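(* Let $N$ be a fixed natural number and let $\mathrm{M}^N_\infty$ be the countable universal $N$-pseudospace, regarded as a structure in the language $(<,\mathcal{A}_{-1},\mathcal{A}_0,\ldots,\mathcal{A}_{N+1})$. The complete first-order theory of $\mathrm{M}^N_\infty$ is axiomatised by the following axioms on a structure $M$: 1. $M$ is an $N$-geometry; 2. $M$ is a simply connected lattice; 3. for all $a<b$ in $M$ and every $s$ (strictly) between the indices of the layers of $a$ and $b$, there are infinitely many $x\in\mathcal{A}_s$ with $a<x<b$.
   Context: Zigzags. Let $V$ be a lattice. An alternating sequence of length $n\ge 0$ is a sequence $x_0,\ldots,x_n$ of elements of $V$ such that $x_i\le x_{i+1}$ and $x_i\ge x_{i+1}$ hold alternatingly; the elements at lower positions are called sinks, those at upper positions peaks. A zigzag is an alternating sequence in which consecutive elements are distinct, $x_i=\inf(x_{i-1},x_{i+1})$ for every sink $x_i$ with $0<i<n$, and $x_i=\sup(x_{i-1},x_{i+1})$ for every peak $x_i$ with $0<i<n$. A zigzag cycle is a zigzag $x_0,\ldots,x_{2n}$ with $n\geq 1$ and $x_0=x_{2n}$ satisfying the zigzag condition with indices modulo $2n$, i.e. also $x_0=\inf(x_{2n-1},x_1)$ if $x_0$ is a sink, respectively $x_0=\sup(x_{2n-1},x_1)$ if $x_0$ is a peak. A lattice is simply connected if it contains no zigzag cycles. $N$-geometries. An $N$-geometry is a structure $(V,<,\mathcal{A}_{-1},\mathcal{A}_0,\ldots,\mathcal{A}_{N+1})$, where $(V,<)$ is a partial order with smallest element $\mathbf{0}$ and largest element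 $\mathbf{1}$, the layers $\mathcal{A}_s$ form a partition of $V$ (layers may be empty), $x\in\mathcal{A}_s$, $y\in\mathcal{A}_t$ and $x<y$ imply $s<t$, and $\mathbf{0}\in\mathcal{A}_{-1}$, $\mathbf{1}\in\mathcal{A}_{N+1}$. Simple extensions. Let $a<b$ be elements of an $N$-geometry $V$ and $s$ the index of a layer strictly between the layers of $a$ and $b$. There is a unique extension $V(x)=V\cup\{x\}$ with $x\notin V$, $x\in\mathcal{A}_s$ and, for all $c\in V$: $c<x\Leftrightarrow c\le a$, and $x<c\Leftrightarrow b\le c$. Such an extension is called simple, of type $(a,b,s)$. The countable universal $N$-pseudospace $\mathrm{M}^N_\infty$ is the $N$-geometry obtained as the union of a countable sequence $V_0\subset V_1\subset\cdots$ of simple extensions $V_{i+1}=V_i(x_i)$, starting from $V_0=\{\mathbf{0},\mathbf{1}\}$ (with $\mathbf 0\in\mathcal A_{-1}$, $\mathbf 1\in\mathcal A_{N+1}$), such that every possible type $(a,b,s)$ with $a,b\in\mathrm{M}^N_\infty$ is used infinitely often. Up to isomorphism it does not depend on the choice of the sequence. *)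

theory Defs
  imports "HOL-Algebra.Lattice" "HOL-Library.Disjoint_Sets"
begin

section \<open>Structures in the language of \<open>N\<close>-geometries\<close>

text \<open>
  A structure consists of a universe (the field \<open>carrier\<close>), a binary relation and unary predicates
  indexed by the integers. Only their values on the carrier matter, and for fixed \<open>N\<close> the only
  predicates that belong to the language are those with index in \<open>{-1..N + 1}\<close>.
\<close>

record 'a layered = "'a partial_object" +
  lt :: "'a \<Rightarrow> 'a \<Rightarrow> bool"
  lay :: "int \<Rightarrow> 'a \<Rightarrow> bool"

abbreviation indices :: "nat \<Rightarrow> int set" where
  "indices N \<equiv> {-1..int N + 1}"

definition layer :: "'a layered \<Rightarrow> int \<Rightarrow> 'a set" where
  "layer M s = {x \<in> carrier M. lay M s x}"

definition order_of :: "'a layered \<Rightarrow> 'a gorder" where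
  "order_of M = \<lparr>carrier = carrier M, eq = (=), le = (\<lambda>x y. x = y \<or> lt M x y)\<rparr>"

section \<open>First-order logic\<close>

text \<open>Variables are named by natural numbers; \<open>LayerAt s i\<close> says that the value of
  variable \<open>i\<close> is in the layer with index \<open>s\<close>.\<close>

datatype fm =
    LessThan nat nat
  | Equal nat nat
  | LayerAt int nat
  | Neg fm
  | Conj fm fm
  | Exi nat fm

primrec free_vars :: "fm \<Rightarrow> nat set" where
  "free_vars (LessThan i j) = {i, j}"
| "free_vars (Equal i j) = {i, j}"
| "free_vars (LayerAt s i) = {i}"
| "free_vars (Neg \<phi>) = free_vars \<phi>"
| "free_vars (Conj \<phi> \<psi>) = free_vars \<phi> \<union> free_vars \<psi>"
| "free_vars (Exi i \<phi>) = free_vars \<phi> - {i}"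

primrec layer_symbols :: "fm \<Rightarrow> int set" where
  "layer_symbols (LessThan i j) = {}"
| "layer_symbols (Equal i j) = {}"
| "layer_symbols (LayerAt s i) = {s}"
| "layer_symbols (Neg \<phi>) = layer_symbols \<phi>"
| "layer_symbols (Conj \<phi> \<psi>) = layer_symbols \<phi> \<union> layer_symbols \<psi>"
| "layer_symbols (Exi i \<phi>) = layer_symbols \<phi>"

primrec sat :: "'a layered \<Rightarrow> (nat \<Rightarrow> 'a) \<Rightarrow> fm \<Rightarrow> bool" where
  "sat M v (LessThan i j) \<longleftrightarrow> lt M (v i) (v j)"
| "sat M v (Equal i j) \<longleftrightarrow> v i = v j"
| "sat M v (LayerAt s i) \<longleftrightarrow> v i \<in> layer M s"
| "sat M v (Neg \<phi>) \<longleftrightarrow> \<not> sat M v \<phi>"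
| "sat M v (Conj \<phi> \<psi>) \<longleftrightarrow> sat M v \<phi> \<and> sat M v \<psi>"
| "sat M v (Exi i \<phi>) \<longleftrightarrow> (\<exists>x\<in>carrier M. sat M (v(i := x)) \<phi>)"

definition sentence :: "nat \<Rightarrow> fm \<Rightarrow> bool" where
  "sentence N \<phi> \<longleftrightarrow> free_vars \<phi> = {} \<and> layer_symbols \<phi> \<subseteq> indices N"

definition holds_in :: "'a layered \<Rightarrow> fm \<Rightarrow> bool" where
  "holds_in M \<phi> \<longleftrightarrow> (\<forall>v. range v \<subseteq> carrier M \<longrightarrow> sat M v \<phi>)"

definition complete_theory :: "nat \<Rightarrow> 'a layered \<Rightarrow> fm set" where
  "complete_theory N M = {\<phi>. sentence N \<phi> \<and> holds_in M \<phi>}"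

definition is_model_of :: "'a layered \<Rightarrow> fm set \<Rightarrow> bool" where
  "is_model_of M T \<longleftrightarrow> (\<forall>\<phi>\<in>T. holds_in M \<phi>)"

section \<open>Zigzags\<close>

text \<open>
  An alternating sequence of length \<open>n\<close> is given by the values \<open>x 0, \<dots>, x n\<close> of a function on
  the natural numbers. The flag \<open>up\<close> says whether \<open>x 0\<close> is a sink, so that the sinks
  are the terms \<open>x i\<close> for which \<open>is_sink up i\<close> holds and the others are the peaks.
\<close>

definition is_sink :: "bool \<Rightarrow> nat \<Rightarrow> bool" where
  "is_sink up i \<longleftrightarrow> (even i \<longleftrightarrow> up)"

definition alternating :: "'a gorder \<Rightarrow> bool \<Rightarrow> nat \<Rightarrow> (nat \<Rightarrow> 'a) \<Rightarrow> bool" where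
  "alternating L up n x \<longleftrightarrow>
     (\<forall>i\<le>n. x i \<in> carrier L) \<and>
     (\<forall>i<n. if is_sink up i then x i \<sqsubseteq>\<^bsub>L\<^esub> x (i + 1) else x (i + 1) \<sqsubseteq>\<^bsub>L\<^esub> x i)"

definition zigzag :: "'a gorder \<Rightarrow> bool \<Rightarrow> nat \<Rightarrow> (nat \<Rightarrow> 'a) \<Rightarrow> bool" where
  "zigzag L up n x \<longleftrightarrow>
     alternating L up n x \<and>
     (\<forall>i<n. x i \<noteq> x (i + 1)) \<and>
     (\<forall>i. 0 < i \<and> i < n \<longrightarrow>
        x i = (if is_sink up i then x (i - 1) \<sqinter>\<^bsub>L\<^esub> x (i + 1) else x (i - 1) \<squnion>\<^bsub>L\<^esub> x (i + 1)))"

definition zigzag_cycle :: "'a gorder \<Rightarrow> bool \<Rightarrow> nat \<Rightarrow> (nat \<Rightarrow> 'a) \<Rightarrow> bool" where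
  "zigzag_cycle L up n x \<longleftrightarrow>
     n \<ge> 1 \<and> zigzag L up (2 * n) x \<and> x 0 = x (2 * n) \<and>
     x 0 = (if is_sink up 0 then x (2 * n - 1) \<sqinter>\<^bsub>L\<^esub> x 1 else x (2 * n - 1) \<squnion>\<^bsub>L\<^esub> x 1)"

definition simply_connected :: "'a gorder \<Rightarrow> bool" where
  "simply_connected L \<longleftrightarrow> \<not> (\<exists>up n x. zigzag_cycle L up n x)"

section \<open>\<open>N\<close>-geometries and the universal \<open>N\<close>-pseudospace\<close>

definition N_geometry :: "nat \<Rightarrow> 'a layered \<Rightarrow> bool" where
  "N_geometry N M \<longleftrightarrow>
     irreflp_on (carrier M) (lt M) \<and> transp_on (carrier M) (lt M) \<and>
     (\<Union>s\<in>indices N. layer M s) = carrier M \<and> disjoint_family_on (layer M) (indices N) \<and>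
     (\<forall>s\<in>indices N. \<forall>t\<in>indices N. \<forall>x\<in>layer M s. \<forall>y\<in>layer M t. lt M x y \<longrightarrow> s < t) \<and>
     (\<exists>z. least (order_of M) z (carrier M) \<and> z \<in> layer M (-1)) \<and>
     (\<exists>u. greatest (order_of M) u (carrier M) \<and> u \<in> layer M (int N + 1))"

definition possible_type :: "nat \<Rightarrow> 'a layered \<Rightarrow> 'a \<Rightarrow> 'a \<Rightarrow> int \<Rightarrow> bool" where
  "possible_type N M a b s \<longleftrightarrow>
     lt M a b \<and>
     (\<exists>p\<in>indices N. \<exists>q\<in>indices N. a \<in> layer M p \<and> b \<in> layer M q \<and> p < s \<and> s < q)"

definition substructure :: "nat \<Rightarrow> 'a layered \<Rightarrow> 'a layered \<Rightarrow> bool" where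
  "substructure N V M \<longleftrightarrow>
     carrier V \<subseteq> carrier M \<and>
     (\<forall>c\<in>carrier V. \<forall>d\<in>carrier V. lt V c d \<longleftrightarrow> lt M c d) \<and>
     (\<forall>s\<in>indices N. layer V s = layer M s \<inter> carrier V)"

definition simple_extension ::
  "nat \<Rightarrow> 'a layered \<Rightarrow> 'a layered \<Rightarrow> 'a \<Rightarrow> 'a \<times> 'a \<times> int \<Rightarrow> bool" where
  "simple_extension N V W x = (\<lambda>(a, b, s).
     N_geometry N V \<and> N_geometry N W \<and> possible_type N V a b s \<and>
     substructure N V W \<and> x \<notin> carrier V \<and> carrier W = insert x (carrier V) \<and> x \<in> layer W s \<and>
     (\<forall>c\<in>carrier V. (lt W c x \<longleftrightarrow> c = a \<or> lt V c a) \<and> (lt W x c \<longleftrightarrow> b = c \<or> lt V b c)))"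

text \<open>
  \<open>universal_pseudospace N M\<close> says that \<open>M\<close> is (a copy, inside the type \<open>'a\<close>, of) the countable
  universal \<open>N\<close>-pseudospace, which is unique up to isomorphism. An \<open>N\<close>-geometry with two elements
  consists of \<open>0\<close>, in layer \<open>-1\<close>, and \<open>1\<close>, in layer \<open>N + 1\<close>.
\<close>

definition universal_pseudospace :: "nat \<Rightarrow> 'a layered \<Rightarrow> bool" where
  "universal_pseudospace N M \<longleftrightarrow> (\<exists>(V :: nat \<Rightarrow> 'a layered) x \<tau>.
     N_geometry N (V 0) \<and> card (carrier (V 0)) = 2 \<and>
     (\<forall>i. simple_extension N (V i) (V (Suc i)) (x i) (\<tau> i)) \<and>
     carrier M = (\<Union>i. carrier (V i)) \<and> (\<forall>i. substructure N (V i) M) \<and>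
     (\<forall>a b s. possible_type N M a b s \<longrightarrow> infinite {i. \<tau> i = (a, b, s)}))"

end

theory Submission
  imports Defs
begin

text \<open>
  The crux is that in a simply connected lattice of finite height a zigzag of length at least \<open>2\<close>
  has incomparable endpoints. Call a finite set \<open>A\<close> containing \<open>0\<close> and \<open>1\<close> nice if it contains
  every zigzag between two of its elements. If \<open>A\<close> is nice in a finite sublattice \<open>B \<noteq> A\<close>, some
  element of \<open>B - A\<close> is neither a proper join nor a proper meet in \<open>B\<close>; hence \<open>B\<close> arises from \<open>A\<close> by
  simple extensions. In a model of the axioms every simple extension of a nice set is realised by
  an element that is far, in terms of zigzags, from the set.

  In order to avoid saturated models, niceness is only required up to zigzags with at most \<open>k\<close>
  terms. A \<open>K\<close>-nice set can be extended to a \<open>k\<close>-nice one that contains a given element by adding at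
  most \<open>G\<close> elements, where \<open>K\<close> and \<open>G\<close> depend on \<open>k\<close> only. So isomorphisms between nice finite
  subsets of two models form a back-and-forth system, with \<open>k\<close> decreasing at every move,
  and any two models are elementarily equivalent.
\<close>

section \<open>Zigzags in ranked lattices\<close>

text \<open>Deleting an irreducible w from a finite sublattice B leaves a sublattice, with a
  greatest element a below w and a least element b above w; so the place of w is given by a type (a,
  b, rank of w). Realising this type in the other lattice is delicate, because an element between a
  and b may be linked to the finite set by short zigzags. If the ranks of a and b differ by two, all
  but finitely many candidates are harmless; higher intervals are reduced to lower ones by an
  alternating construction. Two facts make bounded niceness sufficient. The realising element
  preserves k, so any number of simple extensions can be copied within one move. And zigzags have
  distinct terms, so one that joins two points of A through at most G new points has at most G + 2
  terms; hence K has to dominate G + 2, which requires a G that does not depend on A. Conversely,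
  the axioms are schemes of sentences, one for each cycle length and each number of intermediate
  elements. They hold in the universal pseudospace because the youngest entry of a cycle would be a
  join or meet of older elements.\<close>

text \<open>
  The condition on triples forces the sequence to alternate, so no direction is recorded; it is
  also invariant under exchanging \<open>J\<close> and \<open>M\<close>, which makes all arguments dualisable.
  Lists with fewer than three entries satisfy \<open>zig\<close> vacuously.
\<close>

definition tri :: "('a \<Rightarrow> 'a \<Rightarrow> 'a) \<Rightarrow> ('a \<Rightarrow> 'a \<Rightarrow> 'a) \<Rightarrow> 'a \<Rightarrow> 'a \<Rightarrow> 'a \<Rightarrow> bool" where
  "tri J M x y z \<longleftrightarrow> y \<noteq> x \<and> y \<noteq> z \<and> (y = J x z \<or> y = M x z)"

fun zig :: "('a \<Rightarrow> 'a \<Rightarrow> 'a) \<Rightarrow> ('a \<Rightarrow> 'a \<Rightarrow> 'a) \<Rightarrow> 'a list \<Rightarrow> bool" where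
  "zig J M (x # y # z # r) \<longleftrightarrow> tri J M x y z \<and> zig J M (y # z # r)"
| "zig J M _ \<longleftrightarrow> True"

lemma tri_swap: "tri M J = tri J M"
  by (intro ext) (simp add: tri_def disj_commute)

lemma zig_swap: "zig M J = zig J M"
proof
  fix xs
  \<comment> \<open>\<open>zig\<close> inspects three entries at once, so the list with one more
    entry in front is carried along.\<close>
  have "(\<forall>y. zig M J (y # xs) = zig J M (y # xs)) \<and> zig M J xs = zig J M xs"
  proof (induction xs)
    case (Cons x xs)
    have "tri M J a b c = tri J M a b c" for a b c
      by (simp only: tri_swap[of M J])
    with Cons show ?case
      by (cases xs) auto
  qed simp
  then show "zig M J xs = zig J M xs" by blast
qed

text \<open>Each triple of consecutive entries falls into one of the two parts, so an overlap of two
  entries is enough to splice zigzags.\<close>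

lemma zig_glue: "zig J M (xs @ y # z # ys) \<longleftrightarrow> zig J M (xs @ [y, z]) \<and> zig J M (y # z # ys)"
  by (induction J M xs rule: zig.induct) auto

lemma zig_tl: "zig J M (x # xs) \<Longrightarrow> zig J M xs"
  by (cases "(J, M, x # xs)" rule: zig.cases) auto

lemma zig_appendD2: "zig J M (xs @ ys) \<Longrightarrow> zig J M ys"
  by (induction xs) (auto dest: zig_tl)

lemma zig_appendD1: "zig J M (xs @ ys) \<Longrightarrow> zig J M xs"
proof (induction J M xs rule: zig.induct)
  case (1 J M x y z r)
  then show ?case by simp
qed auto

lemma zig_snoc3: "zig J M (xs @ [x, y, z]) \<longleftrightarrow> zig J M (xs @ [x, y]) \<and> tri J M x y z"
  using zig_glue[of J M xs x y "[z]"] by simp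

lemma zig_sub: "zig J M (xs @ ys @ zs) \<Longrightarrow> zig J M ys"
  by (blast dest: zig_appendD1 zig_appendD2)

lemma list_length3E:
  assumes "3 \<le> length xs"
  obtains x y z r where "xs = x # y # z # r"
proof -
  obtain x xs1 where 1: "xs = x # xs1" "2 \<le> length xs1"
    using assms by (cases xs) auto
  obtain y xs2 where 2: "xs1 = y # xs2" "1 \<le> length xs2"
    using 1(2) by (cases xs1) auto
  obtain z r where "xs2 = z # r"
    using 2(2) by (cases xs2) auto
  with 1 2 show ?thesis by (simp add: that)
qed

lemma list_length3_lastE:
  assumes "3 \<le> length xs"
  obtains x y z r where "xs = r @ [x, y, z]"
proof -
  have "3 \<le> length (rev xs)"
    using assms by simp
  then obtain z y x r where "rev xs = z # y # x # r"
    by (rule list_length3E)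
  then have "xs = rev r @ [x, y, z]"
    by (metis append.assoc append_Cons append_Nil rev.simps(2) rev_swap)
  then show ?thesis by (rule that)
qed

text \<open>Isolates an excursion: a failure of niceness can always be cut down to a stretch whose
  ends lie in A and whose interior avoids A completely.\<close>

lemma segment:
  assumes "hd xs \<in> A" "last xs \<in> A" "x \<in> set xs" "x \<notin> A"
  obtains us a ys b vs where "xs = us @ a # ys @ b # vs" "a \<in> A" "b \<in> A" "x \<in> set ys" "set ys \<inter> A = {}"
proof -
  obtain ps qs where xs: "xs = ps @ x # qs"
    using assms(3) by (auto dest: split_list)
  have "ps \<noteq> []" "qs \<noteq> []"
    using assms xs by (auto simp: hd_append)
  then have "\<exists>p\<in>set ps. p \<in> A" "\<exists>q\<in>set qs. q \<in> A"
    using assms(1,2) xs by (auto simp: hd_append intro: last_in_set)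
  then obtain p1 a p2 q1 b q2 where "ps = p1 @ a # p2" "a \<in> A" "\<forall>y\<in>set p2. y \<notin> A"
      "qs = q1 @ b # q2" "b \<in> A" "\<forall>y\<in>set q1. y \<notin> A"
    using split_list_last_prop[of ps "\<lambda>y. y \<in> A"] split_list_first_prop[of qs "\<lambda>y. y \<in> A"] by metis
  then show ?thesis
    using that[of p1 a "p2 @ x # q1" b q2] xs assms(4) by auto
qed

text \<open>Ranks are integers bounded in absolute value, so that negation gives the rank of the
  order dual. A cycle is a list that repeats its first two entries at the end: every cyclic triple
  is then an ordinary triple of the list.\<close>

locale ranked_lattice =
  fixes C :: "'a set"
    and le :: "'a \<Rightarrow> 'a \<Rightarrow> bool" (infix \<open>\<preceq>\<close> 50)
    and jn :: "'a \<Rightarrow> 'a \<Rightarrow> 'a" (infixl \<open>\<triangle>\<close> 65)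
    and mt :: "'a \<Rightarrow> 'a \<Rightarrow> 'a" (infixl \<open>\<triangleright>\<close> 65)
    and bt tp :: 'a
    and rk :: "'a \<Rightarrow> int"
    and H :: nat
  assumes refl: "x \<in> C \<Longrightarrow> x \<preceq> x"
    and antisym: "x \<in> C \<Longrightarrow> y \<in> C \<Longrightarrow> x \<preceq> y \<Longrightarrow> y \<preceq> x \<Longrightarrow> x = y"
    and trans: "x \<in> C \<Longrightarrow> y \<in> C \<Longrightarrow> z \<in> C \<Longrightarrow> x \<preceq> y \<Longrightarrow> y \<preceq> z \<Longrightarrow> x \<preceq> z"
    and jn_closed [simp]: "x \<in> C \<Longrightarrow> y \<in> C \<Longrightarrow> jn x y \<in> C"
    and jn_ub1 [simp]: "x \<in> C \<Longrightarrow> y \<in> C \<Longrightarrow> x \<preceq> jn x y"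
    and jn_ub2 [simp]: "x \<in> C \<Longrightarrow> y \<in> C \<Longrightarrow> y \<preceq> jn x y"
    and jn_least: "x \<in> C \<Longrightarrow> y \<in> C \<Longrightarrow> z \<in> C \<Longrightarrow> x \<preceq> z \<Longrightarrow> y \<preceq> z \<Longrightarrow> jn x y \<preceq> z"
    and mt_closed [simp]: "x \<in> C \<Longrightarrow> y \<in> C \<Longrightarrow> mt x y \<in> C"
    and mt_lb1 [simp]: "x \<in> C \<Longrightarrow> y \<in> C \<Longrightarrow> mt x y \<preceq> x"
    and mt_lb2 [simp]: "x \<in> C \<Longrightarrow> y \<in> C \<Longrightarrow> mt x y \<preceq> y"
    and mt_greatest: "x \<in> C \<Longrightarrow> y \<in> C \<Longrightarrow> z \<in> C \<Longrightarrow> z \<preceq> x \<Longrightarrow> z \<preceq> y \<Longrightarrow> z \<preceq> mt x y"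
    and bt [simp]: "bt \<in> C" "x \<in> C \<Longrightarrow> bt \<preceq> x"
    and tp [simp]: "tp \<in> C" "x \<in> C \<Longrightarrow> x \<preceq> tp"
    and rk_less: "x \<in> C \<Longrightarrow> y \<in> C \<Longrightarrow> x \<preceq> y \<Longrightarrow> x \<noteq> y \<Longrightarrow> rk x < rk y"
    and rk_bound: "x \<in> C \<Longrightarrow> \<bar>rk x\<bar> \<le> int H"
    and no_cycle: "set (p # q # xs) \<subseteq> C \<Longrightarrow> xs \<noteq> [] \<Longrightarrow> \<not> zig jn mt (p # q # xs @ [p, q])"
begin

text \<open>Statements about peaks or upward steps are proved once; their mirror images are
  instances of them in this dual structure.\<close>

lemma dual: "ranked_lattice C (\<lambda>x y. y \<preceq> x) mt jn tp bt (\<lambda>x. - rk x) H"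
  using no_cycle
  by unfold_locales (auto simp: zig_swap intro: antisym trans refl jn_least mt_greatest rk_less rk_bound
      simp del: set_simps)

lemma le_jn: "x \<in> C \<Longrightarrow> y \<in> C \<Longrightarrow> jn x y = y \<longleftrightarrow> x \<preceq> y"
  by (metis antisym jn_closed jn_least jn_ub1 jn_ub2 refl)

lemma le_mt: "x \<in> C \<Longrightarrow> y \<in> C \<Longrightarrow> mt x y = x \<longleftrightarrow> x \<preceq> y"
  by (metis antisym mt_closed mt_greatest mt_lb1 mt_lb2 refl)

lemma jn_comm: "x \<in> C \<Longrightarrow> y \<in> C \<Longrightarrow> jn x y = jn y x"
  by (rule antisym) (auto intro: jn_least)

lemma mt_comm: "x \<in> C \<Longrightarrow> y \<in> C \<Longrightarrow> mt x y = mt y x"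
  by (rule antisym) (auto intro: mt_greatest)

lemma tri_sym: "x \<in> C \<Longrightarrow> z \<in> C \<Longrightarrow> tri jn mt x y z \<longleftrightarrow> tri jn mt z y x"
  by (auto simp: tri_def jn_comm[of z x] mt_comm[of z x])

lemma zig_rev:
  assumes "zig jn mt xs" "set xs \<subseteq> C"
  shows "zig jn mt (rev xs)"
  using assms
proof (induction xs rule: induct_list012)
  case (3 x y zs)
  show ?case
  proof (cases zs)
    case (Cons z r)
    then have "zig jn mt (rev r @ [z, y])" "tri jn mt z y x"
      using 3 by (auto simp: tri_sym)
    then show ?thesis
      using Cons by (simp add: zig_snoc3)
  qed simp
qed auto

text \<open>If y were the meet of x and z, it would lie below x and hence equal x. So a single
  comparison decides that the middle term is a peak.\<close>

lemma tri_peak: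
  assumes "x \<in> C" "y \<in> C" "z \<in> C" "tri jn mt x y z" "x \<preceq> y"
  shows "z \<preceq> y \<and> y = jn x z"
  using assms unfolding tri_def by (metis jn_ub2 mt_lb1 antisym)

lemma tri_comparable:
  assumes "x \<in> C" "z \<in> C" "tri jn mt x y z"
  shows "y \<in> C" "x \<preceq> y \<or> y \<preceq> x" "x \<noteq> y" "y \<noteq> z"
  using assms by (auto simp: tri_def)

end

lemma (in ranked_lattice) tri_sink:
  assumes "x \<in> C" "y \<in> C" "z \<in> C" "tri jn mt x y z" "y \<preceq> x"
  shows "y \<preceq> z \<and> y = mt x z"
  using ranked_lattice.tri_peak[OF dual, of x y z] assms by (simp add: tri_swap)

section \<open>Incomparability of the ends of a zigzag\<close>

context ranked_lattice
begin

text \<open>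
  In a shortest zigzag \<open>x0, x1, \<dots>, y, z\<close> with \<open>x0 \<preceq> z\<close>, the last term can be lowered to
  \<open>p = x0 \<squnion> y\<close> and the first one raised to \<open>q = p \<sqinter> x1\<close>, which closes the zigzag to a cycle.
\<close>

lemma no_comparable_ends_aux:
  assumes xs: "zig jn mt xs" "set xs \<subseteq> C" "3 \<le> length xs" "hd xs \<preceq> last xs"
    and IH: "\<And>ys. length ys < length xs \<Longrightarrow> zig jn mt ys \<Longrightarrow> set ys \<subseteq> C \<Longrightarrow> 3 \<le> length ys \<Longrightarrow>
      \<not> hd ys \<preceq> last ys \<and> \<not> last ys \<preceq> hd ys"
  shows False
proof -
  obtain x0 x1 x2 r where r: "xs = x0 # x1 # x2 # r"
    using list_length3E[OF xs(3)] .
  obtain yl y z r' where r': "xs = r' @ [yl, y, z]"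
    using list_length3_lastE[OF xs(3)] .
  have C: "x0 \<in> C" "x1 \<in> C" "x2 \<in> C"
    using xs(2) by (auto simp: r)
  have C': "yl \<in> C" "y \<in> C" "z \<in> C"
    using xs(2) by (auto simp: r')
  note C = C C'
  have t0: "tri jn mt x0 x1 x2"
    using xs(1) by (simp add: r)
  have tn: "tri jn mt yl y z"
    using xs(1) by (simp add: r' zig_snoc3)
  have "hd xs = x0" "last xs = z"
    by (simp add: r) (simp add: r')
  then have x0z: "x0 \<preceq> z"
    using xs(4) by simp
  show False
  proof (cases "r = []")
    \<comment> \<open>With three terms the middle one is a join or meet of comparable elements,
      hence equal to one of them.\<close>
    case True
    then have "r' = []" "yl = x0" "y = x1" "z = x2"
      using r r' by auto
    then show False
      using t0 x0z C unfolding tri_def by (metis le_jn le_mt)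
  next
    case False
    then obtain s where s: "r' = x0 # s"
      using r r' by (cases r') auto
    have xs1: "x1 # x2 # r = s @ [yl, y, z]"
      using r r' s by auto
    have xs2: "xs = (x0 # s @ [yl, y]) @ [z]"
      using r' s by simp
    have "last (x1 # x2 # r) = z"
      by (simp only: xs1) simp
    \<comment> \<open>The tail starting at x1 and the initial part ending at y are shorter zigzags,
      so their ends are incomparable. Together with x0 \<preceq> z this makes x1 a peak and y a
      sink.\<close>
    then have nle1: "\<not> x1 \<preceq> z"
      using IH[of "x1 # x2 # r"] xs(1,2) False r by (cases r) auto
    have nle2: "\<not> x0 \<preceq> y"
      using IH[of "x0 # s @ [yl, y]"] xs(1,2) zig_appendD1[of jn mt "x0 # s @ [yl, y]" "[z]"] xs2
      by auto
    have x01: "x0 \<preceq> x1"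
      using tri_comparable(2)[OF C(1,3) t0] trans[of x1 x0 z] C x0z nle1 by metis
    have yz: "y \<preceq> z"
      using tri_comparable(2)[of z yl y] tri_sym[of yl z y] tn trans[of x0 z y] C x0z nle2 by metis
    have yyl: "y \<preceq> yl" "y = mt yl z"
      using tri_sink[of z y yl] tri_sym[of yl z y] tn yz C mt_comm by auto
    have x2x1: "x1 = jn x0 x2"
      using tri_peak[of x0 x1 x2] t0 x01 C by auto
    define p where "p = jn x0 y"
    define q where "q = mt p x1"
    have pC: "p \<in> C" "q \<in> C"
      using C by (auto simp: p_def q_def)
    have pz: "p \<preceq> z"
      using jn_least C x0z yz p_def by auto
    have ypz: "y = mt yl p"
      by (rule antisym)
        (use C pC yyl pz trans[of "mt yl p" p z] in \<open>auto simp: p_def intro: mt_greatest\<close>)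
    have x0q: "x0 \<preceq> q"
      using C x01 pC(1) by (auto simp: q_def p_def intro: mt_greatest)
    have qx1: "x1 = jn q x2"
    proof (rule antisym)
      have "x0 \<preceq> jn q x2"
        by (rule trans[of _ q]) (use C pC x0q in auto)
      then show "x1 \<preceq> jn q x2"
        unfolding x2x1 using C pC by (intro jn_least) auto
      show "jn q x2 \<preceq> x1"
        using C pC x2x1 by (intro jn_least) (auto simp: q_def)
    qed (use C pC in auto)
    have py: "p = jn y q"
    proof (rule antisym)
      have "x0 \<preceq> jn y q"
        by (rule trans[of _ q]) (use C pC x0q in auto)
      then show "p \<preceq> jn y q"
        unfolding p_def using C pC by (intro jn_least) auto
      show "jn y q \<preceq> p"
        using C pC by (intro jn_least) (auto simp: q_def p_def)
    qed (use C pC in auto)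
    have "q \<noteq> x1"
      using nle1 trans[of x1 p z] C pC pz by (auto simp: q_def le_mt[symmetric] mt_comm)
    have "s \<noteq> []"
    proof
      assume "s = []"
      then have "yl = x1" "y = x2" using xs1 by auto
      then have "x1 \<preceq> z"
        using x2x1 C x0z yz by (auto intro: jn_least)
      then show False using nle1 by simp
    qed
    then obtain s' where s': "s = x1 # s'"
      using xs1 by (cases s) auto
    have zmid: "zig jn mt (x1 # s' @ [yl, y])"
      using xs(1) xs2 s' zig_sub[of jn mt "[x0]" "x1 # s' @ [yl, y]" "[z]"] by simp
    \<comment> \<open>If q were p, then y \<preceq> p would lie below x1, and the shorter zigzag
      from x1 to y would have comparable ends.\<close>
    have "\<not> y \<preceq> x1"
      using IH[of "x1 # s' @ [yl, y]"] zmid xs(2) xs2 s' by auto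
    then have "q \<noteq> p"
      using C pC py le_mt[of p x1] trans[of y p x1] by (metis jn_ub1 q_def)
    have "p \<noteq> y"
      using nle2 C by (auto simp: p_def le_jn)
    have x2eq: "x2 = hd (s' @ [yl, y])"
      using xs1 s' by (cases s') auto
    obtain w where w: "s' @ [yl, y] = x2 # w"
      using x2eq by (cases "s' @ [yl, y]") auto
    have "x1 \<noteq> x2"
      using t0 by (simp add: tri_def)
    have "zig jn mt (q # x1 # x2 # w)"
      using zmid w qx1 \<open>q \<noteq> x1\<close> \<open>x1 \<noteq> x2\<close> C pC by (auto simp: tri_def)
    moreover have "tri jn mt p q x1"
      using \<open>q \<noteq> p\<close> \<open>q \<noteq> x1\<close> by (simp add: tri_def q_def)
    ultimately have "zig jn mt (p # q # x1 # s' @ [yl, y])"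
      using w by simp
    moreover have "tri jn mt yl y p" "tri jn mt y p q"
      using ypz py tn \<open>p \<noteq> y\<close> \<open>q \<noteq> p\<close> by (auto simp: tri_def)
    \<comment> \<open>Around the closing point, y is the meet of yl and p, p the join of y and q, q
      the meet of p and x1, and x1 the join of q and x2.\<close>
    ultimately have "zig jn mt (p # q # (x1 # s' @ [yl, y]) @ [p, q])"
      using zig_snoc3[of jn mt "p # q # x1 # s'" yl y p] zig_snoc3[of jn mt "p # q # x1 # s' @ [yl]" y p q]
      by simp
    moreover have "set (p # q # (x1 # s' @ [yl, y])) \<subseteq> C"
      using xs(2) xs2 s' pC by auto
    ultimately show False
      using no_cycle by blast
  qed
qed

lemma no_comparable_ends:
  assumes "zig jn mt xs" "set xs \<subseteq> C" "3 \<le> length xs"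
  shows "\<not> hd xs \<preceq> last xs \<and> \<not> last xs \<preceq> hd xs"
  using assms
proof (induction xs rule: length_induct)
  case (1 xs)
  have "\<not> hd xs \<preceq> last xs"
    using no_comparable_ends_aux[of xs] 1 by blast
  moreover have "xs \<noteq> []"
    using 1 by auto
  then have "\<not> last xs \<preceq> hd xs"
    using no_comparable_ends_aux[of "rev xs"] zig_rev[of xs] 1 by (auto simp: hd_rev last_rev)
  ultimately show ?case by simp
qed

text \<open>A repeated entry cuts out a zigzag with equal, hence comparable, ends. Adjacent
  repetitions are excluded by a triple containing them, taken on whichever side has a third
  entry.\<close>

lemma zig_distinct:
  assumes "zig jn mt xs" "set xs \<subseteq> C" "3 \<le> length xs"
  shows "distinct xs"
proof -
  have "x \<notin> set ys" if xs: "xs = us @ x # ys" for us x ys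
  proof
    assume "x \<in> set ys"
    then obtain vs ws where ys: "ys = vs @ x # ws"
      by (auto dest: split_list)
    show False
    proof (cases "vs = []")
      case False
      then have "3 \<le> length (x # vs @ [x])"
        by (cases vs) auto
      then show False
        using no_comparable_ends[of "x # vs @ [x]"] zig_sub[of jn mt us "x # vs @ [x]" ws]
          assms(1,2) xs ys refl by auto
    next
      case True
      then have xs': "xs = us @ x # x # ws"
        using xs ys by simp
      show False
      proof (cases ws)
        case (Cons w ws')
        then have "tri jn mt x x w"
          using zig_appendD2[of jn mt us "x # x # w # ws'"] assms(1) xs' by simp
        then show False by (simp add: tri_def)
      next
        case Nil
        then obtain u us' where "us = us' @ [u]"
          using assms(3) xs' by (cases us rule: rev_cases) auto
        then have "tri jn mt u x x"
          using assms(1) xs' Nil zig_snoc3[of jn mt us' u x x] by simp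
        then show False by (simp add: tri_def)
      qed
    qed
  qed
  note no_repeat = this
  show ?thesis
  proof (rule ccontr)
    assume "\<not> distinct xs"
    then obtain as x bs cs where "xs = as @ [x] @ bs @ [x] @ cs"
      using not_distinct_decomp by blast
    then show False
      using no_repeat[of as x "bs @ x # cs"] by simp
  qed
qed

end

section \<open>Irreducible elements over a nice subset\<close>

definition sublat :: "('a \<Rightarrow> 'a \<Rightarrow> 'a) \<Rightarrow> ('a \<Rightarrow> 'a \<Rightarrow> 'a) \<Rightarrow> 'a set \<Rightarrow> bool" where
  "sublat J M B \<longleftrightarrow> (\<forall>x\<in>B. \<forall>y\<in>B. J x y \<in> B \<and> M x y \<in> B)"

definition nice :: "('a \<Rightarrow> 'a \<Rightarrow> 'a) \<Rightarrow> ('a \<Rightarrow> 'a \<Rightarrow> 'a) \<Rightarrow> 'a set \<Rightarrow> 'a set \<Rightarrow> bool" where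
  "nice J M B A \<longleftrightarrow> (\<forall>xs. zig J M xs \<longrightarrow> set xs \<subseteq> B \<longrightarrow> 3 \<le> length xs \<longrightarrow>
     hd xs \<in> A \<longrightarrow> last xs \<in> A \<longrightarrow> set xs \<subseteq> A)"

text \<open>The bounds are those of B, not of C: the induction in \<open>exists_irred\<close> passes
  to the part of B above an element, whose bottom is that element.\<close>

definition extends :: "('a \<Rightarrow> 'a \<Rightarrow> bool) \<Rightarrow> ('a \<Rightarrow> 'a \<Rightarrow> 'a) \<Rightarrow> ('a \<Rightarrow> 'a \<Rightarrow> 'a) \<Rightarrow> 'a set \<Rightarrow> 'a set \<Rightarrow> bool" where
  "extends R J M B A \<longleftrightarrow> finite B \<and> sublat J M B \<and> A \<subseteq> B \<and> nice J M B A \<and>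
     (\<exists>z\<in>A. \<forall>x\<in>B. R z x) \<and> (\<exists>z\<in>A. \<forall>x\<in>B. R x z)"

text \<open>For a sublattice B this is what allows w to be deleted: no join or meet of other
  elements yields w.\<close>

definition irred :: "('a \<Rightarrow> 'a \<Rightarrow> 'a) \<Rightarrow> ('a \<Rightarrow> 'a \<Rightarrow> 'a) \<Rightarrow> 'a set \<Rightarrow> 'a \<Rightarrow> bool" where
  "irred J M B w \<longleftrightarrow> (\<forall>u\<in>B. \<forall>v\<in>B. \<not> tri J M u w v)"

lemma extends_swap: "extends (\<lambda>x y. R y x) M J = extends R J M"
  by (intro ext) (auto simp: extends_def sublat_def nice_def zig_swap[of M J])

lemma irred_swap: "irred M J = irred J M"
  by (intro ext) (simp add: irred_def tri_swap[of M J])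

context ranked_lattice
begin

text \<open>
  If \<open>y\<close> is the meet of \<open>x\<close> with \<open>n\<close> but not with \<open>a\<close>, then a zigzag that starts \<open>a, n, m\<close> can be
  lowered at \<open>a\<close> and prolonged by an element below \<open>x\<close>.
\<close>

lemma cap:
  assumes C: "x \<in> C" "y \<in> C" "a \<in> C" "n \<in> C" "m \<in> C"
    and y: "y \<preceq> x" "y \<preceq> a" "y \<preceq> n" "y \<preceq> m" "mt x n = y" "n \<noteq> y" "a = y \<or> mt x a \<noteq> y"
    and z: "zig jn mt (a # n # m # r)"
  defines "a' \<equiv> jn (mt x a) n"
  shows "y \<preceq> mt x a'" "n \<preceq> a'" "zig jn mt (mt x a' # a' # n # m # r)"
proof -
  have t: "tri jn mt a n m"
    using z by simp
  have "a \<noteq> y"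
  proof
    assume "a = y"
    then have "n = jn y m"
      using tri_peak[of a n m] C t y by simp
    then have "n = m"
      using le_jn[of y m] C y by simp
    then show False
      using t by (simp add: tri_def)
  qed
  define a1 where "a1 = mt x a"
  have a1: "a1 \<in> C" "y \<preceq> a1" "a1 \<noteq> y" "a1 \<preceq> x" "a1 \<preceq> a"
    using \<open>a \<noteq> y\<close> y C by (auto simp: a1_def intro: mt_greatest)
  have na: "n \<preceq> a"
  proof (rule ccontr)
    assume "\<not> n \<preceq> a"
    then have "a \<preceq> n"
      using tri_comparable(2)[of a m n] t C by simp
    then have "a1 \<preceq> mt x n"
      using trans[of a1 a n] a1 C by (auto intro: mt_greatest)
    then show False
      using a1 y C antisym[of a1 y] by simp
  qed
  have nm: "n = mt a m" "n \<preceq> m"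
    using tri_sink[of a n m] t C na by auto
  have a': "a' \<in> C" "a' \<preceq> a" "n \<preceq> a'" "a1 \<preceq> a'"
    using a1 C na by (auto simp: a'_def a1_def[symmetric] intro: jn_least)
  define y1 where "y1 = mt x a'"
  have y1: "y1 \<in> C" "a1 \<preceq> y1" "y1 \<preceq> a'" "y1 \<preceq> x"
    using a' a1 C by (auto simp: y1_def intro: mt_greatest)
  show "n \<preceq> a'" by fact
  show "y \<preceq> mt x a'"
    using trans[of y a1 y1] a1 y1 C by (simp add: y1_def)
  \<comment> \<open>y1 lies between \<open>mt x a\<close> and a', so enlarging \<open>mt x a\<close>
    to y1 does not change the join with n.\<close>
  have eq: "a' = jn y1 n"
  proof (rule antisym)
    show "a' \<preceq> jn y1 n"
      unfolding a'_def a1_def[symmetric]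
      using a1 y1 C trans[of a1 y1 "jn y1 n"] by (auto intro: jn_least)
    show "jn y1 n \<preceq> a'"
      using y1 a' C by (auto intro: jn_least)
  qed (use a' y1 C in auto)
  have "y1 \<noteq> a'"
  proof
    assume "y1 = a'"
    then have "n \<preceq> x"
      using trans[of n a' x] a' y1 C by simp
    then show False
      using y le_mt[of n x] mt_comm C by auto
  qed
  have "n \<noteq> a'"
  proof
    assume "n = a'"
    then have "a1 \<preceq> mt x n"
      using a' a1 C by (auto intro: mt_greatest)
    then show False
      using a1 y C antisym[of a1 y] by simp
  qed
  have "tri jn mt y1 a' n"
    using eq \<open>y1 \<noteq> a'\<close> \<open>n \<noteq> a'\<close> by (simp add: tri_def)
  moreover have "n = mt a' m"
  proof (rule antisym)
    have "mt a' m \<preceq> mt a m"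
      using a' C trans[of "mt a' m" a' a] by (auto intro: mt_greatest)
    then show "mt a' m \<preceq> n"
      using nm by simp
    show "n \<preceq> mt a' m"
      using a' C nm by (auto intro: mt_greatest)
  qed (use a' C in auto)
  then have "tri jn mt a' n m"
    using \<open>n \<noteq> a'\<close> t by (simp add: tri_def)
  ultimately show "zig jn mt (mt x a' # a' # n # m # r)"
    using z by (simp add: y1_def)
qed

text \<open>
  Here \<open>x, y, w0\<close> are the last terms of a longest zigzag outside \<open>A\<close>. The elements \<open>w > y\<close> with
  \<open>x \<sqinter> w = y\<close> can replace \<open>w0\<close>, so everything below them is comparable with \<open>y\<close> or joins with \<open>y\<close>
  to something smaller. They are the complement of a nice subset of the interval above \<open>y\<close>:
  a zigzag through them would extend at both ends to a zigzag with comparable ends below \<open>x\<close>.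
\<close>

lemma irred_of_sink:
  assumes E: "extends le jn mt B A" "B \<subseteq> C"
    and IH: "\<And>B' A'. card B' < card B \<Longrightarrow> B' \<subseteq> C \<Longrightarrow> extends le jn mt B' A' \<Longrightarrow> A' \<noteq> B' \<Longrightarrow>
      \<exists>w\<in>B' - A'. irred jn mt B' w"
    and y: "y \<in> B" "y \<notin> A" "x \<in> B" "y \<noteq> x" "w0 \<in> B" "w0 \<noteq> y" "mt x w0 = y"
    and NA: "\<And>w. w \<in> B \<Longrightarrow> w \<noteq> y \<Longrightarrow> mt x w = y \<Longrightarrow> w \<notin> A"
    and NE: "\<And>w t. w \<in> B \<Longrightarrow> w \<noteq> y \<Longrightarrow> mt x w = y \<Longrightarrow> t \<in> B \<Longrightarrow> t \<noteq> w \<Longrightarrow> jn y t \<noteq> w"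
  shows "\<exists>w\<in>B - A. irred jn mt B w"
proof -
  have sub: "jn u v \<in> B" "mt u v \<in> B" if "u \<in> B" "v \<in> B" for u v
    using E that by (auto simp: extends_def sublat_def)
  have BC: "u \<in> C" if "u \<in> B" for u
    using E that by auto
  note yC = y(1,3,5)[THEN BC]
  have yx: "y \<preceq> x"
    using y yC mt_lb1[of x w0] by simp
  define B' where "B' = {z \<in> B. y \<preceq> z}"
  \<comment> \<open>Although \<open>mt x y = y\<close>, the element y itself belongs to A', because
    it has to serve as the bottom of B'.\<close>
  define A' where "A' = insert y {z \<in> B'. mt x z \<noteq> y}"
  have B'C: "u \<in> C" "y \<preceq> u" if "u \<in> B'" for u
    using that BC by (auto simp: B'_def)
  have yB': "y \<in> B'"
    using y yC refl by (simp add: B'_def)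
  have w0: "w0 \<in> B'" "w0 \<notin> A'"
    using y yC mt_lb2[of x w0] by (auto simp: B'_def A'_def)
  obtain z0 where z0: "z0 \<in> A" "\<And>u. u \<in> B \<Longrightarrow> z0 \<preceq> u"
    using E by (auto simp: extends_def)
  obtain t0 where t0: "t0 \<in> A" "\<And>u. u \<in> B \<Longrightarrow> u \<preceq> t0"
    using E by (auto simp: extends_def)
  have AB: "A \<subseteq> B"
    using E by (simp add: extends_def)
  \<comment> \<open>The bottom z0 of B is in A and therefore strictly below y; its loss makes B'
    smaller than B.\<close>
  have "z0 \<notin> B'"
    using z0 y yC BC[of z0] AB antisym[of z0 y] by (auto simp: B'_def)
  then have "B' \<subset> B"
    using z0 AB by (auto simp: B'_def)
  then have card: "card B' < card B"
    using E by (auto simp: extends_def intro: psubset_card_mono)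
  have "t0 \<in> A'"
    using t0 AB y yC le_mt[of x t0] BC[of t0] by (auto simp: A'_def B'_def)
  have "sublat jn mt B'"
    unfolding sublat_def B'_def using sub yC BC
    by (auto intro: mt_greatest) (metis jn_ub1 jn_closed trans)
  have "nice jn mt B' A'"
    unfolding nice_def
  proof (intro allI impI, rule ccontr)
    fix xs
    assume xs: "zig jn mt xs" "set xs \<subseteq> B'" "hd xs \<in> A'" "last xs \<in> A'" "\<not> set xs \<subseteq> A'"
    then obtain e where "e \<in> set xs" "e \<notin> A'"
      by blast
    from segment[OF xs(3,4) this] obtain us a ys b vs where
      s: "xs = us @ a # ys @ b # vs" "a \<in> A'" "b \<in> A'" "e \<in> set ys" "set ys \<inter> A' = {}"
      by metis
    have ysB: "set ys \<subseteq> B'" "a \<in> B'" "b \<in> B'"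
      using xs(2) s(1) by auto
    have ys: "n \<in> C \<and> y \<preceq> n \<and> mt x n = y \<and> n \<noteq> y" if "n \<in> set ys" for n
      using that s(5) ysB B'C by (auto simp: A'_def)
    have ab: "a = y \<or> mt x a \<noteq> y" "b = y \<or> mt x b \<noteq> y"
      using s by (auto simp: A'_def)
    have z1: "zig jn mt (a # ys @ [b])"
      using xs(1) s(1) zig_sub[of jn mt us "a # ys @ [b]" vs] by simp
    obtain n m r where nm: "ys @ [b] = n # m # r"
      using s(4) by (cases ys; cases "tl ys") auto
    have n: "n \<in> set ys" "m \<in> B'"
      using nm ysB s(4) by (cases ys; cases "tl ys"; auto)+
    define a' where "a' = jn (mt x a) n"
    define y1 where "y1 = mt x a'"
    note C = yC ysB(2,3)[THEN B'C(1)] ys[OF n(1)]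
    \<comment> \<open>\<open>cap\<close> prolongs the excursion by y1 at its left end and, after
      reversal, by z1 at its right end; both lie below x.\<close>
    have y1: "a' \<in> C" "y1 \<in> C" "y \<preceq> y1" "n \<preceq> a'" "zig jn mt (y1 # a' # ys @ [b])"
      using cap[of x y a n m r] C n(2)[THEN B'C(1)] n(2)[THEN B'C(2)] ysB(2,3)[THEN B'C(2)] yx ab(1) z1 nm
      by (auto simp: a'_def y1_def)
    have "zig jn mt (rev (y1 # a' # ys @ [b]))"
      using y1 ysB(1) C B'C(1) by (intro zig_rev) auto
    then have z2: "zig jn mt (b # rev ys @ [a', y1])"
      by simp
    obtain n' m' r' where nm': "rev ys @ [a', y1] = n' # m' # r'"
      using s(4) by (cases "rev ys"; cases "tl (rev ys)") auto
    have n': "n' \<in> set ys" "m' = a' \<or> m' \<in> set ys"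
    proof -
      obtain n2 s2 where 2: "rev ys = n2 # s2"
        using s(4) by (cases "rev ys") auto
      then have "set ys = insert n2 (set s2)"
        by (metis list.set(2) set_rev)
      then show "n' \<in> set ys" "m' = a' \<or> m' \<in> set ys"
        using nm' 2 by (cases s2; auto)+
    qed
    have m': "m' \<in> C" "y \<preceq> m'"
      using n'(2) ys C y1 trans[of y n a'] by auto
    define b' where "b' = jn (mt x b) n'"
    define z1 where "z1 = mt x b'"
    have b': "b' \<in> C" "z1 \<in> C"
      using C ys[OF n'(1)] by (auto simp: b'_def z1_def)
    have z3: "zig jn mt (z1 # b' # rev ys @ [a', y1])"
      using cap[of x y b n' m' r'] C ys[OF n'(1)] m' ysB(2,3)[THEN B'C(2)] yx ab(2) z2 nm'
      by (auto simp: b'_def z1_def)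
    have z1x: "z1 \<preceq> x"
      using C b' by (simp add: z1_def)
    have setC: "set ys \<subseteq> C"
      using ys by blast
    show False
    \<comment> \<open>As y1 is the meet of x and a', the zigzag can be continued to x unless it ends
      there already. Its other end z1 is below x.\<close>
    proof (cases "y1 = x")
      case True
      then show False
        using no_comparable_ends[OF z3] z1x b' y1 setC by auto
    next
      case False
      have "y1 \<noteq> a'"
        using y1(5) nm by (auto simp: tri_def)
      then have "tri jn mt a' y1 x"
        using False C y1 mt_comm[of x a'] by (simp add: tri_def y1_def)
      then have "zig jn mt (z1 # b' # rev ys @ [a', y1, x])"
        using z3 zig_snoc3[of jn mt "z1 # b' # rev ys"] by simp
      then show False
        using no_comparable_ends[of "z1 # b' # rev ys @ [a', y1, x]"] z1x b' y1 setC C by auto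
    qed
  qed
  moreover have "finite B'" "A' \<subseteq> B'"
    using E yB' by (auto simp: extends_def A'_def B'_def)
  moreover have "y \<in> A'" "\<forall>u\<in>B'. y \<preceq> u" "\<forall>u\<in>B'. u \<preceq> t0"
    using t0 by (auto simp: A'_def B'_def)
  ultimately have "extends le jn mt B' A'"
    using \<open>sublat jn mt B'\<close> \<open>t0 \<in> A'\<close> unfolding extends_def by blast
  then obtain w where w: "w \<in> B'" "w \<notin> A'" "irred jn mt B' w"
    using IH[OF card] w0 B'C by blast
  then have wB: "w \<in> B" "w \<noteq> y" "mt x w = y" "w \<in> C" "y \<preceq> w"
    using w(1,2) B'C[OF w(1)] unfolding A'_def B'_def by blast+
  \<comment> \<open>Irreducibility passes from B' to B. If w is a meet, both factors are above y and
    lie in B'. If w is the join of u and v, it is also the join of \<open>jn y u\<close> and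
    \<open>jn y v\<close>, which are in B' and differ from w by \<open>NE\<close>.\<close>
  have "\<not> tri jn mt u w v" if uv: "u \<in> B" "v \<in> B" for u v
  proof
    assume t: "tri jn mt u w v"
    note C = uv[THEN BC] wB(4) yC(1)
    show False
    proof (cases "w \<preceq> u")
      case True
      then have "w \<preceq> v"
        using tri_sink[of u w v] t C by auto
      then have "u \<in> B'" "v \<in> B'"
        using True trans[of y w] wB C uv by (auto simp: B'_def)
      then show False
        using w(3) t by (simp add: irred_def)
    next
      case False
      then have "u \<preceq> w"
        using tri_comparable(2)[of u v w] t C by auto
      then have vw: "v \<preceq> w" "w = jn u v"
        using tri_peak[of u w v] t C by auto
      have "u \<noteq> w" "v \<noteq> w"
        using t by (auto simp: tri_def)
      then have ne: "jn y u \<noteq> w" "jn y v \<noteq> w"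
        using NE[of w] wB uv by auto
      have "jn (jn y u) (jn y v) = w"
      proof (rule antisym)
        show "jn (jn y u) (jn y v) \<preceq> w"
          using C wB \<open>u \<preceq> w\<close> vw by (auto intro!: jn_least)
        have "u \<preceq> jn (jn y u) (jn y v)"
          by (rule trans[of _ "jn y u"]) (use C in auto)
        moreover have "v \<preceq> jn (jn y u) (jn y v)"
          by (rule trans[of _ "jn y v"]) (use C in auto)
        ultimately show "w \<preceq> jn (jn y u) (jn y v)"
          unfolding vw(2) using C by (intro jn_least) auto
      qed (use C in auto)
      moreover have "jn y u \<in> B'" "jn y v \<in> B'"
        using sub uv y C by (auto simp: B'_def)
      moreover have "tri jn mt (jn y u) w (jn y v)" if "jn (jn y u) (jn y v) = w"
        using ne that[symmetric] by (simp add: tri_def)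
      ultimately show False
        using w(3) by (auto simp: irred_def)
    qed
  qed
  then show ?thesis
    using wB NA[of w] by (auto simp: irred_def)
qed

end

lemma (in ranked_lattice) irred_of_peak:
  assumes "extends le jn mt B A" "B \<subseteq> C"
    and "\<And>B' A'. card B' < card B \<Longrightarrow> B' \<subseteq> C \<Longrightarrow> extends le jn mt B' A' \<Longrightarrow> A' \<noteq> B' \<Longrightarrow>
      \<exists>w\<in>B' - A'. irred jn mt B' w"
    and "y \<in> B" "y \<notin> A" "x \<in> B" "y \<noteq> x" "w0 \<in> B" "w0 \<noteq> y" "jn x w0 = y"
    and "\<And>w. w \<in> B \<Longrightarrow> w \<noteq> y \<Longrightarrow> jn x w = y \<Longrightarrow> w \<notin> A"
    and "\<And>w t. w \<in> B \<Longrightarrow> w \<noteq> y \<Longrightarrow> jn x w = y \<Longrightarrow> t \<in> B \<Longrightarrow> t \<noteq> w \<Longrightarrow> mt y t \<noteq> w"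
  shows "\<exists>w\<in>B - A. irred jn mt B w"
  using ranked_lattice.irred_of_sink[OF dual, of B A y x w0] assms
  by (simp add: extends_swap[where R = le and M = mt and J = jn] irred_swap[where M = mt and J = jn])

context ranked_lattice
begin

text \<open>Take a longest zigzag in B whose terms, except perhaps the first, avoid A, and let x, y,
  w0 be its last terms. Its maximality and the niceness of A yield the hypotheses of
  \<open>irred_of_sink\<close> or \<open>irred_of_peak\<close>, depending on whether y is a sink or
  a peak.\<close>

theorem exists_irred:
  assumes "extends le jn mt B A" "B \<subseteq> C" "A \<noteq> B"
  shows "\<exists>w\<in>B - A. irred jn mt B w"
  using assms
proof (induction "card B" arbitrary: B A rule: less_induct)
  case less
  note IH = less.hyps and E = less.prems(1) and BC = less.prems(2)
  have AB: "A \<subseteq> B" and nice: "nice jn mt B A" and fin: "finite B"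
    using E by (auto simp: extends_def)
  define Z where "Z = {xs. zig jn mt xs \<and> set xs \<subseteq> B \<and> 3 \<le> length xs \<and> set (tl xs) \<inter> A = {}}"
  show ?case
  proof (cases "Z = {}")
    case True
    obtain c where c: "c \<in> B" "c \<notin> A"
      using AB less.prems(3) by blast
    \<comment> \<open>Neither \<open>[u, c, v]\<close> nor its reverse is in Z, so u and v are in A,
      and niceness would put c there too.\<close>
    have "\<not> tri jn mt u c v" if uv: "u \<in> B" "v \<in> B" for u v
    proof
      assume t: "tri jn mt u c v"
      have "[u, c, v] \<notin> Z" "[v, c, u] \<notin> Z"
        using True by auto
      then have "u \<in> A" "v \<in> A"
        using t c uv BC tri_sym[of u v c] by (auto simp: Z_def)
      then show False
        using nice[unfolded nice_def, rule_format, of "[u, c, v]"] t c uv by auto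
    qed
    then show ?thesis
      using c by (auto simp: irred_def)
  next
    case False
    \<comment> \<open>Zigzags have distinct terms, so lengths in Z are bounded and a longest one
      exists.\<close>
    have "length xs \<le> card B" if "xs \<in> Z" for xs
      using that BC fin zig_distinct[of xs] card_mono[of B "set xs"] by (auto simp: Z_def distinct_card)
    then obtain xs0 where xs0: "xs0 \<in> Z" "\<And>ys. ys \<in> Z \<Longrightarrow> length ys \<le> length xs0"
      using False ex_has_greatest_nat[of "\<lambda>xs. xs \<in> Z" _ length "Suc (card B)"]
      by (metis ex_in_conv less_Suc_eq_le)
    \<comment> \<open>Among the longest zigzags one that starts in A is preferred; this excludes the
      situation in which replacing the last term by an element of A and reversing gives such a
      start.\<close>
    obtain xs where xs: "xs \<in> Z" "\<And>ys. ys \<in> Z \<Longrightarrow> length ys \<le> length xs"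
      and pref: "hd xs \<in> A \<or> (\<forall>ys\<in>Z. length ys = length xs \<longrightarrow> hd ys \<notin> A)"
    proof (cases "\<exists>ys\<in>Z. length ys = length xs0 \<and> hd ys \<in> A")
      case True
      then obtain ys where "ys \<in> Z" "length ys = length xs0" "hd ys \<in> A" by blast
      then show ?thesis using that[of ys] xs0 by simp
    next
      case False
      then show ?thesis using that[of xs0] xs0 by blast
    qed
    have "3 \<le> length xs"
      using xs(1) by (simp add: Z_def)
    then obtain x y w0 rest where s: "xs = rest @ [x, y, w0]"
      by (rule list_length3_lastE)
    have B: "set rest \<subseteq> B" "x \<in> B" "y \<in> B" "w0 \<in> B" "zig jn mt (rest @ [x, y])" "tri jn mt x y w0"
      using xs(1) s by (auto simp: Z_def zig_snoc3)
    have tlA: "set (tl (rest @ [x])) \<inter> A = {}" "y \<notin> A" "w0 \<notin> A"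
      using xs(1) s by (cases rest; auto simp: Z_def)+
    have hd_nA: "set (rest @ [x]) \<inter> A = {}" if "hd (rest @ [x]) \<notin> A"
      using tlA that by (cases rest) auto
    have hd: "hd xs = hd (rest @ [x])"
      using s by (cases rest) auto
    have revZ: "rev L \<in> Z" if "zig jn mt L" "set L \<subseteq> B" "3 \<le> length L" "set (butlast L) \<inter> A = {}" for L
    proof -
      have "L \<noteq> []"
        using that by auto
      then have "tl (rev L) = rev (butlast L)"
        by (metis butlast_rev rev_rev_ident)
      then show ?thesis
        using that zig_rev[of L] BC by (auto simp: Z_def)
    qed
    \<comment> \<open>If w is in A, then niceness fails when the zigzag starts in A; otherwise the
      reversed zigzag has the same length and starts in A, against the preference.\<close>
    have N1: "w \<notin> A" if w: "w \<in> B" "tri jn mt x y w" for w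
    proof
      assume wA: "w \<in> A"
      let ?L = "rest @ [x, y, w]"
      have L: "zig jn mt ?L" "set ?L \<subseteq> B"
        using B w by (auto simp: zig_snoc3)
      have hdL: "hd ?L = hd (rest @ [x])"
        by (cases rest) auto
      show False
      proof (cases "hd xs \<in> A")
        case True
        then show False
          using nice[unfolded nice_def, rule_format, OF L] wA tlA hdL hd by auto
      next
        case False
        then have "rev ?L \<in> Z"
          using revZ[OF L] hd_nA[OF False[unfolded hd]] tlA by (simp add: butlast_append)
        moreover have "length (rev ?L) = length xs" "hd (rev ?L) = w"
          using s by auto
        ultimately show False
          using pref False wA by metis
      qed
    qed
    \<comment> \<open>Prolonging by t gives a longer member of Z: the list itself or, if t is in A,
      its reverse. If both ends are in A, niceness applies instead.\<close>
    have N2: False if w: "w \<in> B" "tri jn mt x y w" and t: "t \<in> B" "tri jn mt y w t" for w t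
    proof -
      let ?L = "rest @ [x, y, w, t]"
      have L: "zig jn mt ?L" "set ?L \<subseteq> B"
        using B w t zig_snoc3[of jn mt "rest @ [x]" y w t] by (auto simp: zig_snoc3)
      have hdL: "hd ?L = hd (rest @ [x])" "set (tl ?L) = set (tl (rest @ [x])) \<union> {y, w, t}"
        by (cases rest; auto)+
      have len: "length ?L > length xs" "length (rev ?L) > length xs"
        using s by auto
      show False
      proof (cases "t \<in> A")
        case False
        then have "?L \<in> Z"
          using L hdL N1[OF w] tlA by (simp add: Z_def)
        then show False
          using xs(2)[of ?L] len by simp
      next
        case tA: True
        show False
        proof (cases "hd xs \<in> A")
          case True
          then show False
            using nice[unfolded nice_def, rule_format, OF L] tA tlA hdL hd by auto
        next
          case False
          then have "rev ?L \<in> Z"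
            using revZ[OF L] hd_nA[OF False[unfolded hd]] tlA N1[OF w] by (simp add: butlast_append)
          then show False
            using xs(2)[of "rev ?L"] len by simp
        qed
      qed
    qed
    have C: "x \<in> C" "y \<in> C" "w0 \<in> C"
      using B BC by auto
    have ne: "y \<noteq> x" "w0 \<noteq> y"
      using B(6) by (auto simp: tri_def)
    have IH': "\<exists>w\<in>B' - A'. irred jn mt B' w"
      if "card B' < card B" "B' \<subseteq> C" "extends le jn mt B' A'" "A' \<noteq> B'" for B' A'
      using IH that by blast
    show ?thesis
    proof (cases "y \<preceq> x")
      case True
      then have eq: "mt x w0 = y"
        using tri_sink[of x y w0] C B by simp
      have "w \<notin> A" if "w \<in> B" "w \<noteq> y" "mt x w = y" for w
        using N1[of w] that ne by (simp add: tri_def)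
      moreover have "jn y t \<noteq> w" if "w \<in> B" "w \<noteq> y" "mt x w = y" "t \<in> B" "t \<noteq> w" for w t
        using N2[of w t] that ne by (auto simp: tri_def)
      ultimately show ?thesis
        using irred_of_sink[OF E BC IH' B(3) tlA(2) B(2) ne(1) B(4) ne(2) eq] by blast
    next
      case False
      then have eq: "jn x w0 = y"
        using tri_peak[of x y w0] tri_comparable(2)[of x w0 y] C B by simp
      have "w \<notin> A" if "w \<in> B" "w \<noteq> y" "jn x w = y" for w
        using N1[of w] that ne by (simp add: tri_def)
      moreover have "mt y t \<noteq> w" if "w \<in> B" "w \<noteq> y" "jn x w = y" "t \<in> B" "t \<noteq> w" for w t
        using N2[of w t] that ne by (auto simp: tri_def)
      ultimately show ?thesis
        using irred_of_peak[OF E BC IH' B(3) tlA(2) B(2) ne(1) B(4) ne(2) eq] by blast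
    qed
  qed
qed

end

section \<open>Bounded closures of nice sets\<close>

context ranked_lattice
begin

definition knice :: "nat \<Rightarrow> 'a set \<Rightarrow> bool" where
  "knice k A \<longleftrightarrow> finite A \<and> A \<subseteq> C \<and> bt \<in> A \<and> tp \<in> A \<and>
     (\<forall>xs. zig jn mt xs \<longrightarrow> set xs \<subseteq> C \<longrightarrow> 3 \<le> length xs \<longrightarrow> length xs \<le> k \<longrightarrow>
       hd xs \<in> A \<longrightarrow> last xs \<in> A \<longrightarrow> set xs \<subseteq> A)"

lemma kniceD:
  assumes "knice k A" "zig jn mt xs" "set xs \<subseteq> C" "3 \<le> length xs" "length xs \<le> k" "hd xs \<in> A" "last xs \<in> A"
  shows "set xs \<subseteq> A"
  using assms unfolding knice_def by blast

lemma knice_mono: "knice K A \<Longrightarrow> k \<le> K \<Longrightarrow> knice k A"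
  unfolding knice_def by (meson le_trans)

lemma knice_subset: "knice k A \<Longrightarrow> x \<in> A \<Longrightarrow> x \<in> C"
  by (auto simp: knice_def)

text \<open>Two elements with their join or meet between them form a three-term zigzag unless that
  value is one of them; this is where the bound 3 comes from.\<close>

lemma knice_sublat:
  assumes "knice k A" "3 \<le> k"
  shows "sublat jn mt A"
  unfolding sublat_def
proof (intro ballI conjI)
  fix x y
  assume xy: "x \<in> A" "y \<in> A"
  then have C: "x \<in> C" "y \<in> C"
    using assms by (auto simp: knice_def)
  show "jn x y \<in> A"
  proof (cases "jn x y = x \<or> jn x y = y")
    case False
    then show ?thesis
      using kniceD[OF assms(1), of "[x, jn x y, y]"] assms(2) xy C by (auto simp: tri_def)
  qed (use xy in auto)
  show "mt x y \<in> A"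
  proof (cases "mt x y = x \<or> mt x y = y")
    case False
    then show ?thesis
      using kniceD[OF assms(1), of "[x, mt x y, y]"] assms(2) xy C by (auto simp: tri_def)
  qed (use xy in auto)
qed

text \<open>The bounds are comparable, so no zigzag of three or more terms joins them. They provide
  a starting position for every k.\<close>

lemma knice_base: "knice k {bt, tp}"
  unfolding knice_def
proof (intro conjI allI impI)
  fix xs
  assume xs: "zig jn mt xs" "set xs \<subseteq> C" "3 \<le> length xs" "hd xs \<in> {bt, tp}" "last xs \<in> {bt, tp}"
  then have "hd xs \<preceq> last xs \<or> last xs \<preceq> hd xs"
    by (metis bt tp insertE singletonD)
  then show "set xs \<subseteq> {bt, tp}"
    using no_comparable_ends[OF xs(1-3)] by simp
qed auto

text \<open>Only the first step of a zigzag leaving c has to be controlled. Once it lands in A, the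
  rest runs between two elements of A; and no zigzag leads from c back to c.\<close>

lemma knice_insert:
  assumes A: "knice k A" "c \<in> C"
    and link: "\<And>ys. zig jn mt (c # ys) \<Longrightarrow> set ys \<subseteq> C \<Longrightarrow> 2 \<le> length ys \<Longrightarrow> length ys < k \<Longrightarrow>
      last ys \<in> A \<Longrightarrow> hd ys \<in> A"
  shows "knice k (insert c A)"
proof -
  have from_c: "set xs \<subseteq> insert c A"
    if xs: "zig jn mt xs" "set xs \<subseteq> C" "3 \<le> length xs" "length xs \<le> k" "hd xs = c" "last xs \<in> A" for xs
  proof -
    obtain d e r where ys: "xs = c # d # e # r"
      using xs(3,5) by (metis list.sel(1) list_length3E)
    then have d: "d \<in> A"
      using link[of "d # e # r"] xs by auto
    have "set (d # e # r) \<subseteq> A"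
    proof (cases r)
      case Nil
      then show ?thesis
        using ys d xs by simp
    next
      case (Cons f r')
      then show ?thesis
        using kniceD[OF A(1), of "d # e # r"] xs d ys by auto
    qed
    then show ?thesis
      using ys by auto
  qed
  have "set xs \<subseteq> insert c A"
    if xs: "zig jn mt xs" "set xs \<subseteq> C" "3 \<le> length xs" "length xs \<le> k"
      "hd xs \<in> insert c A" "last xs \<in> insert c A" for xs
  proof -
    have "xs \<noteq> []"
      using xs by auto
    consider "hd xs = c" "last xs = c" | "hd xs = c" "last xs \<in> A" | "hd xs \<in> A" "last xs = c"
      | "hd xs \<in> A" "last xs \<in> A"
      using xs by auto
    then show ?thesis
    proof cases
      case 1
      then show ?thesis
        using no_comparable_ends[OF xs(1-3)] refl A(2) by simp
    next
      case 2
      then show ?thesis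
        using from_c xs by blast
    next
      case 3
      then show ?thesis
        using from_c[of "rev xs"] zig_rev[OF xs(1,2)] xs \<open>xs \<noteq> []\<close> by (simp add: hd_rev last_rev)
    next
      case 4
      then show ?thesis
        using kniceD[OF A(1) xs(1-4)] by auto
    qed
  qed
  then show ?thesis
    using A unfolding knice_def by auto
qed

text \<open>
  The first step of a path from \<open>c\<close> back to \<open>A\<close> stays in the interval that \<open>A\<close> assigns to \<open>c\<close>;
  adding it to \<open>A\<close> therefore shrinks this interval.
\<close>

lemma progress_up:
  assumes A: "knice k A" "length xs + 3 \<le> k"
    and c: "c \<in> C" "c \<notin> A" "b \<in> A" "c \<preceq> b"
    and z: "zig jn mt (c # d # xs)" "xs \<noteq> []" "set (d # xs) \<subseteq> C" "d \<notin> A" "last xs \<in> A" "c \<preceq> d"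
  shows "d \<preceq> b"
proof (rule ccontr)
  assume db: "\<not> d \<preceq> b"
  obtain e r where xs: "xs = e # r"
    using z(2) by (cases xs) auto
  have C: "b \<in> C" "d \<in> C" "e \<in> C"
    using knice_subset[OF A(1)] c z xs by auto
  have t: "tri jn mt c d e"
    using z xs by simp
  then have d: "d = jn c e" "d \<noteq> e" "e \<preceq> d"
    using tri_peak[of c d e] C c z by (auto simp: tri_def)
  \<comment> \<open>If d is not below b, it can be reached from b through u: then b, u, d followed
    by xs is a zigzag with \<open>length xs + 3\<close> terms and ends in A, which forces d into A.
    If u = b, the first term is dropped.\<close>
  define u where "u = mt d b"
  have u: "u \<in> C" "c \<preceq> u" "u \<preceq> d" "u \<preceq> b"
    using C c z by (auto simp: u_def intro: mt_greatest)
  have due: "d = jn u e"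
  proof (rule antisym)
    show "d \<preceq> jn u e"
      unfolding d(1) using u C c trans[of c u "jn u e"] by (intro jn_least) auto
    show "jn u e \<preceq> d"
      using u C d by (auto intro: jn_least)
  qed (use u C in auto)
  have "u \<noteq> d"
    using u db by auto
  then have t2: "tri jn mt u d e"
    using due d by (simp add: tri_def)
  then have z2: "zig jn mt (u # d # xs)"
    using z(1) xs by simp
  show False
  proof (cases "u = b")
    case True
    then have "set (b # d # xs) \<subseteq> A"
      using kniceD[OF A(1) z2] A(2) u(1) z c xs by auto
    then show False
      using z by simp
  next
    case False
    then have "tri jn mt b u d"
      using \<open>u \<noteq> d\<close> C mt_comm[of b d] by (simp add: tri_def u_def)
    then have "zig jn mt (b # u # d # xs)"
      using z2 by simp
    then have "set (b # u # d # xs) \<subseteq> A"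
      using kniceD[OF A(1), of "b # u # d # xs"] A(2) u(1) z c C xs by auto
    then show False
      using z by simp
  qed
qed

text \<open>Handles a path whose second step e is already in A. The join of a and e bounds d from
  below and has larger rank than a, since e \<preceq> a would imply e \<preceq> c and d = c.\<close>

lemma narrow_up:
  assumes "knice k A" "3 \<le> k" "a \<in> A" "a \<preceq> c" "c \<in> C" "d \<in> C" "c \<preceq> d" "tri jn mt c d e" "e \<in> A"
  shows "\<exists>a'\<in>A. a' \<preceq> d \<and> rk a < rk a'"
proof (intro bexI conjI)
  have C: "a \<in> C" "e \<in> C"
    using knice_subset assms by auto
  have d: "d = jn c e" "e \<preceq> d"
    using tri_peak[of c d e] assms C by auto
  show "jn a e \<in> A"
    using knice_sublat[OF assms(1,2)] assms by (simp add: sublat_def)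
  show "jn a e \<preceq> d"
    using d C assms trans[of a c d] by (auto intro!: jn_least)
  have "jn a e \<noteq> a"
  proof
    assume "jn a e = a"
    then have "e \<preceq> a"
      using jn_ub2[of a e] C by simp
    then have "jn c e = c"
      using trans[of e a c] assms C le_jn[of e c] jn_comm by auto
    then show False
      using d assms by (simp add: tri_def)
  qed
  then show "rk a < rk (jn a e)"
    using rk_less C by auto
qed

lemma knice_dual: "ranked_lattice.knice C mt jn tp bt k A = knice k A"
  using ranked_lattice.knice_def[OF dual] by (auto simp: knice_def zig_swap[of mt jn])

end

lemma (in ranked_lattice) progress_down:
  assumes "knice k A" "length xs + 3 \<le> k" "c \<in> C" "c \<notin> A" "a \<in> A" "a \<preceq> c"
    and "zig jn mt (c # d # xs)" "xs \<noteq> []" "set (d # xs) \<subseteq> C" "d \<notin> A" "last xs \<in> A" "d \<preceq> c"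
  shows "a \<preceq> d"
  using ranked_lattice.progress_up[OF dual, of k A xs c a d] assms
  by (simp add: knice_dual zig_swap[of mt jn])

lemma (in ranked_lattice) narrow_down:
  assumes "knice k A" "3 \<le> k" "b \<in> A" "c \<preceq> b" "c \<in> C" "d \<in> C" "d \<preceq> c" "tri jn mt c d e" "e \<in> A"
  shows "\<exists>b'\<in>A. d \<preceq> b' \<and> rk b' < rk b"
  using ranked_lattice.narrow_up[OF dual, of k A b c d e] assms
  by (simp add: knice_dual tri_swap[of mt jn])

context ranked_lattice
begin

text \<open>
  The closure of \<open>A \<union> {c}\<close> is obtained by recursion on the height \<open>h\<close> of an interval around \<open>c\<close> with
  ends in \<open>A\<close> and, for fixed height, on the length \<open>n\<close> of a path from \<open>c\<close> to \<open>A\<close>.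
\<close>

definition closable :: "nat \<Rightarrow> nat \<Rightarrow> nat \<Rightarrow> nat \<Rightarrow> bool" where
  "closable h k K G \<longleftrightarrow> (\<forall>A c a b. knice K A \<longrightarrow> c \<in> C \<longrightarrow> a \<in> A \<longrightarrow> b \<in> A \<longrightarrow> a \<preceq> c \<longrightarrow> c \<preceq> b \<longrightarrow>
     rk b - rk a \<le> int h \<longrightarrow> (\<exists>A'. insert c A \<subseteq> A' \<and> knice k A' \<and> card (A' - A) \<le> G))"

definition link_closable :: "nat \<Rightarrow> nat \<Rightarrow> nat \<Rightarrow> nat \<Rightarrow> nat \<Rightarrow> bool" where
  "link_closable n h k K G \<longleftrightarrow> (\<forall>A c a b ys. knice K A \<longrightarrow> c \<in> C \<longrightarrow> c \<notin> A \<longrightarrow> a \<in> A \<longrightarrow> b \<in> A \<longrightarrow> a \<preceq> c \<longrightarrow> c \<preceq> b \<longrightarrow>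
     rk b - rk a \<le> int h \<longrightarrow> zig jn mt (c # ys) \<longrightarrow> set ys \<subseteq> C \<longrightarrow> 2 \<le> length ys \<longrightarrow> length ys \<le> n \<longrightarrow>
     hd ys \<notin> A \<longrightarrow> last ys \<in> A \<longrightarrow> (\<exists>A'. insert c A \<subseteq> A' \<and> knice k A' \<and> card (A' - A) \<le> G))"

lemma closableD:
  assumes "closable h k K G" "knice K A" "c \<in> C" "a \<in> A" "b \<in> A" "a \<preceq> c" "c \<preceq> b" "rk b - rk a \<le> int h"
  obtains A' where "insert c A \<subseteq> A'" "knice k A'" "card (A' - A) \<le> G"
  using assms(1)[unfolded closable_def, rule_format, OF assms(2-8)] that by blast

lemma card_diff_trans:
  assumes "finite A''" "A' \<subseteq> A''" "card (A' - A) \<le> m" "card (A'' - A') \<le> n"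
  shows "card (A'' - A) \<le> m + n"
proof -
  have "card (A'' - A) \<le> card ((A' - A) \<union> (A'' - A'))"
    using assms by (intro card_mono) (auto intro: finite_subset)
  also have "\<dots> \<le> m + n"
    using card_Un_le[of "A' - A" "A'' - A'"] assms by linarith
  finally show ?thesis .
qed

text \<open>Let the path be c, d, e and so on. First d is added: it lies in the interval of c, and
  either e is in A and the interval of d shrinks, or the path from d is shorter. Then c is added,
  which is easier because d has become an end of a lower interval around c. The first closure must
  leave the niceness K1 needed by the second; n + 3 serves \<open>progress_up\<close> and
  \<open>progress_down\<close>, and 3 serves the narrowing.\<close>

lemma link_closable_Suc:
  assumes 1: "closable h k K1 G1" and 2: "closable h K1 K2 G2" and 3: "link_closable n (Suc h) K1 K3 G3"
  shows "link_closable (Suc n) (Suc h) k (Max {K2, K3, n + 3, 3}) (max G2 G3 + G1)"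
  unfolding link_closable_def
proof (intro allI impI)
  fix A c a b ys
  define K where "K = Max {K2, K3, n + 3, 3}"
  assume "knice (Max {K2, K3, n + 3, 3}) A"
    and c: "c \<in> C" "c \<notin> A" "a \<in> A" "b \<in> A" "a \<preceq> c" "c \<preceq> b" "rk b - rk a \<le> int (Suc h)"
    and z: "zig jn mt (c # ys)" "set ys \<subseteq> C" "2 \<le> length ys" "length ys \<le> Suc n" "hd ys \<notin> A" "last ys \<in> A"
  then have A: "knice K A"
    by (simp add: K_def)
  have K: "K2 \<le> K" "K3 \<le> K" "n + 3 \<le> K" "3 \<le> K"
    unfolding K_def by simp_all
  obtain d e r where ys: "ys = d # e # r"
    using z(3) by (cases ys; cases "tl ys") auto
  have C: "a \<in> C" "b \<in> C" "d \<in> C"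
    using knice_subset[OF A] c z ys by auto
  have t: "tri jn mt c d e" and dA: "d \<notin> A" and zd: "zig jn mt (d # e # r)"
    using z ys by auto
  have len: "length (e # r) + 3 \<le> K"
    using z(4) ys K by simp
  have interval: "a \<preceq> d \<and> d \<preceq> b \<and> (e \<in> A \<longrightarrow> (\<exists>a'\<in>A. \<exists>b'\<in>A. a' \<preceq> d \<and> d \<preceq> b' \<and> rk b' - rk a' \<le> int h)) \<and>
     (\<exists>a'\<in>insert d A. \<exists>b'\<in>insert d A. a' \<preceq> c \<and> c \<preceq> b' \<and> rk b' - rk a' \<le> int h)"
  proof (cases "c \<preceq> d")
    case True
    have d: "d \<preceq> b"
      by (rule progress_up[OF A len c(1,2,4,6)]) (use z ys dA True in auto)
    moreover have "rk d < rk b"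
      using rk_less[of d b] d dA c C by auto
    moreover have "\<exists>a'\<in>A. a' \<preceq> d \<and> rk a < rk a'" if "e \<in> A"
      using narrow_up[OF A K(4) c(3,5,1) C(3) True t that] .
    ultimately show ?thesis
      using True c trans[of a c d] C by force
  next
    case False
    then have dc: "d \<preceq> c"
      using tri_comparable(2)[of c e d] t z ys c by auto
    have d: "a \<preceq> d"
      by (rule progress_down[OF A len c(1,2,3,5)]) (use z ys dA dc in auto)
    moreover have "rk a < rk d"
      using rk_less[of a d] d dA c C by auto
    moreover have "\<exists>b'\<in>A. d \<preceq> b' \<and> rk b' < rk b" if "e \<in> A"
      using narrow_down[OF A K(4) c(4,6,1) C(3) dc t that] .
    ultimately show ?thesis
      using dc c trans[of d c b] C by force
  qed
  obtain A1 where A1: "insert d A \<subseteq> A1" "knice K1 A1" "card (A1 - A) \<le> max G2 G3"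
  proof (cases "e \<in> A")
    case True
    then obtain a' b' where "a' \<in> A" "b' \<in> A" "a' \<preceq> d" "d \<preceq> b'" "rk b' - rk a' \<le> int h"
      using interval by blast
    then obtain A1 where "insert d A \<subseteq> A1" "knice K1 A1" "card (A1 - A) \<le> G2"
      using closableD[OF 2 knice_mono[OF A K(1)] C(3)] by metis
    then show ?thesis
      using that by auto
  next
    case False
    then have "r \<noteq> []"
      using z ys by auto
    then have "2 \<le> length (e # r)" "length (e # r) \<le> n" "last (e # r) \<in> A" "set (e # r) \<subseteq> C"
      using z ys by (cases r; auto)+
    then obtain A1 where "insert d A \<subseteq> A1" "knice K1 A1" "card (A1 - A) \<le> G3"
      using 3[unfolded link_closable_def, rule_format, OF knice_mono[OF A K(2)] C(3) dA c(3,4) _ _ c(7) zd]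
        interval False by auto
    then show ?thesis
      using that by auto
  qed
  obtain a' b' where "a' \<in> A1" "b' \<in> A1" "a' \<preceq> c" "c \<preceq> b'" "rk b' - rk a' \<le> int h"
    using interval A1(1) by blast
  then obtain A' where A': "insert c A1 \<subseteq> A'" "knice k A'" "card (A' - A1) \<le> G1"
    using closableD[OF 1 A1(2) c(1)] by metis
  then have "card (A' - A) \<le> max G2 G3 + G1"
    using A1 by (intro card_diff_trans[of A' A1]) (auto simp: knice_def)
  then show "\<exists>A'. insert c A \<subseteq> A' \<and> knice k A' \<and> card (A' - A) \<le> max G2 G3 + G1"
    using A1 A' by (intro exI[of _ A']) auto
qed

lemma exists_link_closable:
  assumes "\<And>k. \<exists>K G. closable h k K G"
  shows "\<exists>K G. link_closable n (Suc h) k K G"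
proof (induction n arbitrary: k)
  case 0
  then show ?case
    by (auto simp: link_closable_def)
next
  case (Suc n)
  then show ?case
    using assms link_closable_Suc by metis
qed

lemma exists_closable: "\<exists>K G. closable h k K G"
proof (induction h arbitrary: k)
  case 0
  have "\<exists>A'. insert c A \<subseteq> A' \<and> knice k A' \<and> card (A' - A) \<le> 0"
    if "knice k A" "c \<in> C" "a \<in> A" "b \<in> A" "a \<preceq> c" "c \<preceq> b" "rk b - rk a \<le> int 0" for A c a b
  proof -
    have C: "a \<in> C" "b \<in> C"
      using that knice_subset by auto
    then have "a = b"
      using rk_less[of a b] trans[of a c b] that by auto
    then have "c = a"
      using antisym that C by auto
    then show ?thesis
      using that by (intro exI[of _ A]) auto
  qed
  then show ?case
    unfolding closable_def by blast
next
  case (Suc h)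
  obtain K G where KG: "link_closable k (Suc h) k K G"
    using exists_link_closable[OF Suc] by blast
  have "closable (Suc h) k (max k K) (max 1 G)"
    unfolding closable_def
  proof (intro allI impI)
    fix A c a b
    assume A: "knice (max k K) A"
      and c: "c \<in> C" "a \<in> A" "b \<in> A" "a \<preceq> c" "c \<preceq> b" "rk b - rk a \<le> int (Suc h)"
    have A': "knice k A" "knice K A"
      using A by (auto intro: knice_mono)
    show "\<exists>A'. insert c A \<subseteq> A' \<and> knice k A' \<and> card (A' - A) \<le> max 1 G"
    proof (cases "c \<in> A \<or> knice k (insert c A)")
      case True
      have "card (insert c A - A) \<le> 1"
        by (simp add: insert_Diff_if)
      then have "knice k (insert c A) \<and> card (insert c A - A) \<le> max 1 G"
        using True A' by (auto simp: insert_absorb)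
      then show ?thesis
        by blast
    next
      case False
      \<comment> \<open>Failure of \<open>knice_insert\<close> supplies a path to A with fewer than
        k terms after c, so link length k suffices.\<close>
      then obtain ys where "zig jn mt (c # ys)" "set ys \<subseteq> C" "2 \<le> length ys" "length ys < k" "last ys \<in> A" "hd ys \<notin> A"
        using knice_insert[OF A'(1) c(1)] by metis
      then have "\<exists>A'. insert c A \<subseteq> A' \<and> knice k A' \<and> card (A' - A) \<le> G"
        using KG[unfolded link_closable_def, rule_format, OF A'(2) c(1) _ c(2-6), of ys] False by auto
      then show ?thesis
        by (meson le_max_iff_disj)
    qed
  qed
  then show ?case by blast
qed

theorem exists_closure:
  "\<exists>K G. \<forall>A c. knice K A \<longrightarrow> c \<in> C \<longrightarrow> (\<exists>A'. insert c A \<subseteq> A' \<and> knice k A' \<and> card (A' - A) \<le> G)"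
proof -
  \<comment> \<open>The recursion starts with the whole lattice as interval; ranks between -H and H
    give it height at most 2H.\<close>
  have "rk tp - rk bt \<le> int (2 * H)"
    using rk_bound[of tp] rk_bound[of bt] by auto
  moreover obtain K G where KG: "closable (2 * H) k K G"
    using exists_closable by blast
  moreover have "bt \<in> A" "tp \<in> A" if "knice K A" for A
    using that by (auto simp: knice_def)
  ultimately have "\<exists>A'. insert c A \<subseteq> A' \<and> knice k A' \<and> card (A' - A) \<le> G" if "knice K A" "c \<in> C" for A c
    using closableD[OF KG that, of bt tp] that by (metis bt(2) tp(2))
  then show ?thesis by blast
qed

lemma exists_knice_superset:
  assumes "finite F" "F \<subseteq> C"
  shows "\<exists>A. F \<subseteq> A \<and> knice k A"
  using assms
proof (induction F arbitrary: k rule: finite_induct)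
  case empty
  then show ?case using knice_base by blast
next
  case (insert c F)
  obtain K G where KG: "\<And>A c. knice K A \<Longrightarrow> c \<in> C \<Longrightarrow> \<exists>A'. insert c A \<subseteq> A' \<and> knice k A' \<and> card (A' - A) \<le> G"
    using exists_closure by metis
  have "\<exists>A. F \<subseteq> A \<and> knice K A"
    using insert.IH insert.prems by simp
  then obtain A where "F \<subseteq> A" "knice K A"
    by blast
  then show ?case
    using KG[of A c] insert.prems by (metis insert_subset subset_trans)
qed

end

section \<open>Elements that are far from a finite set\<close>

locale dense_ranked_lattice = ranked_lattice +
  assumes dense: "a \<in> C \<Longrightarrow> b \<in> C \<Longrightarrow> a \<preceq> b \<Longrightarrow> rk a < s \<Longrightarrow> s < rk b \<Longrightarrow>
    infinite {x \<in> C. rk x = s \<and> a \<preceq> x \<and> x \<preceq> b}"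
begin

lemma dense_dual: "dense_ranked_lattice C (\<lambda>x y. y \<preceq> x) mt jn tp bt (\<lambda>x. - rk x) H"
proof -
  interpret d: ranked_lattice C "\<lambda>x y. y \<preceq> x" mt jn tp bt "\<lambda>x. - rk x" H
    by (rule dual)
  show ?thesis
  proof
    fix a b s
    assume "a \<in> C" "b \<in> C" "b \<preceq> a" "- rk a < s" "s < - rk b"
    then have "infinite {x \<in> C. rk x = - s \<and> b \<preceq> x \<and> x \<preceq> a}"
      by (intro dense) auto
    moreover have "{x \<in> C. rk x = - s \<and> b \<preceq> x \<and> x \<preceq> a} = {x \<in> C. - rk x = s \<and> x \<preceq> a \<and> b \<preceq> x}"
      by auto
    ultimately show "infinite {x \<in> C. - rk x = s \<and> x \<preceq> a \<and> b \<preceq> x}"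
      by simp
  qed
qed

text \<open>One-term paths are included: for \<open>ys = [c]\<close> the condition says that
  elements of A above x are above b. Longer paths express that x is linked to A only through
  b.\<close>

definition far_up :: "nat \<Rightarrow> 'a set \<Rightarrow> 'a \<Rightarrow> 'a \<Rightarrow> bool" where
  "far_up k A b x \<longleftrightarrow> (\<forall>ys. zig jn mt (x # ys) \<longrightarrow> set ys \<subseteq> C \<longrightarrow> ys \<noteq> [] \<longrightarrow> length ys < k \<longrightarrow>
     last ys \<in> A \<longrightarrow> x \<preceq> hd ys \<longrightarrow> b \<preceq> hd ys)"

definition far_down :: "nat \<Rightarrow> 'a set \<Rightarrow> 'a \<Rightarrow> 'a \<Rightarrow> bool" where
  "far_down k A a x \<longleftrightarrow> (\<forall>ys. zig jn mt (x # ys) \<longrightarrow> set ys \<subseteq> C \<longrightarrow> ys \<noteq> [] \<longrightarrow> length ys < k \<longrightarrow>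
     last ys \<in> A \<longrightarrow> hd ys \<preceq> x \<longrightarrow> hd ys \<preceq> a)"

definition far_exists :: "nat \<Rightarrow> 'a set \<Rightarrow> 'a \<Rightarrow> 'a \<Rightarrow> int \<Rightarrow> bool" where
  "far_exists k A a b s \<longleftrightarrow> (\<exists>x\<in>C. x \<notin> A \<and> rk x = s \<and> a \<preceq> x \<and> x \<preceq> b \<and> far_up k A b x \<and> far_down k A a x)"

lemma far_upD:
  "far_up k A b x \<Longrightarrow> zig jn mt (x # ys) \<Longrightarrow> set ys \<subseteq> C \<Longrightarrow> ys \<noteq> [] \<Longrightarrow> length ys < k \<Longrightarrow>
     last ys \<in> A \<Longrightarrow> x \<preceq> hd ys \<Longrightarrow> b \<preceq> hd ys"
  by (simp add: far_up_def)

lemma far_downD: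
  "far_down k A a x \<Longrightarrow> zig jn mt (x # ys) \<Longrightarrow> set ys \<subseteq> C \<Longrightarrow> ys \<noteq> [] \<Longrightarrow> length ys < k \<Longrightarrow>
     last ys \<in> A \<Longrightarrow> hd ys \<preceq> x \<Longrightarrow> hd ys \<preceq> a"
  by (simp add: far_down_def)

lemma far_up_antimono: "far_up k B b x \<Longrightarrow> A \<subseteq> B \<Longrightarrow> j \<le> k \<Longrightarrow> far_up j A b x"
  unfolding far_up_def by (meson less_le_trans subsetD)

lemma far_down_antimono: "far_down k B b x \<Longrightarrow> A \<subseteq> B \<Longrightarrow> j \<le> k \<Longrightarrow> far_down j A b x"
  unfolding far_down_def by (meson less_le_trans subsetD)

text \<open>No rank lies strictly between x and b. A first step d outside A would lie strictly
  between them by \<open>progress_up\<close>, the source of the 3; if d is in A, then so is its meet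
  with b, which is strictly above x and hence equals b.\<close>

lemma far_up_atom:
  assumes A: "knice (k + 3) A" and x: "x \<in> C" "x \<notin> A" "x \<preceq> b" "b \<in> A" "rk b = rk x + 1"
  shows "far_up k A b x"
  unfolding far_up_def
proof (intro allI impI)
  fix ys
  assume ys: "zig jn mt (x # ys)" "set ys \<subseteq> C" "ys \<noteq> []" "length ys < k" "last ys \<in> A" "x \<preceq> hd ys"
  then obtain d xs where d: "ys = d # xs"
    by (cases ys) auto
  have C: "b \<in> C" "d \<in> C"
    using knice_subset[OF A] x ys d by auto
  show "b \<preceq> hd ys"
  proof (cases "d \<in> A")
    case True
    have "mt d b \<in> A"
      using knice_sublat[OF A] True x by (simp add: sublat_def)
    moreover have "x \<preceq> mt d b"
      using x ys d C by (auto intro: mt_greatest)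
    ultimately have "rk x < rk (mt d b)"
      using rk_less[of x "mt d b"] C x by auto
    then have "mt d b = b"
      using rk_less[of "mt d b" b] C x by fastforce
    then show ?thesis
      using C d mt_lb1[of d b] by simp
  next
    case False
    then have "xs \<noteq> []"
      using ys d by auto
    then have "d \<preceq> b"
      using progress_up[OF A, of xs x b d] x ys d False by auto
    moreover have "x \<noteq> d"
      using ys d \<open>xs \<noteq> []\<close> by (cases xs) (auto simp: tri_def)
    ultimately have "rk x < rk d" "d \<noteq> b \<longrightarrow> rk d < rk b"
      using rk_less[of x d] rk_less[of d b] C ys d x by auto
    then show ?thesis
      using x False by auto
  qed
qed

text \<open>
  A path from \<open>y\<close> downwards starts with \<open>x\<close> or continues a path from \<open>x\<close>;
  in the first case the path from \<open>x\<close> is one step shorter and starts upwards.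
\<close>

lemma far_down_step:
  assumes x: "x \<in> C" "x \<notin> A" "far_down k A a x" "far_up j A b x"
    and y: "y \<in> C" "x \<preceq> y" "y \<preceq> b" "b \<in> C" "far_down k (insert x A) x y"
    and A: "A \<subseteq> C"
  shows "far_down (min k (Suc j)) A a y"
  unfolding far_down_def
proof (intro allI impI)
  fix ys
  assume ys: "zig jn mt (y # ys)" "set ys \<subseteq> C" "ys \<noteq> []" "length ys < min k (Suc j)" "last ys \<in> A" "hd ys \<preceq> y"
  then obtain d xs where d: "ys = d # xs"
    by (cases ys) auto
  have C: "d \<in> C"
    using ys d by simp
  have dx: "d \<preceq> x"
    using far_downD[OF y(5) ys(1-3) _ _ ys(6)] ys d by auto
  show "hd ys \<preceq> a"
  \<comment> \<open>A path through x turns upwards there. Its next term is above b, hence above y,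
    so x, being the meet of y with that term, would equal y.\<close>
  proof (cases "d = x")
    case True
    then obtain e r where e: "xs = e # r"
      using ys d x by (cases xs) auto
    have eC: "e \<in> C" and t: "tri jn mt y x e"
      using ys d e True by auto
    have xe: "x \<preceq> e" "x = mt y e"
      using tri_sink[of y x e] t y x eC by auto
    have "b \<preceq> hd xs"
      using far_upD[OF x(4), of xs] ys d e True xe by auto
    then have "y \<preceq> e"
      using trans[of y b e] y eC e by auto
    then have "x = y"
      using xe le_mt y eC by simp
    then show ?thesis
      using t by (simp add: tri_def)
  next
    case False
    \<comment> \<open>Since d \<preceq> x \<preceq> y, a meet d of y and e is also the meet of x and
      e; so x can replace y as starting point.\<close>
    have "zig jn mt (x # d # xs)"
    proof (cases xs)
      case (Cons e r)
      then have eC: "e \<in> C" and t: "tri jn mt y d e"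
        using ys d by auto
      then have de: "d \<preceq> e" "d = mt y e"
        using tri_sink[of y d e] ys y C d by auto
      have "d = mt x e"
      proof (rule antisym)
        show "d \<preceq> mt x e"
          using C x eC dx de by (auto intro: mt_greatest)
        have "mt x e \<preceq> mt y e"
          using x y eC trans[of "mt x e" x y] by (auto intro: mt_greatest)
        then show "mt x e \<preceq> d"
          using de by simp
      qed (use C x eC in auto)
      then show ?thesis
        using False t ys(1) d Cons by (auto simp: tri_def)
    qed simp
    then show ?thesis
      using far_downD[OF x(3), of ys] ys d dx by auto
  qed
qed

lemma far_dual:
  "dense_ranked_lattice.far_up C (\<lambda>x y. y \<preceq> x) mt jn k A b x \<longleftrightarrow> far_down k A b x"
  "dense_ranked_lattice.far_down C (\<lambda>x y. y \<preceq> x) mt jn k A b x \<longleftrightarrow> far_up k A b x"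
  "dense_ranked_lattice.far_exists C (\<lambda>x y. y \<preceq> x) mt jn (\<lambda>x. - rk x) k A b a s \<longleftrightarrow> far_exists k A a b (- s)"
proof -
  show 1: "dense_ranked_lattice.far_up C (\<lambda>x y. y \<preceq> x) mt jn k A b x \<longleftrightarrow> far_down k A b x" for k A b x
    by (simp add: dense_ranked_lattice.far_up_def[OF dense_dual] far_down_def zig_swap[of mt jn])
  show 2: "dense_ranked_lattice.far_down C (\<lambda>x y. y \<preceq> x) mt jn k A b x \<longleftrightarrow> far_up k A b x" for k A b x
    by (simp add: dense_ranked_lattice.far_down_def[OF dense_dual] far_up_def zig_swap[of mt jn])
  have "- rk x = s \<longleftrightarrow> rk x = - s" for x
    by auto
  then show "dense_ranked_lattice.far_exists C (\<lambda>x y. y \<preceq> x) mt jn (\<lambda>x. - rk x) k A b a s \<longleftrightarrow> far_exists k A a b (- s)"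
    unfolding dense_ranked_lattice.far_exists_def[OF dense_dual] far_exists_def 1 2 by blast
qed

end

lemma (in dense_ranked_lattice) far_down_atom:
  assumes "knice (k + 3) A" "x \<in> C" "x \<notin> A" "a \<preceq> x" "a \<in> A" "rk x = rk a + 1"
  shows "far_down k A a x"
  using dense_ranked_lattice.far_up_atom[OF dense_dual, of k A x a] assms
  by (simp add: knice_dual far_dual)

lemma (in dense_ranked_lattice) far_up_step:
  assumes "x \<in> C" "x \<notin> A" "far_up k A b x" "far_down j A a x"
    and "y \<in> C" "y \<preceq> x" "a \<preceq> y" "a \<in> C" "far_up k (insert x A) x y" "A \<subseteq> C"
  shows "far_up (min k (Suc j)) A b y"
  using dense_ranked_lattice.far_down_step[OF dense_dual, of x A k b j a y] assms
  by (simp only: far_dual simp_thms)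

context dense_ranked_lattice
begin

text \<open>
  Alternating between layer \<open>s\<close> below the current element and layer \<open>s + 1\<close> above it, each time
  with an element that is far over the previous one, increases the distance to \<open>A\<close> step by step.
\<close>

lemma far_exists_step_up:
  assumes A: "finite A" "A \<subseteq> C" "a \<in> A" "b \<in> A" "a \<preceq> b" "rk a < s" "s + 1 < rk b"
    and IH: "\<And>A' a' b' s'. finite A' \<Longrightarrow> A' \<subseteq> C \<Longrightarrow> a' \<in> A' \<Longrightarrow> b' \<in> A' \<Longrightarrow> a' \<preceq> b' \<Longrightarrow>
      rk a' < s' \<Longrightarrow> s' < rk b' \<Longrightarrow> rk b' - rk a' < rk b - rk a \<Longrightarrow> far_exists k A' a' b' s'"
  shows "far_exists k A a b s"
proof -
  have abC: "a \<in> C" "b \<in> C"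
    using A by auto
  \<comment> \<open>Only the upward distance grows with j; the downward distance is k throughout, as
    x is always chosen far in an interval that starts at a. For j = 0 the upward condition is
    vacuous.\<close>
  have "\<exists>x\<in>C. x \<notin> A \<and> rk x = s \<and> a \<preceq> x \<and> x \<preceq> b \<and> far_down k A a x \<and> far_up (min k j) A b x" for j
  proof (induction j)
    case 0
    have "infinite {y \<in> C. rk y = s + 1 \<and> a \<preceq> y \<and> y \<preceq> b}"
      using dense abC A by auto
    then obtain y where y: "y \<in> C" "rk y = s + 1" "a \<preceq> y" "y \<preceq> b"
      using not_finite_existsD by auto
    have "far_exists k (insert y A) a y s"
      using IH[of "insert y A" a y s] A y by auto
    then obtain x where "x \<in> C" "x \<notin> insert y A" "rk x = s" "a \<preceq> x" "x \<preceq> y" "far_down k (insert y A) a x"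
      unfolding far_exists_def by blast
    moreover have "far_up (min k 0) A b x"
      by (simp add: far_up_def)
    ultimately show ?case
      using far_down_antimono[of k "insert y A" a x A k] trans[of x y b] y abC by blast
  next
    case (Suc j)
    then obtain x where x: "x \<in> C" "x \<notin> A" "rk x = s" "a \<preceq> x" "x \<preceq> b"
      "far_down k A a x" "far_up (min k j) A b x"
      by blast
    \<comment> \<open>Because rk a < s and s + 1 < rk b, the intervals from x to b and from a to y
      are lower than the given one, so \<open>IH\<close> covers both.\<close>
    have "far_exists k (insert x A) x b (s + 1)"
      using IH[of "insert x A" x b "s + 1"] A x by auto
    then obtain y where y: "y \<in> C" "y \<notin> insert x A" "rk y = s + 1" "x \<preceq> y" "y \<preceq> b"
      "far_up k (insert x A) b y" "far_down k (insert x A) x y"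
      unfolding far_exists_def by blast
    have y1: "far_up k A b y"
      using far_up_antimono[OF y(6)] by blast
    \<comment> \<open>The upward distance of x becomes a downward distance of y, larger by one up to
      the cap k; below, this becomes an upward distance of z.\<close>
    have y2: "far_down (min k (Suc (min k j))) A a y"
      using far_down_step[OF x(1,2,6,7) y(1,4,5) abC(2) y(7) A(2)] .
    have ay: "a \<preceq> y"
      using trans[of a x y] x y abC by blast
    have "far_exists k (insert y A) a y s"
      using IH[of "insert y A" a y s] A y ay by auto
    then obtain z where z: "z \<in> C" "z \<notin> insert y A" "rk z = s" "a \<preceq> z" "z \<preceq> y"
      "far_up k (insert y A) y z" "far_down k (insert y A) a z"
      unfolding far_exists_def by blast
    have "far_up (min k (Suc (min k (Suc (min k j))))) A b z"
      using far_up_step[OF y(1) _ y1 y2 z(1,5,4) abC(1) z(6) A(2)] y by blast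
    then have "far_up (min k (Suc j)) A b z"
      by (rule far_up_antimono) auto
    moreover have "far_down k A a z"
      using far_down_antimono[OF z(7)] by blast
    moreover have "z \<preceq> b"
      using trans[of z y b] y z abC by blast
    ultimately show ?case
      using z by blast
  qed
  from this[of k] show ?thesis
    unfolding far_exists_def by auto
qed

end

lemma (in dense_ranked_lattice) far_exists_step_down:
  assumes A: "finite A" "A \<subseteq> C" "a \<in> A" "b \<in> A" "a \<preceq> b" "rk a < s - 1" "s < rk b"
    and IH: "\<And>A' a' b' s'. finite A' \<Longrightarrow> A' \<subseteq> C \<Longrightarrow> a' \<in> A' \<Longrightarrow> b' \<in> A' \<Longrightarrow> a' \<preceq> b' \<Longrightarrow>
      rk a' < s' \<Longrightarrow> s' < rk b' \<Longrightarrow> rk b' - rk a' < rk b - rk a \<Longrightarrow> far_exists k A' a' b' s'"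
  shows "far_exists k A a b s"
proof -
  have "dense_ranked_lattice.far_exists C (\<lambda>x y. y \<preceq> x) mt jn (\<lambda>x. - rk x) k A b a (- s)"
  proof (rule dense_ranked_lattice.far_exists_step_up[OF dense_dual])
    fix A' a' b' s'
    assume "finite A'" "A' \<subseteq> C" "a' \<in> A'" "b' \<in> A'" "b' \<preceq> a'" "- rk a' < s'" "s' < - rk b'"
      "- rk b' - - rk a' < - rk a - - rk b"
    then show "dense_ranked_lattice.far_exists C (\<lambda>x y. y \<preceq> x) mt jn (\<lambda>x. - rk x) k A' a' b' s'"
      unfolding far_dual by (intro IH) auto
  qed (use A in auto)
  then show ?thesis
    by (simp add: far_dual)
qed

context dense_ranked_lattice
begin

text \<open>Induction on the height of the interval. With room for a layer next to s on either side,
  the alternating construction applies. In height two, infinitely many candidates compete with a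
  finite nice superset of A, and any candidate outside it is far.\<close>

lemma far_exists:
  assumes "finite A" "A \<subseteq> C" "a \<in> A" "b \<in> A" "a \<preceq> b" "rk a < s" "s < rk b"
  shows "far_exists k A a b s"
  using assms
proof (induction "nat (rk b - rk a)" arbitrary: A a b s rule: less_induct)
  case less
  have IH: "far_exists k A' a' b' s'"
    if "finite A'" "A' \<subseteq> C" "a' \<in> A'" "b' \<in> A'" "a' \<preceq> b'" "rk a' < s'" "s' < rk b'" "rk b' - rk a' < rk b - rk a"
    for A' a' b' s'
    using less.hyps[of b' a' A' s'] that by auto
  consider "s + 1 < rk b" | "rk a < s - 1" | "rk b = s + 1" "s = rk a + 1"
    using less.prems(6,7) by linarith
  then show ?case
  proof cases
    case 1
    show ?thesis
      using far_exists_step_up[OF less.prems(1-6) 1 IH] .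
  next
    case 2
    show ?thesis
      using far_exists_step_down[OF less.prems(1-5) 2 less.prems(7) IH] .
  next
    case 3
    obtain A' where A': "A \<subseteq> A'" "knice (k + 3) A'"
      using exists_knice_superset less.prems by metis
    have "infinite {x \<in> C. rk x = s \<and> a \<preceq> x \<and> x \<preceq> b}"
      using dense less.prems by auto
    moreover have "finite A'"
      using A' by (simp add: knice_def)
    ultimately have "infinite ({x \<in> C. rk x = s \<and> a \<preceq> x \<and> x \<preceq> b} - A')"
      by (rule Diff_infinite_finite[rotated])
    then have "{x \<in> C. rk x = s \<and> a \<preceq> x \<and> x \<preceq> b} - A' \<noteq> {}"
      by (rule infinite_imp_nonempty)
    then obtain x where x: "x \<in> C" "rk x = s" "a \<preceq> x" "x \<preceq> b" "x \<notin> A'"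
      by blast
    have ab: "a \<in> A'" "b \<in> A'"
      using A' less.prems by auto
    have "rk b = rk x + 1" "rk x = rk a + 1"
      using 3 x(2) by simp_all
    then have "far_up k A' b x" "far_down k A' a x"
      using far_up_atom[OF A'(2) x(1,5,4) ab(2)] far_down_atom[OF A'(2) x(1,5,3) ab(1)] by simp_all
    then have "far_up k A b x" "far_down k A a x"
      using A' by (auto intro: far_up_antimono far_down_antimono)
    then show ?thesis
      unfolding far_exists_def using x A' by blast
  qed
qed

text \<open>Supplies the link condition of \<open>knice_insert\<close>. As b lies between x and d,
  the join d of x and e is also the join of b and e, so the path can be started at b, in A.\<close>

lemma link_up:
  assumes A: "knice k A" and x: "x \<in> C" "b \<in> A" "x \<preceq> b" "b \<preceq> d" "d \<in> C" "x \<noteq> d"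
    and z: "zig jn mt (x # d # e # r)" "set (e # r) \<subseteq> C" "length r + 3 \<le> k" "last (e # r) \<in> A"
  shows "d \<in> A"
proof (cases "d = b")
  case False
  have C: "b \<in> C" "e \<in> C"
    using knice_subset[OF A] x z by auto
  have "x \<preceq> d"
    using trans[of x b d] x C by blast
  then have d: "d = jn x e" "e \<preceq> d"
    using tri_peak[of x d e] x z C by auto
  have "d = jn b e"
  proof (rule antisym)
    show "d \<preceq> jn b e"
      unfolding d(1) using x C trans[of x b "jn b e"] by (intro jn_least) auto
    show "jn b e \<preceq> d"
      using x C d by (auto intro: jn_least)
  qed (use x C in auto)
  then have "zig jn mt (b # d # e # r)"
    using z False by (auto simp: tri_def)
  then have "set (b # d # e # r) \<subseteq> A"
    using kniceD[OF A, of "b # d # e # r"] x z C by simp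
  then show ?thesis
    by simp
qed (use x in auto)

end

lemma (in dense_ranked_lattice) link_down:
  assumes "knice k A" "x \<in> C" "a \<in> A" "a \<preceq> x" "d \<preceq> a" "d \<in> C" "x \<noteq> d"
    and "zig jn mt (x # d # e # r)" "set (e # r) \<subseteq> C" "length r + 3 \<le> k" "last (e # r) \<in> A"
  shows "d \<in> A"
  using dense_ranked_lattice.link_up[OF dense_dual, of k A x a d e r] assms
  by (simp only: knice_dual zig_swap[of mt jn] simp_thms)

context dense_ranked_lattice
begin

text \<open>Realises a simple extension without lowering k, so that such steps can be iterated
  freely.\<close>

theorem exists_generic:
  assumes A: "knice k A" and ab: "a \<in> A" "b \<in> A" "a \<preceq> b" "rk a < s" "s < rk b"
  shows "\<exists>x\<in>C. x \<notin> A \<and> rk x = s \<and> (\<forall>c\<in>A. (c \<preceq> x \<longleftrightarrow> c \<preceq> a) \<and> (x \<preceq> c \<longleftrightarrow> b \<preceq> c)) \<and> knice k (insert x A)"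
proof -
  have AC: "finite A" "A \<subseteq> C"
    using A by (auto simp: knice_def)
  then have abC: "a \<in> C" "b \<in> C"
    using ab by auto
  \<comment> \<open>The surplus 2 admits one-term paths for every k, including 0; these give the
    order relations between x and A.\<close>
  obtain x where x: "x \<in> C" "x \<notin> A" "rk x = s" "a \<preceq> x" "x \<preceq> b"
    "far_up (k + 2) A b x" "far_down (k + 2) A a x"
    using far_exists[OF AC ab, of "k + 2"] unfolding far_exists_def by blast
  have "(c \<preceq> x \<longleftrightarrow> c \<preceq> a) \<and> (x \<preceq> c \<longleftrightarrow> b \<preceq> c)" if "c \<in> A" for c
    using far_upD[OF x(6), of "[c]"] far_downD[OF x(7), of "[c]"] that AC(2) x trans[of c a x] trans[of x b c] abC
    by auto
  moreover have "knice k (insert x A)"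
  proof (rule knice_insert[OF A x(1)])
    fix ys
    assume ys: "zig jn mt (x # ys)" "set ys \<subseteq> C" "2 \<le> length ys" "length ys < k" "last ys \<in> A"
    then obtain d e r where d: "ys = d # e # r"
      by (cases ys; cases "tl ys") auto
    then have t: "tri jn mt x d e" "d \<in> C" "e \<in> C" "x \<noteq> d"
      using ys by (auto simp: tri_def)
    consider "x \<preceq> d" | "d \<preceq> x"
      using tri_comparable(2)[of x e d] t x by auto
    then show "hd ys \<in> A"
    proof cases
      case 1
      then have "b \<preceq> d"
        using far_upD[OF x(6) ys(1,2)] ys d by auto
      then show ?thesis
        using link_up[OF A x(1) ab(2) x(5) _ t(2,4)] ys d by auto
    next
      case 2
      then have "d \<preceq> a"
        using far_downD[OF x(7) ys(1,2)] ys d by auto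
      then show ?thesis
        using link_down[OF A x(1) ab(1) x(4) _ t(2,4)] ys d by auto
    qed
  qed
  ultimately show ?thesis
    using x by blast
qed

end

section \<open>Back and forth\<close>

context ranked_lattice
begin

text \<open>An element of maximal rank below w works: its join with another such element is still
  below w and cannot have larger rank.\<close>

lemma greatest_below:
  assumes B: "finite B" "B \<subseteq> C" "sublat jn mt B" "bt \<in> B" and w: "w \<in> C"
  shows "\<exists>a\<in>B. a \<preceq> w \<and> (\<forall>c\<in>B. c \<preceq> w \<longrightarrow> c \<preceq> a)"
proof -
  let ?D = "{c \<in> B. c \<preceq> w}"
  have "finite (rk ` ?D)" "rk ` ?D \<noteq> {}"
    using B w by auto
  then have "Max (rk ` ?D) \<in> rk ` ?D"
    by (rule Max_in)
  then obtain a where a: "a \<in> B" "a \<preceq> w" "rk a = Max (rk ` ?D)"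
    by auto
  have max: "rk c \<le> rk a" if "c \<in> B" "c \<preceq> w" for c
    using a(3) that B(1) by simp
  have "c \<preceq> a" if c: "c \<in> B" "c \<preceq> w" for c
  proof -
    have C: "a \<in> C" "c \<in> C"
      using a c B by auto
    have "jn a c \<in> B" "jn a c \<preceq> w"
      using B(3) a c C w by (auto simp: sublat_def intro: jn_least)
    then have "\<not> rk a < rk (jn a c)"
      using max by fastforce
    then have "jn a c = a"
      using rk_less[of a "jn a c"] C by fastforce
    then show ?thesis
      using jn_ub2[of a c] C by simp
  qed
  then show ?thesis
    using a by blast
qed

end

lemma (in ranked_lattice) least_above:
  assumes "finite B" "B \<subseteq> C" "sublat jn mt B" "tp \<in> B" "w \<in> C"
  shows "\<exists>b\<in>B. w \<preceq> b \<and> (\<forall>c\<in>B. w \<preceq> c \<longrightarrow> b \<preceq> c)"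
proof -
  have "sublat mt jn B"
    using assms(3) by (auto simp: sublat_def)
  then show ?thesis
    using ranked_lattice.greatest_below[OF dual] assms by blast
qed

context ranked_lattice
begin

text \<open>Passes from bounded to full niceness inside B: an excursion from A has distinct interior
  terms in B - A, hence at most \<open>card (B - A) + 2\<close> terms with its ends.\<close>

lemma extends_of_knice:
  assumes A: "knice K A" and B: "knice k B" "3 \<le> k" "A \<subseteq> B" and K: "card (B - A) + 2 \<le> K"
  shows "extends le jn mt B A"
proof -
  have BC: "finite B" "B \<subseteq> C" "bt \<in> A" "tp \<in> A"
    using A B by (auto simp: knice_def)
  have "nice jn mt B A"
    unfolding nice_def
  proof (intro allI impI, rule ccontr)
    fix xs
    assume xs: "zig jn mt xs" "set xs \<subseteq> B" "hd xs \<in> A" "last xs \<in> A" "\<not> set xs \<subseteq> A"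
    then obtain e where "e \<in> set xs" "e \<notin> A"
      by blast
    from segment[OF xs(3,4) this] obtain us a ys b vs where
      s: "xs = us @ a # ys @ b # vs" "a \<in> A" "b \<in> A" "e \<in> set ys" "set ys \<inter> A = {}"
      by metis
    have z: "zig jn mt (a # ys @ [b])"
      using xs(1) s(1) zig_sub[of jn mt us "a # ys @ [b]" vs] by simp
    have C: "set (a # ys @ [b]) \<subseteq> C"
      using xs(2) s(1) BC by auto
    have len: "3 \<le> length (a # ys @ [b])"
      using s(4) by (cases ys) auto
    then have "distinct ys"
      using zig_distinct[OF z C] by simp
    then have "length ys = card (set ys)"
      by (simp add: distinct_card)
    also have "\<dots> \<le> card (B - A)"
      by (rule card_mono) (use s xs(2) BC in auto)
    finally have "length ys \<le> card (B - A)" .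
    then have "set (a # ys @ [b]) \<subseteq> A"
      using kniceD[OF A z C len] K s by simp
    then show False
      using s by auto
  qed
  moreover have "\<forall>x\<in>B. bt \<preceq> x" "\<forall>x\<in>B. x \<preceq> tp"
    using BC by auto
  ultimately show ?thesis
    using BC B(3) knice_sublat[OF B(1,2)] unfolding extends_def by blast
qed

lemma extends_remove_irred:
  assumes E: "extends le jn mt B A" "B \<subseteq> C" and w: "w \<in> B - A" "irred jn mt B w"
  shows "extends le jn mt (B - {w}) A"
proof -
  have "sublat jn mt (B - {w})"
    unfolding sublat_def
  proof (intro ballI)
    fix u v
    assume uv: "u \<in> B - {w}" "v \<in> B - {w}"
    then have "\<not> tri jn mt u w v"
      using w(2) by (auto simp: irred_def)
    then have "jn u v \<noteq> w" "mt u v \<noteq> w"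
      using uv by (auto simp: tri_def)
    then show "jn u v \<in> B - {w} \<and> mt u v \<in> B - {w}"
      using E uv by (auto simp: extends_def sublat_def)
  qed
  moreover have "nice jn mt (B - {w}) A"
    using E by (auto simp: extends_def nice_def)
  ultimately show ?thesis
    using E w by (auto simp: extends_def)
qed

end

locale two_lattices =
  L: dense_ranked_lattice C le jn mt bt tp rk H +
  L': dense_ranked_lattice C' le' jn' mt' bt' tp' rk' H'
  for C :: "'a set" and le jn mt bt tp rk H
    and C' :: "'b set" and le' jn' mt' bt' tp' rk' H'
begin

definition position :: "nat \<Rightarrow> 'a set \<Rightarrow> ('a \<Rightarrow> 'b) \<Rightarrow> bool" where
  "position k A f \<longleftrightarrow> L.knice k A \<and> L'.knice k (f ` A) \<and>
     (\<forall>x\<in>A. \<forall>y\<in>A. le x y \<longleftrightarrow> le' (f x) (f y)) \<and> (\<forall>x\<in>A. rk' (f x) = rk x)"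

lemma swap: "two_lattices C' le' jn' mt' bt' tp' rk' H' C le jn mt bt tp rk H"
  by unfold_locales

lemma position_mono: "position K A f \<Longrightarrow> k \<le> K \<Longrightarrow> position k A f"
  unfolding position_def using L.knice_mono L'.knice_mono by blast

lemma position_eq_iff:
  assumes "position k A f" "x \<in> A" "y \<in> A"
  shows "f x = f y \<longleftrightarrow> x = y"
proof
  assume e: "f x = f y"
  have "x \<in> C" "y \<in> C" "f x \<in> C'"
    using assms L.knice_subset L'.knice_subset unfolding position_def by blast+
  moreover have "le x y" "le y x"
    using assms e L'.refl[OF \<open>f x \<in> C'\<close>] unfolding position_def by metis+
  ultimately show "x = y"
    using L.antisym by blast
qed simp

text \<open>An irreducible w is removed from B, the rest is mapped by induction, and w is sent to a
  generic element of the corresponding type. The degree k on the image side survives because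
  \<open>exists_generic\<close> preserves it.\<close>

lemma extend_iso:
  assumes "extends le jn mt B A" "B \<subseteq> C"
    and A: "L'.knice k (f ` A)" "\<forall>x\<in>A. \<forall>y\<in>A. le x y \<longleftrightarrow> le' (f x) (f y)" "\<forall>x\<in>A. rk' (f x) = rk x"
    and bt: "bt \<in> A" "tp \<in> A"
  shows "\<exists>f'. (\<forall>x\<in>A. f' x = f x) \<and> L'.knice k (f' ` B) \<and>
    (\<forall>x\<in>B. \<forall>y\<in>B. le x y \<longleftrightarrow> le' (f' x) (f' y)) \<and> (\<forall>x\<in>B. rk' (f' x) = rk x)"
  using assms(1,2)
proof (induction "card B" arbitrary: B rule: less_induct)
  case less
  note E = less.prems(1) and BC = less.prems(2)
  have fin: "finite B" "A \<subseteq> B"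
    using E by (auto simp: extends_def)
  show ?case
  proof (cases "A = B")
    case True
    then show ?thesis
      using A by blast
  next
    case False
    obtain w where w: "w \<in> B - A" "irred jn mt B w"
      using L.exists_irred[OF E BC False] by blast
    define B0 where "B0 = B - {w}"
    have E0: "extends le jn mt B0 A"
      unfolding B0_def by (rule L.extends_remove_irred[OF E BC w])
    have card: "card B0 < card B"
      unfolding B0_def using fin w by (intro card_Diff1_less) auto
    have B0: "finite B0" "B0 \<subseteq> C" "sublat jn mt B0" "A \<subseteq> B0" "w \<notin> B0" "B = insert w B0" "w \<in> C"
      using fin w BC E0 by (auto simp: B0_def extends_def)
    from less.hyps[OF card E0 B0(2)] obtain g where
      g: "\<forall>x\<in>A. g x = f x" "L'.knice k (g ` B0)" "\<forall>x\<in>B0. \<forall>y\<in>B0. le x y \<longleftrightarrow> le' (g x) (g y)"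
        "\<forall>x\<in>B0. rk' (g x) = rk x"
      by blast
    \<comment> \<open>Since w is not in B0, it differs from a and b, so its rank is strictly between
      theirs; all its order relations to B0 follow from a and b.\<close>
    obtain a where a: "a \<in> B0" "le a w" "\<forall>c\<in>B0. le c w \<longrightarrow> le c a"
      using L.greatest_below[OF B0(1-3) _ B0(7)] bt B0(4) by blast
    obtain b where b: "b \<in> B0" "le w b" "\<forall>c\<in>B0. le w c \<longrightarrow> le b c"
      using L.least_above[OF B0(1-3) _ B0(7)] bt B0(4) by blast
    have C: "a \<in> C" "b \<in> C"
      using a b B0 by auto
    have "rk a < rk w" "rk w < rk b"
      using L.rk_less[of a w] L.rk_less[of w b] a b B0 C by auto
    then have "rk' (g a) < rk w" "rk w < rk' (g b)"
      using g a b by auto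
    moreover have "le' (g a) (g b)"
      using g a b L.trans[of a w b] B0 C by blast
    ultimately obtain x where x: "x \<in> C'" "x \<notin> g ` B0" "rk' x = rk w"
      "\<forall>c\<in>g ` B0. (le' c x \<longleftrightarrow> le' c (g a)) \<and> (le' x c \<longleftrightarrow> le' (g b) c)" "L'.knice k (insert x (g ` B0))"
      using L'.exists_generic[OF g(2), of "g a" "g b" "rk w"] a b by blast
    have below: "le c w \<longleftrightarrow> le c a" "le w c \<longleftrightarrow> le b c" if "c \<in> B0" for c
      using that a b L.trans[of c a w] L.trans[of w b c] B0 C by blast+
    define f' where "f' = g(w := x)"
    have f': "f' w = x" "\<And>c. c \<in> B0 \<Longrightarrow> f' c = g c"
      using B0(5) by (auto simp: f'_def)
    have img: "f' ` B = insert x (g ` B0)"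
      unfolding B0(6) using f' by auto
    have le: "le c d \<longleftrightarrow> le' (f' c) (f' d)" if "c \<in> B" "d \<in> B" for c d
    proof -
      have "c = w \<or> c \<in> B0" "d = w \<or> d \<in> B0"
        using that B0(6) by auto
      then show ?thesis
        using f' below g(3) x(4) a b L.refl[OF B0(7)] L'.refl[OF x(1)] by (elim disjE) auto
    qed
    have "\<forall>c\<in>B. rk' (f' c) = rk c"
      unfolding B0(6) using f' g(4) x(3) by auto
    moreover have "\<forall>c\<in>A. f' c = f c"
      using f' g(1) B0(4) by auto
    ultimately show ?thesis
      using le x(5) img by (intro exI[of _ f']) auto
  qed
qed

lemma extend_domain:
  "\<exists>K. \<forall>A f c. position K A f \<longrightarrow> c \<in> C \<longrightarrow>
     (\<exists>A' f'. position k A' f' \<and> A \<subseteq> A' \<and> c \<in> A' \<and> (\<forall>x\<in>A. f' x = f x))"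
proof -
  \<comment> \<open>Degree at least 3 ensures that the closure is a sublattice.\<close>
  define k1 where "k1 = max k 3"
  obtain K0 G where KG: "\<And>A c. L.knice K0 A \<Longrightarrow> c \<in> C \<Longrightarrow>
      \<exists>A'. insert c A \<subseteq> A' \<and> L.knice k1 A' \<and> card (A' - A) \<le> G"
    using L.exists_closure[of k1] by metis
  \<comment> \<open>K0 is needed for the closure, k1 for the niceness that the image keeps, and G +
    2 for \<open>extends_of_knice\<close>.\<close>
  define K where "K = max K0 (max k1 (G + 2))"
  have K: "K0 \<le> K" "k1 \<le> K" "G + 2 \<le> K"
    by (auto simp: K_def)
  have "\<exists>A' f'. position k A' f' \<and> A \<subseteq> A' \<and> c \<in> A' \<and> (\<forall>x\<in>A. f' x = f x)"
    if pos: "position K A f" and c: "c \<in> C" for A f c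
  proof -
    have A: "L.knice K A" "L'.knice K (f ` A)" "\<forall>x\<in>A. \<forall>y\<in>A. le x y \<longleftrightarrow> le' (f x) (f y)"
      "\<forall>x\<in>A. rk' (f x) = rk x"
      using pos by (auto simp: position_def)
    obtain A' where A': "insert c A \<subseteq> A'" "L.knice k1 A'" "card (A' - A) \<le> G"
      using KG[OF L.knice_mono[OF A(1) K(1)] c] by blast
    have "extends le jn mt A' A"
      by (rule L.extends_of_knice[OF A(1) A'(2)]) (use A' K in \<open>auto simp: k1_def\<close>)
    moreover have "A' \<subseteq> C" "bt \<in> A" "tp \<in> A"
      using A' A by (auto simp: L.knice_def)
    ultimately obtain f' where f': "\<forall>x\<in>A. f' x = f x" "L'.knice k1 (f' ` A')"
      "\<forall>x\<in>A'. \<forall>y\<in>A'. le x y \<longleftrightarrow> le' (f' x) (f' y)" "\<forall>x\<in>A'. rk' (f' x) = rk x"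
      using extend_iso[OF _ _ L'.knice_mono[OF A(2) K(2)] A(3,4)] by blast
    then have "position k1 A' f'"
      using A' by (simp add: position_def)
    then have "position k A' f'"
      by (rule position_mono) (simp add: k1_def)
    then show ?thesis
      using A' f' by blast
  qed
  then show ?thesis by blast
qed

lemma position_swap:
  assumes pos: "position k A f" and g: "\<And>x. x \<in> A \<Longrightarrow> g (f x) = x"
  shows "two_lattices.position C' le' jn' mt' bt' tp' rk' C le jn mt bt tp rk k (f ` A) g"
proof -
  have "g ` f ` A = A"
    using g by (auto simp: image_image)
  then show ?thesis
    using pos g unfolding position_def two_lattices.position_def[OF swap] by auto
qed

end

text \<open>The back move is the forth move for the inverse map, inverted again.\<close>

lemma (in two_lattices) extend_range:
  "\<exists>K. \<forall>A f d. position K A f \<longrightarrow> d \<in> C' \<longrightarrow>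
     (\<exists>A' f'. position k A' f' \<and> A \<subseteq> A' \<and> d \<in> f' ` A' \<and> (\<forall>x\<in>A. f' x = f x))"
proof -
  interpret S: two_lattices C' le' jn' mt' bt' tp' rk' H' C le jn mt bt tp rk H
    by (rule swap)
  obtain K where K: "\<And>B g d. S.position K B g \<Longrightarrow> d \<in> C' \<Longrightarrow>
      \<exists>B' g'. S.position k B' g' \<and> B \<subseteq> B' \<and> d \<in> B' \<and> (\<forall>x\<in>B. g' x = g x)"
    using S.extend_domain[of k] by metis
  have "\<exists>A' f'. position k A' f' \<and> A \<subseteq> A' \<and> d \<in> f' ` A' \<and> (\<forall>x\<in>A. f' x = f x)"
    if pos: "position K A f" and d: "d \<in> C'" for A f d
  proof -
    have inj: "inj_on f A"
      using position_eq_iff[OF pos] by (auto simp: inj_on_def)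
    define g where "g = inv_into A f"
    have g: "g (f x) = x" if "x \<in> A" for x
      using inj that by (simp add: g_def)
    obtain B' g' where B': "S.position k B' g'" "f ` A \<subseteq> B'" "d \<in> B'" "\<forall>x\<in>f ` A. g' x = g x"
      using K[OF position_swap[OF pos g] d] by blast
    have inj': "inj_on g' B'"
      using S.position_eq_iff[OF B'(1)] by (auto simp: inj_on_def)
    define f' where "f' = inv_into B' g'"
    have f': "f' (g' x) = x" if "x \<in> B'" for x
      using inj' that by (simp add: f'_def)
    have "position k (g' ` B') f'"
      using S.position_swap[OF B'(1) f'] .
    moreover have "x \<in> g' ` B' \<and> f' x = f x" if "x \<in> A" for x
    proof -
      have "g' (f x) = x" "f x \<in> B'"
        using B' g that by auto
      then show ?thesis
        using f'[of "f x"] by (metis image_eqI)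
    qed
    moreover have "d \<in> f' ` g' ` B'"
      using f'[OF B'(3)] B'(3) by (metis image_eqI)
    ultimately show ?thesis by blast
  qed
  then show ?thesis by blast
qed

section \<open>Elementary equivalence of the models\<close>

lemma order_of_simps [simp]:
  "carrier (order_of M) = carrier M"
  "le (order_of M) x y \<longleftrightarrow> x = y \<or> lt M x y"
  "eq (order_of M) x y \<longleftrightarrow> x = y"
  by (simp_all add: order_of_def)

definition level :: "nat \<Rightarrow> 'a layered \<Rightarrow> 'a \<Rightarrow> int" where
  "level N M x = (THE s. s \<in> indices N \<and> x \<in> layer M s)"

lemma N_geometry_lt:
  assumes "N_geometry N M"
  shows "x \<in> carrier M \<Longrightarrow> \<not> lt M x x"
    and "x \<in> carrier M \<Longrightarrow> y \<in> carrier M \<Longrightarrow> z \<in> carrier M \<Longrightarrow> lt M x y \<Longrightarrow> lt M y z \<Longrightarrow> lt M x z"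
  using assms unfolding N_geometry_def irreflp_on_def transp_on_def by blast+

lemma layer_subset: "x \<in> layer M s \<Longrightarrow> x \<in> carrier M"
  by (simp add: layer_def)

lemma N_geometry_level:
  assumes G: "N_geometry N M" and x: "x \<in> carrier M"
  shows "level N M x \<in> indices N" "x \<in> layer M (level N M x)"
    "s \<in> indices N \<Longrightarrow> x \<in> layer M s \<longleftrightarrow> level N M x = s"
proof -
  obtain t where t: "t \<in> indices N" "x \<in> layer M t"
    using G x unfolding N_geometry_def by blast
  have unique: "u = t" if "u \<in> indices N" "x \<in> layer M u" for u
    using G t that unfolding N_geometry_def disjoint_family_on_def by blast
  have "level N M x = t"
    unfolding level_def by (rule the_equality) (use t unique in blast)+
  then show "level N M x \<in> indices N" "x \<in> layer M (level N M x)"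
    "s \<in> indices N \<Longrightarrow> x \<in> layer M s \<longleftrightarrow> level N M x = s"
    using t unique by blast+
qed

lemma N_geometry_level_less:
  assumes "N_geometry N M" "x \<in> carrier M" "y \<in> carrier M" "lt M x y"
  shows "level N M x < level N M y"
  using assms N_geometry_level[OF assms(1)] unfolding N_geometry_def by blast

lemma possible_type_iff:
  assumes G: "N_geometry N M"
  shows "possible_type N M a b s \<longleftrightarrow>
    a \<in> carrier M \<and> b \<in> carrier M \<and> lt M a b \<and> level N M a < s \<and> s < level N M b"
  unfolding possible_type_def using N_geometry_level[OF G] layer_subset by metis

lemma possible_type_indices:
  "possible_type N M a b s \<Longrightarrow> s \<in> indices N"
  unfolding possible_type_def by force

definition pseudospace_axioms :: "nat \<Rightarrow> 'a layered \<Rightarrow> bool" where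
  "pseudospace_axioms N M \<longleftrightarrow> N_geometry N M \<and>
      (lattice (order_of M) \<and> simply_connected (order_of M)) \<and>
      (\<forall>a b s. possible_type N M a b s \<longrightarrow> infinite {x \<in> layer M s. lt M a x \<and> lt M x b})"

section \<open>Zigzag cycles from cyclic lists\<close>

lemma tri_cases:
  assumes "lattice (order_of M)" and C: "x \<in> carrier M" "z \<in> carrier M"
    and t: "tri (join (order_of M)) (meet (order_of M)) x y z"
  shows "lt M x y \<and> lt M z y \<and> y = x \<squnion>\<^bsub>order_of M\<^esub> z \<or> lt M y x \<and> lt M y z \<and> y = x \<sqinter>\<^bsub>order_of M\<^esub> z"
proof -
  interpret L: lattice "order_of M" by fact
  show ?thesis
    using t C L.join_left[of x z] L.join_right[of x z] L.meet_left[of x z] L.meet_right[of x z]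
    by (auto simp: tri_def)
qed

lemma zig_nth:
  "zig J M xs \<Longrightarrow> i + 2 < length xs \<Longrightarrow> tri J M (xs ! i) (xs ! (i + 1)) (xs ! (i + 2))"
proof (induction J M xs arbitrary: i rule: zig.induct)
  case (1 J M x y z r)
  then show ?case
    by (cases i) auto
qed auto

lemma zigzag_cycle_of_zig:
  assumes lat: "lattice (order_of M)" and G: "N_geometry N M"
    and xs: "set (p # q # xs) \<subseteq> carrier M" "xs \<noteq> []"
    and z: "zig (join (order_of M)) (meet (order_of M)) (p # q # xs @ [p, q])"
  shows "\<exists>up n x. zigzag_cycle (order_of M) up n x"
proof -
  define ys where "ys = p # q # xs @ [p, q]"
  define m where "m = length xs + 2"
  have len: "length ys = m + 2"
    by (simp add: ys_def m_def)
  have C: "ys ! i \<in> carrier M" if "i < m + 2" for i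
    using xs(1) nth_mem[of i ys] that len by (auto simp: ys_def)
  have ends: "ys ! 0 = p" "ys ! 1 = q" "ys ! m = p" "ys ! (m + 1) = q"
    by (simp_all add: ys_def m_def nth_append)
  have t: "lt M (ys ! i) (ys ! (i+1)) \<and> lt M (ys ! (i+2)) (ys ! (i+1)) \<and> ys ! (i+1) = ys ! i \<squnion>\<^bsub>order_of M\<^esub> ys ! (i+2)
      \<or> lt M (ys ! (i+1)) (ys ! i) \<and> lt M (ys ! (i+1)) (ys ! (i+2)) \<and> ys ! (i+1) = ys ! i \<sqinter>\<^bsub>order_of M\<^esub> ys ! (i+2)"
    if "i < m" for i
    using zig_nth[of _ _ ys i] z that len by (intro tri_cases[OF lat C C]) (auto simp: ys_def)
  have asym: "\<not> (lt M (ys ! i) (ys ! j) \<and> lt M (ys ! j) (ys ! i))" if "i < m + 2" "j < m + 2" for i j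
    using N_geometry_lt[OF G] C that by blast
  \<comment> \<open>Entry 1 becomes the first term of the cycle, so \<open>up\<close> records
    whether it is a sink.\<close>
  define up where "up \<longleftrightarrow> lt M (ys ! 1) (ys ! 2)"
  have m0: "0 < m"
    by (simp add: m_def)
  have dir: "(lt M (ys ! (i+1)) (ys ! (i+2)) \<longleftrightarrow> (even i \<longleftrightarrow> up)) \<and>
      (lt M (ys ! (i+2)) (ys ! (i+1)) \<longleftrightarrow> \<not> (even i \<longleftrightarrow> up))" if "i < m" for i
    using that
  proof (induction i)
    case 0
    then show ?case
      using t[of 0] asym[of 1 2] by (auto simp: up_def numeral_2_eq_2)
  next
    case (Suc i)
    then show ?case
      using t[of "Suc i"] asym[of "Suc i + 1" "Suc i + 2"] asym[of "Suc i" "Suc i + 1"] by auto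
  qed
  have wrap: "lt M q p \<longleftrightarrow> up" "lt M p q \<longleftrightarrow> \<not> up"
    using t[of 0] asym[of 0 1] asym[of 1 2] ends m0 by (auto simp: up_def numeral_2_eq_2)
  \<comment> \<open>The pair p, q occurs at positions 0, 1 and again at m, m + 1; alternation gives
    it the same direction only for even m.\<close>
  have "even m"
    using dir[of "m - 1"] wrap ends m0 by (cases m) auto
  then obtain n where n: "m = 2 * n"
    by (auto elim: evenE)
  \<comment> \<open>After the shift by one, both neighbours of x 0 occur in the list, and the
    condition at the closing point is the case i = 0 of \<open>inner\<close>.\<close>
  define x where "x = (\<lambda>i. ys ! (i + 1))"
  have alt: "if is_sink up i then lt M (x i) (x (i + 1)) else lt M (x (i + 1)) (x i)" if "i < m" for i
    using dir[OF that] t[OF that] by (auto simp: x_def is_sink_def)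
  have inner: "ys ! (i + 1) = (if is_sink up i then ys ! i \<sqinter>\<^bsub>order_of M\<^esub> ys ! (i + 2)
      else ys ! i \<squnion>\<^bsub>order_of M\<^esub> ys ! (i + 2))" if "i < m" for i
    using dir[OF that] t[OF that] by (auto simp: is_sink_def)
  have "zigzag (order_of M) up m x"
    unfolding zigzag_def alternating_def
  proof (intro conjI allI impI)
    show "x i \<in> carrier (order_of M)" if "i \<le> m" for i
      using C that by (simp add: x_def)
    show "if is_sink up i then x i \<sqsubseteq>\<^bsub>order_of M\<^esub> x (i + 1) else x (i + 1) \<sqsubseteq>\<^bsub>order_of M\<^esub> x i" if "i < m" for i
      using alt[OF that] by auto
    show "x i \<noteq> x (i + 1)" if "i < m" for i
      using alt[OF that] asym[of "i + 1" "i + 1"] that by (auto simp: x_def split: if_splits)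
    show "x i = (if is_sink up i then x (i - 1) \<sqinter>\<^bsub>order_of M\<^esub> x (i + 1) else x (i - 1) \<squnion>\<^bsub>order_of M\<^esub> x (i + 1))"
      if "0 < i \<and> i < m" for i
      using inner[of i] that by (simp add: x_def)
  qed
  moreover have "x (m - 1) = ys ! 0" "x m = x 0" "x 1 = ys ! 2" "x 0 = ys ! 1"
    using ends m0 by (simp_all add: x_def numeral_2_eq_2)
  ultimately have "zigzag_cycle (order_of M) up n x"
    using inner[of 0] m0 n unfolding zigzag_cycle_def by (auto simp: numeral_2_eq_2)
  then show ?thesis by blast
qed

lemma dense_ranked_lattice_of_axioms:
  assumes "pseudospace_axioms N M"
  obtains bt tp where
    "dense_ranked_lattice (carrier M) (\<lambda>x y. x = y \<or> lt M x y) (join (order_of M)) (meet (order_of M))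
      bt tp (level N M) (N + 1)"
    "level N M bt = -1" "level N M tp = int N + 1"
proof -
  have G: "N_geometry N M" and lat: "lattice (order_of M)" and sc: "simply_connected (order_of M)"
    and inf: "\<And>a b s. possible_type N M a b s \<Longrightarrow> infinite {x \<in> layer M s. lt M a x \<and> lt M x b}"
    using assms unfolding pseudospace_axioms_def by blast+
  interpret L: lattice "order_of M" by fact
  obtain bt tp where bt: "least (order_of M) bt (carrier M)" "bt \<in> layer M (-1)"
    and tp: "greatest (order_of M) tp (carrier M)" "tp \<in> layer M (int N + 1)"
    using G unfolding N_geometry_def by blast
  have C: "bt \<in> carrier M" "tp \<in> carrier M"
    using layer_subset[OF bt(2)] layer_subset[OF tp(2)] by blast+
  note irr = N_geometry_lt(1)[OF G] and tr = N_geometry_lt(2)[OF G]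
  have "dense_ranked_lattice (carrier M) (\<lambda>x y. x = y \<or> lt M x y) (join (order_of M)) (meet (order_of M))
      bt tp (level N M) (N + 1)"
  proof
    fix x y z
    assume xyz: "x \<in> carrier M" "y \<in> carrier M"
    show "x = y \<or> lt M x y \<Longrightarrow> y = x \<or> lt M y x \<Longrightarrow> x = y"
      using irr[of x] tr[of x y x] xyz by blast
    show "x = y \<or> lt M x y \<Longrightarrow> x \<noteq> y \<Longrightarrow> level N M x < level N M y"
      using N_geometry_level_less[OF G] xyz by blast
    show "x \<squnion>\<^bsub>order_of M\<^esub> y \<in> carrier M" "x \<sqinter>\<^bsub>order_of M\<^esub> y \<in> carrier M"
      using L.join_closed[of x y] L.meet_closed[of x y] xyz by simp_all
    show "x = x \<squnion>\<^bsub>order_of M\<^esub> y \<or> lt M x (x \<squnion>\<^bsub>order_of M\<^esub> y)" "y = x \<squnion>\<^bsub>order_of M\<^esub> y \<or> lt M y (x \<squnion>\<^bsub>order_of M\<^esub> y)"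
      using L.join_left[of x y] L.join_right[of x y] xyz by simp_all
    show "x \<sqinter>\<^bsub>order_of M\<^esub> y = x \<or> lt M (x \<sqinter>\<^bsub>order_of M\<^esub> y) x" "x \<sqinter>\<^bsub>order_of M\<^esub> y = y \<or> lt M (x \<sqinter>\<^bsub>order_of M\<^esub> y) y"
      using L.meet_left[of x y] L.meet_right[of x y] xyz by simp_all
    assume z: "z \<in> carrier M"
    show "x = y \<or> lt M x y \<Longrightarrow> y = z \<or> lt M y z \<Longrightarrow> x = z \<or> lt M x z"
      using tr[of x y z] xyz z by blast
    show "x = z \<or> lt M x z \<Longrightarrow> y = z \<or> lt M y z \<Longrightarrow> x \<squnion>\<^bsub>order_of M\<^esub> y = z \<or> lt M (x \<squnion>\<^bsub>order_of M\<^esub> y) z"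
      using L.join_le[of x z y] xyz z by simp
    show "z = x \<or> lt M z x \<Longrightarrow> z = y \<or> lt M z y \<Longrightarrow> z = x \<sqinter>\<^bsub>order_of M\<^esub> y \<or> lt M z (x \<sqinter>\<^bsub>order_of M\<^esub> y)"
      using L.meet_le[of z x y] xyz z by simp
  next
    fix x
    assume x: "x \<in> carrier M"
    show "bt = x \<or> lt M bt x" "x = tp \<or> lt M x tp"
      using bt(1) tp(1) x by (auto simp: least_def greatest_def)
    show "\<bar>level N M x\<bar> \<le> int (N + 1)"
      using N_geometry_level(1)[OF G x] by auto
  next
    fix p q xs
    assume "set (p # q # xs) \<subseteq> carrier M" "xs \<noteq> []"
    then show "\<not> zig (join (order_of M)) (meet (order_of M)) (p # q # xs @ [p, q])"
      using zigzag_cycle_of_zig[OF lat G] sc unfolding simply_connected_def by blast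
  next
    fix a b s
    assume ab: "a \<in> carrier M" "b \<in> carrier M" "a = b \<or> lt M a b" "level N M a < s" "s < level N M b"
    then have pt: "possible_type N M a b s"
      by (auto simp: possible_type_iff[OF G])
    have "{x \<in> layer M s. lt M a x \<and> lt M x b} \<subseteq>
        {x \<in> carrier M. level N M x = s \<and> (a = x \<or> lt M a x) \<and> (x = b \<or> lt M x b)}"
      using N_geometry_level(3)[OF G _ possible_type_indices[OF pt]] layer_subset[of _ M s] by blast
    then show "infinite {x \<in> carrier M. level N M x = s \<and> (a = x \<or> lt M a x) \<and> (x = b \<or> lt M x b)}"
      using inf[OF pt] by (rule infinite_super)
  qed (use C in auto)
  moreover have "level N M bt = -1" "level N M tp = int N + 1"
    using N_geometry_level(3)[OF G C(1), of "-1"] N_geometry_level(3)[OF G C(2), of "int N + 1"] bt tp by auto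
  ultimately show ?thesis
    by (rule that)
qed

section \<open>Truth of formulas along positions\<close>

lemma sat_cong: "\<forall>i\<in>free_vars \<phi>. v i = w i \<Longrightarrow> sat M v \<phi> \<longleftrightarrow> sat M w \<phi>"
proof (induction \<phi> arbitrary: v w)
  case (Exi i \<phi>)
  have "sat M (v(i := x)) \<phi> \<longleftrightarrow> sat M (w(i := x)) \<phi>" for x
    by (rule Exi.IH) (use Exi.prems in auto)
  then show ?case by simp
next
  case (Neg \<phi>)
  then show ?case by simp
next
  case (Conj \<phi> \<psi>)
  then have "sat M v \<phi> \<longleftrightarrow> sat M w \<phi>" "sat M v \<psi> \<longleftrightarrow> sat M w \<psi>"
    by auto
  then show ?case by simp
qed auto

lemma holds_in_sentence:
  assumes "free_vars \<phi> = {}" "range v \<subseteq> carrier M"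
  shows "holds_in M \<phi> \<longleftrightarrow> sat M v \<phi>"
  unfolding holds_in_def using sat_cong[of \<phi> v _ M] assms by auto

text \<open>An Ehrenfeucht-Fraisse argument in which the degree of niceness replaces the number of
  remaining rounds: a quantifier in front of a formula of degree k needs the larger of the degrees
  for one forth and one back move that end at k.\<close>

lemma position_sat:
  assumes T: "two_lattices (carrier M) (\<lambda>x y. x = y \<or> lt M x y) jn mt bt tp (level N M) H
      (carrier M') (\<lambda>x y. x = y \<or> lt M' x y) jn' mt' bt' tp' (level N M') H'"
    and G: "N_geometry N M" "N_geometry N M'"
  defines "pos \<equiv> two_lattices.position (carrier M) (\<lambda>x y. x = y \<or> lt M x y) jn mt bt tp (level N M)
      (carrier M') (\<lambda>x y. x = y \<or> lt M' x y) jn' mt' bt' tp' (level N M')"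
  assumes "layer_symbols \<phi> \<subseteq> indices N"
  shows "\<exists>K. \<forall>A f v. pos K A f \<longrightarrow> range v \<subseteq> A \<longrightarrow> (sat M v \<phi> \<longleftrightarrow> sat M' (f \<circ> v) \<phi>)"
  using assms(5)
proof -
  interpret T: two_lattices "carrier M" "\<lambda>x y. x = y \<or> lt M x y" jn mt bt tp "level N M" H
      "carrier M'" "\<lambda>x y. x = y \<or> lt M' x y" jn' mt' bt' tp' "level N M'" H'
    by (rule T)
  have C: "x \<in> carrier M" "f x \<in> carrier M'" if "pos k A f" "x \<in> A" for k A f x
    using that unfolding pos_def T.position_def T.L.knice_def T.L'.knice_def by blast+
  have lt: "lt M x y \<longleftrightarrow> lt M' (f x) (f y)" if p: "pos k A f" and xy: "x \<in> A" "y \<in> A" for k A f x y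
  proof -
    have "x = y \<or> lt M x y \<longleftrightarrow> f x = f y \<or> lt M' (f x) (f y)"
      using p xy unfolding pos_def T.position_def by blast
    moreover have "f x = f y \<longleftrightarrow> x = y"
      using T.position_eq_iff p xy unfolding pos_def by blast
    moreover have "\<not> lt M x x" "\<not> lt M' (f x) (f x)"
      using N_geometry_lt(1)[OF G(1) C(1)[OF p xy(1)]] N_geometry_lt(1)[OF G(2) C(2)[OF p xy(1)]] by blast+
    ultimately show ?thesis by metis
  qed
  show ?thesis
    using assms(5)
  proof (induction \<phi>)
    case (LessThan i j)
    then show ?case
      using lt by (auto intro!: exI[of _ 0]) (meson range_subsetD)+
  next
    case (Equal i j)
    then show ?case
      using T.position_eq_iff unfolding pos_def by (auto intro!: exI[of _ 0]) (meson range_subsetD)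
  next
    case (LayerAt s i)
    have "v i \<in> layer M s \<longleftrightarrow> f (v i) \<in> layer M' s" if p: "pos k A f" and v: "range v \<subseteq> A" for k A f v
    proof -
      have vi: "v i \<in> A"
        using v by auto
      then have "level N M' (f (v i)) = level N M (v i)"
        using p unfolding pos_def T.position_def by blast
      then show ?thesis
        using N_geometry_level(3)[OF G(1) C(1)[OF p vi]] N_geometry_level(3)[OF G(2) C(2)[OF p vi]] LayerAt by simp
    qed
    then show ?case
      by simp
  next
    case (Neg \<phi>)
    then show ?case by simp
  next
    case (Conj \<phi> \<psi>)
    then have "layer_symbols \<phi> \<subseteq> indices N" "layer_symbols \<psi> \<subseteq> indices N"
      by auto
    then obtain K1 K2 where
      K: "\<forall>A f v. pos K1 A f \<longrightarrow> range v \<subseteq> A \<longrightarrow> (sat M v \<phi> \<longleftrightarrow> sat M' (f \<circ> v) \<phi>)"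
        "\<forall>A f v. pos K2 A f \<longrightarrow> range v \<subseteq> A \<longrightarrow> (sat M v \<psi> \<longleftrightarrow> sat M' (f \<circ> v) \<psi>)"
      using Conj.IH by blast
    have "sat M v (Conj \<phi> \<psi>) \<longleftrightarrow> sat M' (f \<circ> v) (Conj \<phi> \<psi>)"
      if pos: "pos (max K1 K2) A f" and v: "range v \<subseteq> A" for A f v
    proof -
      have "pos K1 A f" "pos K2 A f"
        using T.position_mono[OF pos[unfolded pos_def]] unfolding pos_def by simp_all
      then have "sat M v \<phi> \<longleftrightarrow> sat M' (f \<circ> v) \<phi>" "sat M v \<psi> \<longleftrightarrow> sat M' (f \<circ> v) \<psi>"
        using K v by blast+
      then show ?thesis by simp
    qed
    then show ?case by blast
  next
    case (Exi i \<phi>)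
    then have "layer_symbols \<phi> \<subseteq> indices N"
      by simp
    then obtain k where k: "\<And>A f v. pos k A f \<Longrightarrow> range v \<subseteq> A \<Longrightarrow> sat M v \<phi> \<longleftrightarrow> sat M' (f \<circ> v) \<phi>"
      using Exi.IH by blast
    obtain K1 where K1: "\<forall>A f c. pos K1 A f \<longrightarrow> c \<in> carrier M \<longrightarrow>
        (\<exists>A' f'. pos k A' f' \<and> A \<subseteq> A' \<and> c \<in> A' \<and> (\<forall>x\<in>A. f' x = f x))"
      using T.extend_domain[of k] unfolding pos_def by (rule exE)
    obtain K2 where K2: "\<forall>A f d. pos K2 A f \<longrightarrow> d \<in> carrier M' \<longrightarrow>
        (\<exists>A' f'. pos k A' f' \<and> A \<subseteq> A' \<and> d \<in> f' ` A' \<and> (\<forall>x\<in>A. f' x = f x))"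
      using T.extend_range[of k] unfolding pos_def by (rule exE)
    have step: "sat M (v(i := c)) \<phi> \<longleftrightarrow> sat M' ((f \<circ> v)(i := f' c)) \<phi>"
      if "pos k A' f'" "A \<subseteq> A'" "c \<in> A'" "\<forall>x\<in>A. f' x = f x" "range v \<subseteq> A" for A A' f f' c v
    proof -
      have v: "v j \<in> A" for j
        using that(5) by auto
      then have "range (v(i := c)) \<subseteq> A'"
        using that by auto
      moreover have "f' \<circ> v(i := c) = (f \<circ> v)(i := f' c)"
        using that v by (auto simp: fun_eq_iff)
      ultimately show ?thesis
        using k[OF that(1), of "v(i := c)"] by simp
    qed
    have "sat M v (Exi i \<phi>) \<longleftrightarrow> sat M' (f \<circ> v) (Exi i \<phi>)"
      if pos: "pos (max K1 K2) A f" and v: "range v \<subseteq> A" for A f v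
    proof
      have pos': "pos K1 A f" "pos K2 A f"
        using T.position_mono[OF pos[unfolded pos_def]] unfolding pos_def by simp_all
      show "sat M' (f \<circ> v) (Exi i \<phi>)" if "sat M v (Exi i \<phi>)"
      proof -
        obtain c where c: "c \<in> carrier M" "sat M (v(i := c)) \<phi>"
          using \<open>sat M v (Exi i \<phi>)\<close> by auto
        obtain A' f' where f': "pos k A' f'" "A \<subseteq> A'" "c \<in> A'" "\<forall>x\<in>A. f' x = f x"
          using K1[rule_format, OF pos'(1) c(1)] by blast
        then have "sat M' ((f \<circ> v)(i := f' c)) \<phi>" "f' c \<in> carrier M'"
          using step[OF f' v] c C(2)[OF f'(1,3)] by auto
        then show ?thesis
          by auto
      qed
      show "sat M v (Exi i \<phi>)" if "sat M' (f \<circ> v) (Exi i \<phi>)"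
      proof -
        obtain d where d: "d \<in> carrier M'" "sat M' ((f \<circ> v)(i := d)) \<phi>"
          using \<open>sat M' (f \<circ> v) (Exi i \<phi>)\<close> by auto
        obtain A' f' where f': "pos k A' f'" "A \<subseteq> A'" "d \<in> f' ` A'" "\<forall>x\<in>A. f' x = f x"
          using K2[rule_format, OF pos'(2) d(1)] by blast
        then obtain c where c: "c \<in> A'" "d = f' c"
          by blast
        then have "sat M (v(i := c)) \<phi>" "c \<in> carrier M"
          using step[OF f'(1,2) c(1) f'(4) v] d C(1)[OF f'(1) c(1)] by auto
        then show ?thesis
          by auto
      qed
    qed
    then show ?case by blast
  qed
qed

text \<open>The map between the two pairs of bounds is a position of every degree, so it is
  available whatever degree the sentence requires.\<close>

theorem pseudospace_axioms_complete:
  assumes M: "pseudospace_axioms N M" and M': "pseudospace_axioms N M'" and \<phi>: "sentence N \<phi>"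
  shows "holds_in M \<phi> \<longleftrightarrow> holds_in M' \<phi>"
proof -
  have G: "N_geometry N M" "N_geometry N M'"
    using M M' by (simp_all add: pseudospace_axioms_def)
  obtain bt tp where L: "dense_ranked_lattice (carrier M) (\<lambda>x y. x = y \<or> lt M x y)
      (join (order_of M)) (meet (order_of M)) bt tp (level N M) (N + 1)"
    and lev: "level N M bt = -1" "level N M tp = int N + 1"
    using dense_ranked_lattice_of_axioms[OF M] .
  obtain bt' tp' where L': "dense_ranked_lattice (carrier M') (\<lambda>x y. x = y \<or> lt M' x y)
      (join (order_of M')) (meet (order_of M')) bt' tp' (level N M') (N + 1)"
    and lev': "level N M' bt' = -1" "level N M' tp' = int N + 1"
    using dense_ranked_lattice_of_axioms[OF M'] .
  have T: "two_lattices (carrier M) (\<lambda>x y. x = y \<or> lt M x y)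
      (join (order_of M)) (meet (order_of M)) bt tp (level N M) (N + 1)
      (carrier M') (\<lambda>x y. x = y \<or> lt M' x y) (join (order_of M')) (meet (order_of M')) bt' tp' (level N M') (N + 1)"
    unfolding two_lattices_def using L L' by blast
  interpret T: two_lattices "carrier M" "\<lambda>x y. x = y \<or> lt M x y" "join (order_of M)" "meet (order_of M)"
      bt tp "level N M" "N + 1" "carrier M'" "\<lambda>x y. x = y \<or> lt M' x y" "join (order_of M')" "meet (order_of M')"
      bt' tp' "level N M'" "N + 1"
    by (rule T)
  have sent: "free_vars \<phi> = {}" "layer_symbols \<phi> \<subseteq> indices N"
    using \<phi> by (auto simp: sentence_def)
  obtain K where K: "\<And>A f v. T.position K A f \<Longrightarrow> range v \<subseteq> A \<Longrightarrow> sat M v \<phi> \<longleftrightarrow> sat M' (f \<circ> v) \<phi>"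
    using position_sat[OF T G sent(2)] by blast
  define f where "f = (\<lambda>x. if x = bt then bt' else tp')"
  have ne: "bt \<noteq> tp" "bt' \<noteq> tp'"
    using lev lev' by auto
  then have f: "f bt = bt'" "f tp = tp'"
    by (auto simp: f_def)
  have "T.position K {bt, tp} f"
    unfolding T.position_def
    using f ne lev lev' T.L.knice_base T.L'.knice_base T.L.bt(2)[OF T.L.tp(1)] T.L'.bt(2)[OF T.L'.tp(1)]
      T.L.antisym[OF T.L.bt(1) T.L.tp(1)] T.L'.antisym[OF T.L'.bt(1) T.L'.tp(1)] by auto
  then have "sat M (\<lambda>_. bt) \<phi> \<longleftrightarrow> sat M' (f \<circ> (\<lambda>_. bt)) \<phi>"
    by (rule K) auto
  moreover have "holds_in M \<phi> \<longleftrightarrow> sat M (\<lambda>_. bt) \<phi>"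
    using T.L.bt(1) by (intro holds_in_sentence[OF sent(1)]) auto
  moreover have "holds_in M' \<phi> \<longleftrightarrow> sat M' (f \<circ> (\<lambda>_. bt)) \<phi>"
    using T.L'.bt(1) f by (intro holds_in_sentence[OF sent(1)]) auto
  ultimately show ?thesis by simp
qed

section \<open>The universal pseudospace satisfies the axioms\<close>

definition lub_in :: "('a \<Rightarrow> 'a \<Rightarrow> bool) \<Rightarrow> 'a set \<Rightarrow> 'a \<Rightarrow> 'a \<Rightarrow> 'a \<Rightarrow> bool" where
  "lub_in R S x y e \<longleftrightarrow> e \<in> S \<and> R x e \<and> R y e \<and> (\<forall>u\<in>S. R x u \<longrightarrow> R y u \<longrightarrow> R e u)"

text \<open>Greatest lower bounds are the least upper bounds for the converse relation.\<close>

locale one_point_order =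
  fixes R :: "'a \<Rightarrow> 'a \<Rightarrow> bool" and S :: "'a set" and w a b :: 'a
  assumes refl: "\<And>x. x \<in> insert w S \<Longrightarrow> R x x"
    and trans: "\<And>x y z. x \<in> insert w S \<Longrightarrow> y \<in> insert w S \<Longrightarrow> z \<in> insert w S \<Longrightarrow> R x y \<Longrightarrow> R y z \<Longrightarrow> R x z"
    and ab: "a \<in> S" "b \<in> S"
    and below: "\<And>c. c \<in> S \<Longrightarrow> R c w \<longleftrightarrow> R c a"
    and above: "\<And>c. c \<in> S \<Longrightarrow> R w c \<longleftrightarrow> R b c"
begin

text \<open>If w is an upper bound of x and y, so is a; then e is below a and hence below w.\<close>

lemma lub_in_insert:
  assumes "lub_in R S x y e" "x \<in> S" "y \<in> S"
  shows "lub_in R (insert w S) x y e"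
  using assms below ab unfolding lub_in_def by auto

text \<open>For c not below w, every common upper bound of w and c is an old element above b, so the
  join of b and c serves.\<close>

lemma lub_exists_insert:
  assumes ex: "\<And>x y. x \<in> S \<Longrightarrow> y \<in> S \<Longrightarrow> \<exists>e. lub_in R S x y e"
    and xy: "x \<in> insert w S" "y \<in> insert w S"
  shows "\<exists>e. lub_in R (insert w S) x y e"
proof -
  have new: "\<exists>e. lub_in R (insert w S) w c e \<and> lub_in R (insert w S) c w e" if c: "c \<in> insert w S" for c
  proof (cases "R c w")
    case True
    then have "lub_in R (insert w S) w c w" "lub_in R (insert w S) c w w"
      using refl by (auto simp: lub_in_def)
    then show ?thesis by blast
  next
    case False
    then have cS: "c \<in> S"
      using c refl by auto
    obtain e where e: "lub_in R S b c e"
      using ex ab(2) cS by blast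
    then have eS: "e \<in> S" "R b e" "R c e" "\<And>u. u \<in> S \<Longrightarrow> R b u \<Longrightarrow> R c u \<Longrightarrow> R e u"
      by (auto simp: lub_in_def)
    then have "R w e"
      using above by simp
    moreover have "R e u" if "u \<in> insert w S" "R w u" "R c u" for u
      using that False eS(4) above by auto
    ultimately have "lub_in R (insert w S) w c e" "lub_in R (insert w S) c w e"
      using eS by (auto simp: lub_in_def)
    then show ?thesis by blast
  qed
  show ?thesis
  proof (cases "x \<in> S \<and> y \<in> S")
    case True
    then show ?thesis
      using ex lub_in_insert by blast
  next
    case False
    then show ?thesis
      using new xy by blast
  qed
qed

end

text \<open>Shows that the bottom of the first stage stays the bottom of every later stage: there is
  no layer below -1, so the least element cannot be strictly below z.\<close>

lemma N_geometry_bottom: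
  assumes G: "N_geometry N M" and z: "z \<in> layer M (-1)" and x: "x \<in> carrier M"
  shows "z = x \<or> lt M z x"
proof -
  obtain z' where z': "least (order_of M) z' (carrier M)"
    using G unfolding N_geometry_def by blast
  have zC: "z \<in> carrier M" "level N M z = -1"
    using z layer_subset[OF z] N_geometry_level(3)[OF G, of z "-1"] by auto
  have min: "z' \<in> carrier M" "\<And>y. y \<in> carrier M \<Longrightarrow> z' = y \<or> lt M z' y"
    using z' by (auto simp: least_def)
  have "\<not> lt M z' z"
    using N_geometry_level_less[OF G min(1) zC(1)] N_geometry_level(1)[OF G min(1)] zC(2) by auto
  then have "z' = z"
    using min zC by blast
  then show ?thesis
    using min x by blast
qed

lemma N_geometry_top:
  assumes G: "N_geometry N M" and z: "z \<in> layer M (int N + 1)" and x: "x \<in> carrier M"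
  shows "x = z \<or> lt M x z"
proof -
  obtain z' where z': "greatest (order_of M) z' (carrier M)"
    using G unfolding N_geometry_def by blast
  have zC: "z \<in> carrier M" "level N M z = int N + 1"
    using z layer_subset[OF z] N_geometry_level(3)[OF G, of z "int N + 1"] by auto
  have max: "z' \<in> carrier M" "\<And>y. y \<in> carrier M \<Longrightarrow> y = z' \<or> lt M y z'"
    using z' by (auto simp: greatest_def)
  have "\<not> lt M z z'"
    using N_geometry_level_less[OF G zC(1) max(1)] N_geometry_level(1)[OF G max(1)] zC(2) by auto
  then have "z' = z"
    using max zC by blast
  then show ?thesis
    using max x by blast
qed

lemma least_Upper_iff:
  assumes "x \<in> carrier M" "y \<in> carrier M"
  shows "least (order_of M) e (Upper (order_of M) {x, y}) \<longleftrightarrow>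
    lub_in (\<lambda>x y. x = y \<or> lt M x y) (carrier M) x y e"
  using assms unfolding least_def Upper_def lub_in_def by (auto; metis)

lemma greatest_Lower_iff:
  assumes "x \<in> carrier M" "y \<in> carrier M"
  shows "greatest (order_of M) e (Lower (order_of M) {x, y}) \<longleftrightarrow>
    lub_in (\<lambda>x y. y = x \<or> lt M y x) (carrier M) x y e"
  using assms unfolding greatest_def Lower_def lub_in_def by (auto; metis)

lemma lattice_order_of:
  assumes G: "N_geometry N M"
  shows "lattice (order_of M) \<longleftrightarrow>
    (\<forall>x\<in>carrier M. \<forall>y\<in>carrier M. \<exists>e. lub_in (\<lambda>x y. x = y \<or> lt M x y) (carrier M) x y e) \<and>
    (\<forall>x\<in>carrier M. \<forall>y\<in>carrier M. \<exists>e. lub_in (\<lambda>x y. y = x \<or> lt M y x) (carrier M) x y e)" (is "_ \<longleftrightarrow> ?R")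
proof
  assume "lattice (order_of M)"
  then interpret L: lattice "order_of M" .
  show ?R
    using L.sup_of_two_exists L.inf_of_two_exists by (auto simp: least_Upper_iff greatest_Lower_iff)
next
  assume R: ?R
  note irr = N_geometry_lt(1)[OF G] and tr = N_geometry_lt(2)[OF G]
  show "lattice (order_of M)"
  proof
    show "(.=\<^bsub>order_of M\<^esub>) = (=)"
      by (simp add: fun_eq_iff)
    show "\<exists>s. least (order_of M) s (Upper (order_of M) {x, y})"
      "\<exists>s. greatest (order_of M) s (Lower (order_of M) {x, y})"
      if "x \<in> carrier (order_of M)" "y \<in> carrier (order_of M)" for x y
      using R that by (simp_all add: least_Upper_iff greatest_Lower_iff)
  qed (unfold order_of_simps, (use irr tr in blast)+)
qed

lemma join_eq:
  assumes "lattice (order_of M)" "x \<in> carrier M" "y \<in> carrier M"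
  shows "e = x \<squnion>\<^bsub>order_of M\<^esub> y \<longleftrightarrow> lub_in (\<lambda>x y. x = y \<or> lt M x y) (carrier M) x y e"
proof -
  interpret L: lattice "order_of M" by fact
  have j: "lub_in (\<lambda>x y. x = y \<or> lt M x y) (carrier M) x y (x \<squnion>\<^bsub>order_of M\<^esub> y)"
    using assms(2,3) L.join_left[of x y] L.join_right[of x y] L.join_closed[of x y] L.join_le[of x _ y]
    by (auto simp: lub_in_def)
  moreover have "e = x \<squnion>\<^bsub>order_of M\<^esub> y" if "lub_in (\<lambda>x y. x = y \<or> lt M x y) (carrier M) x y e"
    by (rule L.le_antisym) (use that j in \<open>simp_all only: order_of_simps lub_in_def\<close>)
  ultimately show ?thesis by (intro iffI) simp_all
qed

lemma meet_eq:
  assumes "lattice (order_of M)" "x \<in> carrier M" "y \<in> carrier M"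
  shows "e = x \<sqinter>\<^bsub>order_of M\<^esub> y \<longleftrightarrow> lub_in (\<lambda>x y. y = x \<or> lt M y x) (carrier M) x y e"
proof -
  interpret L: lattice "order_of M" by fact
  have j: "lub_in (\<lambda>x y. y = x \<or> lt M y x) (carrier M) x y (x \<sqinter>\<^bsub>order_of M\<^esub> y)"
    using assms(2,3) L.meet_left[of x y] L.meet_right[of x y] L.meet_closed[of x y] L.meet_le[of _ x y]
    by (auto simp: lub_in_def)
  moreover have "e = x \<sqinter>\<^bsub>order_of M\<^esub> y" if "lub_in (\<lambda>x y. y = x \<or> lt M y x) (carrier M) x y e"
    by (rule L.le_antisym) (use that j in \<open>simp_all only: order_of_simps lub_in_def\<close>)
  ultimately show ?thesis by (intro iffI) simp_all
qed

text \<open>The only property of cycles used for the universal pseudospace: each entry is produced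
  from two other values by a join or meet, so none can be the last one added.\<close>

lemma zigzag_cycle_neighbours:
  assumes z: "zigzag_cycle L up n x" and j: "j \<le> 2 * n"
  shows "\<exists>u\<in>x ` {..2 * n}. \<exists>v\<in>x ` {..2 * n}. u \<noteq> x j \<and> v \<noteq> x j \<and> (x j = u \<sqinter>\<^bsub>L\<^esub> v \<or> x j = u \<squnion>\<^bsub>L\<^esub> v)"
proof -
  have n: "1 \<le> n" and zz: "zigzag L up (2 * n) x" and e: "x 0 = x (2 * n)"
    and w: "x 0 = (if is_sink up 0 then x (2 * n - 1) \<sqinter>\<^bsub>L\<^esub> x 1 else x (2 * n - 1) \<squnion>\<^bsub>L\<^esub> x 1)"
    using z unfolding zigzag_cycle_def by blast+
  have wrap: "x 0 = x (2 * n - 1) \<sqinter>\<^bsub>L\<^esub> x 1 \<or> x 0 = x (2 * n - 1) \<squnion>\<^bsub>L\<^esub> x 1"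
    using w by presburger
  have ne: "x i \<noteq> x (i + 1)" if "i < 2 * n" for i
    using zz that unfolding zigzag_def by blast
  have inner: "x i = x (i - 1) \<sqinter>\<^bsub>L\<^esub> x (i + 1) \<or> x i = x (i - 1) \<squnion>\<^bsub>L\<^esub> x (i + 1)" if "0 < i" "i < 2 * n" for i
    using zz that unfolding zigzag_def by presburger
  show ?thesis
  proof (cases "0 < j \<and> j < 2 * n")
    case True
    then have "j - 1 < 2 * n" "j - 1 + 1 = j"
      by auto
    then have "x (j - 1) \<noteq> x j" "x (j + 1) \<noteq> x j"
      using ne[of "j - 1"] ne[of j] True by metis+
    moreover have "x (j - 1) \<in> x ` {..2 * n}" "x (j + 1) \<in> x ` {..2 * n}"
      using True by auto
    ultimately show ?thesis
      using inner[of j] True by blast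
  next
    case False
    then have "x j = x 0"
      using j e by auto
    moreover have "x (2 * n - 1) \<noteq> x 0" "x 1 \<noteq> x 0" "x (2 * n - 1) \<in> x ` {..2 * n}" "x 1 \<in> x ` {..2 * n}"
      using ne[of "2 * n - 1"] ne[of 0] n e by auto
    ultimately show ?thesis
      using wrap by metis
  qed
qed

text \<open>Finitely many elements always lie in a common stage. Each stage is closed under the
  joins and meets of the union, which gives the lattice property and excludes cycles.\<close>

lemma universal_pseudospace_axioms:
  assumes "universal_pseudospace N P"
  shows "pseudospace_axioms N P"
proof -
  obtain V x \<tau> where V0: "N_geometry N (V 0)" "card (carrier (V 0)) = 2"
    and step: "\<And>i. simple_extension N (V i) (V (Suc i)) (x i) (\<tau> i)"
    and PC: "carrier P = (\<Union>i. carrier (V i))" and sub: "\<And>i. substructure N (V i) P"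
    and all: "\<And>a b s. possible_type N P a b s \<Longrightarrow> infinite {i. \<tau> i = (a, b, s)}"
    using assms unfolding universal_pseudospace_def by blast
  define C where "C i = carrier (V i)" for i
  let ?R = "\<lambda>x y. x = y \<or> lt P x y"
  have GV: "N_geometry N (V i)" for i
    using step[of i] by (cases "\<tau> i") (simp add: simple_extension_def)
  have CS: "C (Suc i) = insert (x i) (C i)" "x i \<notin> C i" for i
    using step[of i] by (cases "\<tau> i"; simp add: simple_extension_def C_def)+
  have lt: "lt (V i) c d \<longleftrightarrow> lt P c d" if "c \<in> C i" "d \<in> C i" for c d i
    using sub[of i] that by (simp add: substructure_def C_def)
  have layer: "layer (V i) s = layer P s \<inter> C i" if "s \<in> indices N" for i s
    using sub[of i] that by (simp add: substructure_def C_def)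
  have "C i \<subseteq> C (Suc i)" for i
    using CS by blast
  then have mono: "C i \<subseteq> C j" if "i \<le> j" for i j
    using that by (rule lift_Suc_mono_le)
  have stage: "\<exists>i. F \<subseteq> C i" if "finite F" "F \<subseteq> carrier P" for F
    using that
  proof (induction F rule: finite_induct)
    case (insert c F)
    then obtain i j where "F \<subseteq> C i" "c \<in> C j"
      by (auto simp: PC C_def)
    then have "insert c F \<subseteq> C (max i j)"
      using mono[of i "max i j"] mono[of j "max i j"] by auto
    then show ?case by blast
  qed simp
  have CP: "C i \<subseteq> carrier P" for i
    by (auto simp: PC C_def)
  have stage3: "\<exists>i. c \<in> C i \<and> d \<in> C i \<and> e \<in> C i" if "c \<in> carrier P" "d \<in> carrier P" "e \<in> carrier P" for c d e
    using stage[of "{c, d, e}"] that by auto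
  have irr: "\<not> lt P c c" if c: "c \<in> carrier P" for c
  proof -
    obtain i where "c \<in> C i"
      using c by (auto simp: PC C_def)
    then show ?thesis
      using N_geometry_lt(1)[OF GV[of i]] lt by (auto simp: C_def)
  qed
  have tr: "lt P c e" if cde: "c \<in> carrier P" "d \<in> carrier P" "e \<in> carrier P" "lt P c d" "lt P d e" for c d e
  proof -
    obtain i where "c \<in> C i" "d \<in> C i" "e \<in> C i"
      using stage3[OF cde(1-3)] by blast
    then show ?thesis
      using N_geometry_lt(2)[OF GV[of i], of c d e] lt cde by (auto simp: C_def)
  qed
  obtain z where z0: "z \<in> layer (V 0) (-1)"
    using V0(1) unfolding N_geometry_def by blast
  obtain u where u0: "u \<in> layer (V 0) (int N + 1)"
    using V0(1) unfolding N_geometry_def by blast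
  have zu: "z \<in> layer P (-1)" "z \<in> C 0" "u \<in> layer P (int N + 1)" "u \<in> C 0"
    using z0 u0 layer[of "-1" 0] layer[of "int N + 1" 0] by auto
  have zl: "?R z c" "?R c u" if c: "c \<in> carrier P" for c
  proof -
    obtain i where i: "c \<in> C i"
      using c by (auto simp: PC C_def)
    have i': "z \<in> C i" "u \<in> C i"
      using zu mono[of 0 i] by auto
    then have "z \<in> layer (V i) (-1)" "u \<in> layer (V i) (int N + 1)"
      using zu layer[of "-1" i] layer[of "int N + 1" i] by auto
    then show "?R z c" "?R c u"
      using N_geometry_bottom[OF GV[of i], of z c] N_geometry_top[OF GV[of i], of u c]
        lt[of z i c] lt[of c i u] i i' by (auto simp: C_def)
  qed
  have G: "N_geometry N P"
    unfolding N_geometry_def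
  proof (intro conjI)
    show "irreflp_on (carrier P) (lt P)"
      using irr by (auto simp: irreflp_on_def)
    show "transp_on (carrier P) (lt P)"
      using tr unfolding transp_on_def by blast
    show "(\<Union>s\<in>indices N. layer P s) = carrier P"
    proof
      show "(\<Union>s\<in>indices N. layer P s) \<subseteq> carrier P"
        by (auto simp: layer_def)
      show "carrier P \<subseteq> (\<Union>s\<in>indices N. layer P s)"
      proof
        fix c assume "c \<in> carrier P"
        then obtain i where i: "c \<in> C i"
          by (auto simp: PC C_def)
        then have "c \<in> layer (V i) (level N (V i) c)" "level N (V i) c \<in> indices N"
          using N_geometry_level[OF GV[of i]] by (auto simp: C_def)
        then show "c \<in> (\<Union>s\<in>indices N. layer P s)"
          using layer by blast
      qed
    qed
    show "disjoint_family_on (layer P) (indices N)"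
      unfolding disjoint_family_on_def
    proof (intro ballI impI, rule ccontr)
      fix s t assume st: "s \<in> indices N" "t \<in> indices N" "s \<noteq> t" "layer P s \<inter> layer P t \<noteq> {}"
      then obtain c where c: "c \<in> layer P s" "c \<in> layer P t"
        by blast
      then obtain i where i: "c \<in> C i"
        using layer_subset[OF c(1)] by (auto simp: PC C_def)
      then have "c \<in> layer (V i) s" "c \<in> layer (V i) t"
        using c st layer by auto
      then show False
        using N_geometry_level(3)[OF GV[of i]] st i by (auto simp: C_def)
    qed
    show "\<forall>s\<in>indices N. \<forall>t\<in>indices N. \<forall>c\<in>layer P s. \<forall>d\<in>layer P t. lt P c d \<longrightarrow> s < t"
    proof (intro ballI impI)
      fix s t c d assume st: "s \<in> indices N" "t \<in> indices N" "c \<in> layer P s" "d \<in> layer P t" "lt P c d"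
      then obtain i where i: "c \<in> C i" "d \<in> C i"
        using stage3[of c d d] layer_subset[OF st(3)] layer_subset[OF st(4)] by auto
      then have "c \<in> layer (V i) s" "d \<in> layer (V i) t" "lt (V i) c d"
        using st layer lt by auto
      then show "s < t"
        using GV[of i] st unfolding N_geometry_def by blast
    qed
    show "\<exists>z. least (order_of P) z (carrier P) \<and> z \<in> layer P (- 1)"
      using zl zu layer_subset[OF zu(1)] by (auto simp: least_def)
    show "\<exists>u. greatest (order_of P) u (carrier P) \<and> u \<in> layer P (int N + 1)"
      using zl zu layer_subset[OF zu(3)] by (auto simp: greatest_def)
  qed
  have "z \<noteq> u"
    using N_geometry_level(3)[OF G, of z "-1"] N_geometry_level(3)[OF G, of u "int N + 1"] zu CP[of 0] by auto
  then have C0: "C 0 = {z, u}"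
    using V0(2) zu card_subset_eq[of "C 0" "{z, u}"] card_gt_0_iff[of "C 0"] by (auto simp: C_def)
  have new: "\<exists>a b. one_point_order ?R (C i) (x i) a b \<and> one_point_order (\<lambda>c d. ?R d c) (C i) (x i) b a" for i
  proof -
    obtain a b s where \<tau>: "\<tau> i = (a, b, s)"
      by (cases "\<tau> i")
    have pt: "possible_type N (V i) a b s"
      and ord: "\<And>c. c \<in> C i \<Longrightarrow> (lt (V (Suc i)) c (x i) \<longleftrightarrow> c = a \<or> lt (V i) c a) \<and> (lt (V (Suc i)) (x i) c \<longleftrightarrow> b = c \<or> lt (V i) b c)"
      using step[of i] \<tau> by (auto simp: simple_extension_def C_def)
    have ab: "a \<in> C i" "b \<in> C i"
      using pt possible_type_iff[OF GV[of i]] by (auto simp: C_def)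
    have xS: "x i \<in> C (Suc i)" "C i \<subseteq> C (Suc i)" "insert (x i) (C i) \<subseteq> carrier P"
      using CS[of i] CP[of "Suc i"] by auto
    have xi: "x i \<in> carrier P" "C i \<subseteq> carrier P"
      using xS by auto
    have new_iff: "?R c (x i) \<longleftrightarrow> ?R c a" "?R (x i) c \<longleftrightarrow> ?R b c" if "c \<in> C i" for c
      using ord[OF that] lt[of c "Suc i" "x i"] lt[of "x i" "Suc i" c] lt[of c i a] lt[of b i c] that ab xS CS(2)[of i] by auto
    have R_trans: "?R c e" if "c \<in> insert (x i) (C i)" "d \<in> insert (x i) (C i)" "e \<in> insert (x i) (C i)" "?R c d" "?R d e" for c d e
      using tr[of c d e] that xS(3) by blast
    have "one_point_order ?R (C i) (x i) a b"
      by (rule one_point_order.intro[OF _ R_trans ab new_iff]) simp_all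
    moreover have "one_point_order (\<lambda>c d. ?R d c) (C i) (x i) b a"
      by (rule one_point_order.intro[OF _ _ ab(2,1) new_iff(2,1)]) (simp, rule R_trans)
    ultimately have "one_point_order ?R (C i) (x i) a b \<and> one_point_order (\<lambda>c d. ?R d c) (C i) (x i) b a" ..
    then show ?thesis by blast
  qed
  have lub: "\<exists>e. lub_in ?R (C i) c d e" "\<exists>e. lub_in (\<lambda>c d. ?R d c) (C i) c d e" if "c \<in> C i" "d \<in> C i" for c d i
    using that
  proof (induction i arbitrary: c d)
    case 0
    have "?R z u" by (rule zl) (use zu CP in auto)
    { case 1
      have "lub_in ?R (C 0) c d (if c = z \<and> d = z then z else u)"
        using 1 C0 \<open>?R z u\<close> by (auto simp: lub_in_def)
      then show ?case by blast
    next
      case 2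
      have "lub_in (\<lambda>c d. ?R d c) (C 0) c d (if c = u \<and> d = u then u else z)"
        using 2 C0 \<open>?R z u\<close> by (auto simp: lub_in_def)
      then show ?case by blast }
  next
    case (Suc i)
    obtain a b where ab: "one_point_order ?R (C i) (x i) a b" "one_point_order (\<lambda>c d. ?R d c) (C i) (x i) b a"
      using new by blast
    { case 1
      then show ?case
        using one_point_order.lub_exists_insert[OF ab(1) Suc(1)] unfolding CS by blast
    next
      case 2
      then show ?case
        using one_point_order.lub_exists_insert[OF ab(2) Suc(2)] unfolding CS by blast }
  qed
  \<comment> \<open>A bound computed at one stage survives all later one-point extensions and is
    therefore a bound in the union.\<close>
  have lub_mono: "lub_in ?R (C (i + k)) c d e" if "lub_in ?R (C i) c d e" "c \<in> C i" "d \<in> C i" for c d e i k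
  proof (induction k)
    case (Suc k)
    obtain a b where "one_point_order ?R (C (i + k)) (x (i + k)) a b"
      using new by blast
    then show ?case
      using one_point_order.lub_in_insert Suc that mono[of i "i + k"] CS(1)[of "i + k"] by fastforce
  qed (use that in simp)
  have glb_mono: "lub_in (\<lambda>c d. ?R d c) (C (i + k)) c d e" if "lub_in (\<lambda>c d. ?R d c) (C i) c d e" "c \<in> C i" "d \<in> C i" for c d e i k
  proof (induction k)
    case (Suc k)
    obtain a b where "one_point_order (\<lambda>c d. ?R d c) (C (i + k)) (x (i + k)) b a"
      using new by blast
    then show ?case
      using one_point_order.lub_in_insert Suc that mono[of i "i + k"] CS(1)[of "i + k"] by fastforce
  qed (use that in simp)
  have union: "lub_in R (carrier P) c d e"
    if "\<And>k. lub_in R (C (i + k)) c d e" for R c d e i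
    unfolding lub_in_def
  proof (intro conjI ballI impI)
    show "e \<in> carrier P" "R c e" "R d e"
      using that[of 0] CP by (auto simp: lub_in_def)
    fix f assume f: "f \<in> carrier P" "R c f" "R d f"
    then obtain j where "f \<in> C j"
      by (auto simp: PC C_def)
    then have "f \<in> C (i + j)"
      using mono[of j "i + j"] by auto
    then show "R e f"
      using that[of j] f by (auto simp: lub_in_def)
  qed
  have lub_P: "\<exists>e\<in>C i. lub_in ?R (carrier P) c d e" "\<exists>e\<in>C i. lub_in (\<lambda>c d. ?R d c) (carrier P) c d e"
    if cd: "c \<in> C i" "d \<in> C i" for c d i
  proof -
    obtain e where e: "lub_in ?R (C i) c d e"
      using lub(1)[OF cd] by blast
    have "lub_in ?R (carrier P) c d e"
      using lub_mono[OF e cd] by (rule union)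
    then show "\<exists>e\<in>C i. lub_in ?R (carrier P) c d e"
      using e by (auto simp: lub_in_def)
    obtain e where e: "lub_in (\<lambda>c d. ?R d c) (C i) c d e"
      using lub(2)[OF cd] by blast
    have "lub_in (\<lambda>c d. ?R d c) (carrier P) c d e"
      using glb_mono[OF e cd] by (rule union)
    then show "\<exists>e\<in>C i. lub_in (\<lambda>c d. ?R d c) (carrier P) c d e"
      using e by (auto simp: lub_in_def)
  qed
  have lat: "lattice (order_of P)"
    unfolding lattice_order_of[OF G] using stage3 lub_P by meson
  have closed: "c \<squnion>\<^bsub>order_of P\<^esub> d \<in> C i" "c \<sqinter>\<^bsub>order_of P\<^esub> d \<in> C i" if cd: "c \<in> C i" "d \<in> C i" for c d i
  proof -
    have cdP: "c \<in> carrier P" "d \<in> carrier P"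
      using cd CP by auto
    obtain e where "e \<in> C i" "lub_in ?R (carrier P) c d e"
      using lub_P(1)[OF cd] by blast
    then show "c \<squnion>\<^bsub>order_of P\<^esub> d \<in> C i"
      using join_eq[OF lat cdP, of e] by simp
    obtain e where "e \<in> C i" "lub_in (\<lambda>c d. ?R d c) (carrier P) c d e"
      using lub_P(2)[OF cd] by blast
    then show "c \<sqinter>\<^bsub>order_of P\<^esub> d \<in> C i"
      using meet_eq[OF lat cdP, of e] by simp
  qed
  have "simply_connected (order_of P)"
    unfolding simply_connected_def
  proof (intro notI, elim exE)
    fix up n y
    assume cyc: "zigzag_cycle (order_of P) up n y"
    note nb = zigzag_cycle_neighbours[OF cyc]
    have "\<not> y ` {..2 * n} \<subseteq> C i" for i
    proof (induction i)
      case 0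
      show ?case
      proof
        assume a: "y ` {..2 * n} \<subseteq> C 0"
        obtain v w where vw: "v \<in> y ` {..2 * n}" "w \<in> y ` {..2 * n}" "v \<noteq> y 0" "w \<noteq> y 0"
          "y 0 = v \<sqinter>\<^bsub>order_of P\<^esub> w \<or> y 0 = v \<squnion>\<^bsub>order_of P\<^esub> w"
          using nb[of 0] by blast
        have "y 0 \<in> C 0" "v \<in> C 0" "w \<in> C 0"
          using a vw(1,2) by blast+
        \<comment> \<open>Only one element of C 0 differs from y 0, so y 0 would be the meet or join
          of that element with itself.\<close>
        then have "v = w" "v \<in> C 0"
          using vw(3,4) unfolding C0 by blast+
        then have v: "v \<noteq> y 0" "y 0 = v \<sqinter>\<^bsub>order_of P\<^esub> v \<or> y 0 = v \<squnion>\<^bsub>order_of P\<^esub> v"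
          using vw by simp_all
        have "v \<in> carrier P"
          using \<open>v \<in> C 0\<close> CP by blast
        then have "v = v \<sqinter>\<^bsub>order_of P\<^esub> v" "v = v \<squnion>\<^bsub>order_of P\<^esub> v"
          using join_eq[OF lat, of v v v] meet_eq[OF lat, of v v v] by (auto simp: lub_in_def)
        then show False
          using v by metis
      qed
    next
      case (Suc i)
      show ?case
      proof
        assume a: "y ` {..2 * n} \<subseteq> C (Suc i)"
        \<comment> \<open>By induction the newest point occurs in the cycle; its neighbours are then
          in C i, whose closure under join and meet would put x i there.\<close>
        have "x i \<in> y ` {..2 * n}"
        proof (rule ccontr)
          assume nx: "x i \<notin> y ` {..2 * n}"
          have "y ` {..2 * n} \<subseteq> insert (x i) (C i)"
            using a by (simp only: CS(1))
          then have "y ` {..2 * n} \<subseteq> C i"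
            by (rule iffD1[OF subset_insert[OF nx]])
          then show False
            using Suc by contradiction
        qed
        then obtain j where j: "j \<le> 2 * n" "y j = x i"
          by auto
        obtain v w where "v \<in> y ` {..2 * n}" "w \<in> y ` {..2 * n}" "v \<noteq> x i" "w \<noteq> x i"
          "x i = v \<sqinter>\<^bsub>order_of P\<^esub> w \<or> x i = v \<squnion>\<^bsub>order_of P\<^esub> w"
          using nb[OF j(1)] unfolding j(2) by blast
        moreover have "v \<in> C i" "w \<in> C i"
          using calculation(1-4) a CS(1)[of i] by blast+
        ultimately show False
          using closed[of v i w] CS(2)[of i] by metis
      qed
    qed
    moreover have "y ` {..2 * n} \<subseteq> carrier P"
      using cyc by (auto simp: zigzag_cycle_def zigzag_def alternating_def)
    then have "\<exists>i. y ` {..2 * n} \<subseteq> C i"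
      by (intro stage) auto
    ultimately show False by blast
  qed
  moreover have "infinite {y \<in> layer P s. lt P a y \<and> lt P y b}" if pt: "possible_type N P a b s" for a b s
  proof -
    let ?I = "{i. \<tau> i = (a, b, s)}"
    \<comment> \<open>Infinitely many uses of a type yield infinitely many elements because every
      step adds a new one.\<close>
    have "inj x"
    proof (rule linorder_injI)
      fix i j :: nat assume "i < j"
      then have "x i \<in> C j"
        using CS(1)[of i] mono[of "Suc i" j] by auto
      then show "x i \<noteq> x j"
        using CS(2)[of j] by auto
    qed
    then have "infinite (x ` ?I)"
      using all[OF pt] by (meson finite_imageD inj_on_subset subset_UNIV)
    moreover have "x ` ?I \<subseteq> {y \<in> layer P s. lt P a y \<and> lt P y b}"
    proof
      fix y assume "y \<in> x ` ?I"
      then obtain i where i: "y = x i" "\<tau> i = (a, b, s)"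
        by auto
      have ext: "possible_type N (V i) a b s" "x i \<in> layer (V (Suc i)) s"
        "\<And>c. c \<in> C i \<Longrightarrow> (lt (V (Suc i)) c (x i) \<longleftrightarrow> c = a \<or> lt (V i) c a) \<and> (lt (V (Suc i)) (x i) c \<longleftrightarrow> b = c \<or> lt (V i) b c)"
        using step[of i] i by (auto simp: simple_extension_def C_def)
      have "a \<in> C i" "b \<in> C i"
        using ext(1) possible_type_iff[OF GV[of i]] by (auto simp: C_def)
      then have "lt P a (x i)" "lt P (x i) b"
        using ext(3)[of a] ext(3)[of b] lt[of a "Suc i" "x i"] lt[of "x i" "Suc i" b] CS(1)[of i] by auto
      then show "y \<in> {y \<in> layer P s. lt P a y \<and> lt P y b}"
        using ext(2) layer[OF possible_type_indices[OF pt]] i by auto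
    qed
    ultimately show ?thesis
      using finite_subset by blast
  qed
  ultimately show ?thesis
    using G lat unfolding pseudospace_axioms_def by blast
qed

section \<open>The axioms as first-order sentences\<close>

abbreviation All_fm :: "nat \<Rightarrow> fm \<Rightarrow> fm" where
  "All_fm i \<phi> \<equiv> Neg (Exi i (Neg \<phi>))"

abbreviation Disj_fm :: "fm \<Rightarrow> fm \<Rightarrow> fm" where
  "Disj_fm \<phi> \<psi> \<equiv> Neg (Conj (Neg \<phi>) (Neg \<psi>))"

abbreviation Imp_fm :: "fm \<Rightarrow> fm \<Rightarrow> fm" where
  "Imp_fm \<phi> \<psi> \<equiv> Neg (Conj \<phi> (Neg \<psi>))"

text \<open>The empty conjunction is a valid formula without free variables or layer symbols, so it
  adds nothing to either set.\<close>

primrec Conjs :: "fm list \<Rightarrow> fm" where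
  "Conjs [] = All_fm 0 (Equal 0 0)"
| "Conjs (\<phi> # \<phi>s) = Conj \<phi> (Conjs \<phi>s)"

primrec Exs :: "nat \<Rightarrow> fm \<Rightarrow> fm" where
  "Exs 0 \<phi> = \<phi>"
| "Exs (Suc n) \<phi> = Exs n (Exi n \<phi>)"

lemma Conjs_simps [simp]:
  "sat M v (Conjs \<phi>s) \<longleftrightarrow> (\<forall>\<phi>\<in>set \<phi>s. sat M v \<phi>)"
  "free_vars (Conjs \<phi>s) = (\<Union>\<phi>\<in>set \<phi>s. free_vars \<phi>)"
  "layer_symbols (Conjs \<phi>s) = (\<Union>\<phi>\<in>set \<phi>s. layer_symbols \<phi>)"
  by (induction \<phi>s) auto

lemma Exs_simps [simp]:
  "free_vars (Exs n \<phi>) = free_vars \<phi> - {..<n}"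
  "layer_symbols (Exs n \<phi>) = layer_symbols \<phi>"
  by (induction n arbitrary: \<phi>) auto

lemma sat_Exs:
  "sat M v (Exs n \<phi>) \<longleftrightarrow> (\<exists>w. (\<forall>i<n. w i \<in> carrier M) \<and> (\<forall>i\<ge>n. w i = v i) \<and> sat M w \<phi>)"
proof (induction n arbitrary: \<phi>)
  case 0
  have "(\<forall>i\<ge>0. w i = v i) \<longleftrightarrow> w = v" for w :: "nat \<Rightarrow> 'a"
    by auto
  then show ?case by simp
next
  case (Suc n)
  have "(\<exists>w. (\<forall>i<n. w i \<in> carrier M) \<and> (\<forall>i\<ge>n. w i = v i) \<and> (\<exists>x\<in>carrier M. sat M (w(n := x)) \<phi>)) \<longleftrightarrow>
      (\<exists>w. (\<forall>i<Suc n. w i \<in> carrier M) \<and> (\<forall>i\<ge>Suc n. w i = v i) \<and> sat M w \<phi>)"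
  proof
    assume "\<exists>w. (\<forall>i<n. w i \<in> carrier M) \<and> (\<forall>i\<ge>n. w i = v i) \<and> (\<exists>x\<in>carrier M. sat M (w(n := x)) \<phi>)"
    then obtain w x where w: "\<forall>i<n. w i \<in> carrier M" "\<forall>i\<ge>n. w i = v i" "x \<in> carrier M" "sat M (w(n := x)) \<phi>"
      by blast
    then show "\<exists>w. (\<forall>i<Suc n. w i \<in> carrier M) \<and> (\<forall>i\<ge>Suc n. w i = v i) \<and> sat M w \<phi>"
      by (intro exI[of _ "w(n := x)"]) (auto simp: less_Suc_eq)
  next
    assume "\<exists>w. (\<forall>i<Suc n. w i \<in> carrier M) \<and> (\<forall>i\<ge>Suc n. w i = v i) \<and> sat M w \<phi>"
    then obtain w where w: "\<forall>i<Suc n. w i \<in> carrier M" "\<forall>i\<ge>Suc n. w i = v i" "sat M w \<phi>"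
      by blast
    have "\<forall>i\<ge>n. (w(n := v n)) i = v i"
      using w(2) by (simp add: Suc_le_eq)
    moreover have "\<forall>i<n. (w(n := v n)) i \<in> carrier M" "w n \<in> carrier M"
      using w(1) by auto
    moreover have "sat M ((w(n := v n))(n := w n)) \<phi>"
      using w(3) by simp
    ultimately show "\<exists>w. (\<forall>i<n. w i \<in> carrier M) \<and> (\<forall>i\<ge>n. w i = v i) \<and> (\<exists>x\<in>carrier M. sat M (w(n := x)) \<phi>)"
      by blast
  qed
  then show ?case
    using Suc by simp
qed

text \<open>A nonempty carrier provides an assignment; without one every formula would hold
  vacuously.\<close>

lemma holds_in_iff:
  assumes "carrier M \<noteq> {}" and sat: "\<And>v. range v \<subseteq> carrier M \<Longrightarrow> sat M v \<phi> \<longleftrightarrow> Q"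
  shows "holds_in M \<phi> \<longleftrightarrow> Q"
proof -
  obtain x where "x \<in> carrier M"
    using assms by blast
  then have "range (\<lambda>_. x) \<subseteq> carrier M"
    by auto
  then show ?thesis
    using sat unfolding holds_in_def by blast
qed

definition le_fm :: "nat \<Rightarrow> nat \<Rightarrow> fm" where
  "le_fm i j = Disj_fm (Equal i j) (LessThan i j)"

definition ge_fm :: "nat \<Rightarrow> nat \<Rightarrow> fm" where
  "ge_fm i j = le_fm j i"

text \<open>The bound variable m has to be fresh. With \<open>ge_fm\<close> for r the same formula
  describes meets.\<close>

definition lub_fm :: "(nat \<Rightarrow> nat \<Rightarrow> fm) \<Rightarrow> nat \<Rightarrow> nat \<Rightarrow> nat \<Rightarrow> nat \<Rightarrow> fm" where
  "lub_fm r m i j k = Conj (r i k) (Conj (r j k) (All_fm m (Imp_fm (Conj (r i m) (r j m)) (r k m))))"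

lemma le_fm_simps [simp]:
  "sat M v (le_fm i j) \<longleftrightarrow> v i = v j \<or> lt M (v i) (v j)"
  "free_vars (le_fm i j) = {i, j}" "layer_symbols (le_fm i j) = {}"
  by (auto simp: le_fm_def)

lemma ge_fm_simps [simp]:
  "sat M v (ge_fm i j) \<longleftrightarrow> v j = v i \<or> lt M (v j) (v i)"
  "free_vars (ge_fm i j) = {i, j}" "layer_symbols (ge_fm i j) = {}"
  by (auto simp: ge_fm_def)

lemma lub_fm_simps [simp]:
  "layer_symbols (lub_fm le_fm m i j k) = {}" "layer_symbols (lub_fm ge_fm m i j k) = {}"
  "m \<notin> {i, j, k} \<Longrightarrow> free_vars (lub_fm le_fm m i j k) = {i, j, k}"
  "m \<notin> {i, j, k} \<Longrightarrow> free_vars (lub_fm ge_fm m i j k) = {i, j, k}"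
  by (auto simp: lub_fm_def)

lemma sat_lub_fm_rel:
  assumes r: "\<And>v i j. sat M v (r i j) \<longleftrightarrow> R (v i) (v j)" and m: "m \<notin> {i, j, k}" "v k \<in> carrier M"
  shows "sat M v (lub_fm r m i j k) \<longleftrightarrow> lub_in R (carrier M) (v i) (v j) (v k)"
  using m by (simp add: lub_fm_def lub_in_def r)

lemma sat_lub_fm:
  assumes "m \<notin> {i, j, k}" "v k \<in> carrier M"
  shows "sat M v (lub_fm le_fm m i j k) \<longleftrightarrow> lub_in (\<lambda>x y. x = y \<or> lt M x y) (carrier M) (v i) (v j) (v k)"
    and "sat M v (lub_fm ge_fm m i j k) \<longleftrightarrow> lub_in (\<lambda>x y. y = x \<or> lt M y x) (carrier M) (v i) (v j) (v k)"
  using assms by (intro sat_lub_fm_rel; simp)+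

section \<open>Sentences expressing the axioms\<close>

definition irrefl_fm :: fm where
  "irrefl_fm = All_fm 0 (Neg (LessThan 0 0))"

definition trans_fm :: fm where
  "trans_fm = All_fm 0 (All_fm 1 (All_fm 2 (Imp_fm (Conj (LessThan 0 1) (LessThan 1 2)) (LessThan 0 2))))"

definition cover_fm :: "nat \<Rightarrow> fm" where
  "cover_fm N = All_fm 0 (Neg (Conjs (map (\<lambda>s. Neg (LayerAt s 0)) [-1..int N + 1])))"

definition disjoint_fm :: "int \<Rightarrow> int \<Rightarrow> fm" where
  "disjoint_fm s t = All_fm 0 (Neg (Conj (LayerAt s 0) (LayerAt t 0)))"

text \<open>Used for the pairs s, t with t \<le> s: together these sentences express that layer
  indices increase strictly along the order.\<close>

definition unordered_fm :: "int \<Rightarrow> int \<Rightarrow> fm" where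
  "unordered_fm s t = All_fm 0 (All_fm 1 (Neg (Conj (LessThan 0 1) (Conj (LayerAt s 0) (LayerAt t 1)))))"

definition extremum_fm :: "(nat \<Rightarrow> nat \<Rightarrow> fm) \<Rightarrow> int \<Rightarrow> fm" where
  "extremum_fm r s = Exi 0 (Conj (LayerAt s 0) (All_fm 1 (r 0 1)))"

definition lubs_fm :: "(nat \<Rightarrow> nat \<Rightarrow> fm) \<Rightarrow> fm" where
  "lubs_fm r = All_fm 0 (All_fm 1 (Exi 2 (lub_fm r 3 0 1 2)))"

text \<open>Variables 0 to 2n hold the entries, and 2n + 1 is the bound variable of
  \<open>lub_fm\<close>. Sinks are meets, hence \<open>ge_fm\<close>.\<close>

definition cycle_conds :: "bool \<Rightarrow> nat \<Rightarrow> fm" where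
  "cycle_conds up n = Conjs (
     map (\<lambda>i. if is_sink up i then le_fm i (i + 1) else le_fm (i + 1) i) [0..<2 * n] @
     map (\<lambda>i. Neg (Equal i (i + 1))) [0..<2 * n] @
     map (\<lambda>i. lub_fm (if is_sink up i then ge_fm else le_fm) (2 * n + 1) (i - 1) (i + 1) i) [1..<2 * n] @
     [Equal 0 (2 * n), lub_fm (if is_sink up 0 then ge_fm else le_fm) (2 * n + 1) (2 * n - 1) 1 0])"

definition no_cycle_fm :: "bool \<Rightarrow> nat \<Rightarrow> fm" where
  "no_cycle_fm up n = Neg (Exs (2 * n + 1) (cycle_conds up n))"

text \<open>The m witnesses occupy the variables below m, exactly those bound by
  \<open>Exs m\<close>; the ends of the interval are placed at m and m + 1.\<close>

definition between_fm :: "int \<Rightarrow> int \<Rightarrow> int \<Rightarrow> nat \<Rightarrow> fm" where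
  "between_fm p q s m = All_fm m (All_fm (m + 1)
     (Imp_fm (Conj (LessThan m (m + 1)) (Conj (LayerAt p m) (LayerAt q (m + 1))))
       (Exs m (Conjs (
         map (\<lambda>i. Conj (LayerAt s i) (Conj (LessThan m i) (LessThan i (m + 1)))) [0..<m] @
         concat (map (\<lambda>j. map (\<lambda>i. Neg (Equal i j)) [0..<j]) [0..<m]))))))"

lemma sentences:
  "sentence N irrefl_fm" "sentence N trans_fm" "sentence N (cover_fm N)"
  "s \<in> indices N \<Longrightarrow> t \<in> indices N \<Longrightarrow> sentence N (disjoint_fm s t)"
  "s \<in> indices N \<Longrightarrow> t \<in> indices N \<Longrightarrow> sentence N (unordered_fm s t)"
  "s \<in> indices N \<Longrightarrow> sentence N (extremum_fm le_fm s)"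
  "s \<in> indices N \<Longrightarrow> sentence N (extremum_fm ge_fm s)"
  "sentence N (lubs_fm le_fm)" "sentence N (lubs_fm ge_fm)"
  by (auto simp: sentence_def irrefl_fm_def trans_fm_def cover_fm_def disjoint_fm_def unordered_fm_def
      extremum_fm_def lubs_fm_def)

lemma sentence_no_cycle_fm:
  assumes "1 \<le> n"
  shows "sentence N (no_cycle_fm up n)"
proof -
  have "free_vars (cycle_conds up n) \<subseteq> {..<2 * n + 1}" "layer_symbols (cycle_conds up n) = {}"
    using assms by (auto simp: cycle_conds_def split: if_splits)
  then show ?thesis
    by (auto simp: sentence_def no_cycle_fm_def)
qed

lemma sentence_between_fm:
  assumes "p \<in> indices N" "q \<in> indices N" "s \<in> indices N"
  shows "sentence N (between_fm p q s m)"
  using assms by (auto simp: sentence_def between_fm_def)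

section \<open>Meaning of the sentences in a structure\<close>

lemma holds_in_simps:
  assumes "carrier M \<noteq> {}"
  shows "holds_in M irrefl_fm \<longleftrightarrow> irreflp_on (carrier M) (lt M)"
    "holds_in M trans_fm \<longleftrightarrow> transp_on (carrier M) (lt M)"
    "holds_in M (cover_fm N) \<longleftrightarrow> (\<Union>s\<in>indices N. layer M s) = carrier M"
    "holds_in M (disjoint_fm s t) \<longleftrightarrow> layer M s \<inter> layer M t = {}"
    "holds_in M (unordered_fm s t) \<longleftrightarrow> (\<forall>x\<in>layer M s. \<forall>y\<in>layer M t. \<not> lt M x y)"
    "holds_in M (extremum_fm le_fm s) \<longleftrightarrow> (\<exists>z. least (order_of M) z (carrier M) \<and> z \<in> layer M s)"
    "holds_in M (extremum_fm ge_fm s) \<longleftrightarrow> (\<exists>z. greatest (order_of M) z (carrier M) \<and> z \<in> layer M s)"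
    "holds_in M (lubs_fm le_fm) \<longleftrightarrow>
      (\<forall>x\<in>carrier M. \<forall>y\<in>carrier M. \<exists>e. lub_in (\<lambda>x y. x = y \<or> lt M x y) (carrier M) x y e)"
    "holds_in M (lubs_fm ge_fm) \<longleftrightarrow>
      (\<forall>x\<in>carrier M. \<forall>y\<in>carrier M. \<exists>e. lub_in (\<lambda>x y. y = x \<or> lt M y x) (carrier M) x y e)"
proof -
  have [simp]: "(\<exists>x\<in>layer M s. x \<in> carrier M \<and> Q x) \<longleftrightarrow> (\<exists>x\<in>layer M s. Q x)" for s Q
    by (auto dest: layer_subset)
  show "holds_in M irrefl_fm \<longleftrightarrow> irreflp_on (carrier M) (lt M)"
    by (rule holds_in_iff[OF assms]) (auto simp: irrefl_fm_def irreflp_on_def)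
  show "holds_in M trans_fm \<longleftrightarrow> transp_on (carrier M) (lt M)"
    by (rule holds_in_iff[OF assms]) (simp add: trans_fm_def transp_on_def)
  show "holds_in M (cover_fm N) \<longleftrightarrow> (\<Union>s\<in>indices N. layer M s) = carrier M"
    by (rule holds_in_iff[OF assms]) (auto simp: cover_fm_def layer_def)
  show "holds_in M (disjoint_fm s t) \<longleftrightarrow> layer M s \<inter> layer M t = {}"
    by (rule holds_in_iff[OF assms]) (auto simp: disjoint_fm_def layer_def)
  show "holds_in M (unordered_fm s t) \<longleftrightarrow> (\<forall>x\<in>layer M s. \<forall>y\<in>layer M t. \<not> lt M x y)"
    by (rule holds_in_iff[OF assms]) (auto simp: unordered_fm_def layer_def)
  show "holds_in M (extremum_fm le_fm s) \<longleftrightarrow> (\<exists>z. least (order_of M) z (carrier M) \<and> z \<in> layer M s)"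
    by (rule holds_in_iff[OF assms]) (auto simp: extremum_fm_def least_def layer_def)
  show "holds_in M (extremum_fm ge_fm s) \<longleftrightarrow> (\<exists>z. greatest (order_of M) z (carrier M) \<and> z \<in> layer M s)"
    by (rule holds_in_iff[OF assms]) (auto simp: extremum_fm_def greatest_def layer_def)
  have e: "lub_in R (carrier M) x y e \<longleftrightarrow> e \<in> carrier M \<and> lub_in R (carrier M) x y e" for R x y e
    by (auto simp: lub_in_def)
  show "holds_in M (lubs_fm le_fm) \<longleftrightarrow>
      (\<forall>x\<in>carrier M. \<forall>y\<in>carrier M. \<exists>e. lub_in (\<lambda>x y. x = y \<or> lt M x y) (carrier M) x y e)"
    by (rule holds_in_iff[OF assms], subst e) (simp add: lubs_fm_def sat_lub_fm Bex_def Ball_def cong: conj_cong)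
  show "holds_in M (lubs_fm ge_fm) \<longleftrightarrow>
      (\<forall>x\<in>carrier M. \<forall>y\<in>carrier M. \<exists>e. lub_in (\<lambda>x y. y = x \<or> lt M y x) (carrier M) x y e)"
    by (rule holds_in_iff[OF assms], subst e) (simp add: lubs_fm_def sat_lub_fm Bex_def Ball_def cong: conj_cong)
qed

lemma sat_cycle_conds:
  assumes lat: "lattice (order_of M)" and n: "1 \<le> n" and w: "\<And>i. i \<le> 2 * n \<Longrightarrow> w i \<in> carrier M"
  shows "sat M w (cycle_conds up n) \<longleftrightarrow> zigzag_cycle (order_of M) up n w"
proof -
  have inner: "sat M w (lub_fm (if is_sink up k then ge_fm else le_fm) (2 * n + 1) i j k) \<longleftrightarrow>
      w k = (if is_sink up k then w i \<sqinter>\<^bsub>order_of M\<^esub> w j else w i \<squnion>\<^bsub>order_of M\<^esub> w j)"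
    if "i \<le> 2 * n" "j \<le> 2 * n" "k \<le> 2 * n" for i j k
    using sat_lub_fm[of "2 * n + 1" i j k w M] join_eq[OF lat w[OF that(1)] w[OF that(2)], of "w k"]
      meet_eq[OF lat w[OF that(1)] w[OF that(2)], of "w k"] w[OF that(3)] that by simp
  have inner_i: "sat M w (lub_fm (if is_sink up i then ge_fm else le_fm) (2 * n + 1) (i - 1) (i + 1) i) \<longleftrightarrow>
      w i = (if is_sink up i then w (i - 1) \<sqinter>\<^bsub>order_of M\<^esub> w (i + 1) else w (i - 1) \<squnion>\<^bsub>order_of M\<^esub> w (i + 1))"
    if "0 < i \<and> i < 2 * n" for i
    using that by (intro inner) auto
  have inner_all: "(\<forall>i. 0 < i \<and> i < 2 * n \<longrightarrow> sat M w (lub_fm (if is_sink up i then ge_fm else le_fm) (2 * n + 1) (i - 1) (i + 1) i)) \<longleftrightarrow>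
      (\<forall>i. 0 < i \<and> i < 2 * n \<longrightarrow>
        w i = (if is_sink up i then w (i - 1) \<sqinter>\<^bsub>order_of M\<^esub> w (i + 1) else w (i - 1) \<squnion>\<^bsub>order_of M\<^esub> w (i + 1)))"
    by (rule iff_allI, rule imp_cong, rule refl, rule inner_i)
  have inner0: "sat M w (lub_fm (if is_sink up 0 then ge_fm else le_fm) (2 * n + 1) (2 * n - 1) 1 0) \<longleftrightarrow>
      w 0 = (if is_sink up 0 then w (2 * n - 1) \<sqinter>\<^bsub>order_of M\<^esub> w 1 else w (2 * n - 1) \<squnion>\<^bsub>order_of M\<^esub> w 1)"
    using n by (intro inner) auto
  have "sat M w (cycle_conds up n) \<longleftrightarrow>
      (\<forall>i<2 * n. if is_sink up i then w i \<sqsubseteq>\<^bsub>order_of M\<^esub> w (i + 1) else w (i + 1) \<sqsubseteq>\<^bsub>order_of M\<^esub> w i) \<and>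
      (\<forall>i<2 * n. w i \<noteq> w (i + 1)) \<and>
      (\<forall>i. 0 < i \<and> i < 2 * n \<longrightarrow> sat M w (lub_fm (if is_sink up i then ge_fm else le_fm) (2 * n + 1) (i - 1) (i + 1) i)) \<and>
      w 0 = w (2 * n) \<and> sat M w (lub_fm (if is_sink up 0 then ge_fm else le_fm) (2 * n + 1) (2 * n - 1) 1 0)"
  proof -
    have "sat M w (if is_sink up i then le_fm i (i + 1) else le_fm (i + 1) i) \<longleftrightarrow>
        (if is_sink up i then w i \<sqsubseteq>\<^bsub>order_of M\<^esub> w (i + 1) else w (i + 1) \<sqsubseteq>\<^bsub>order_of M\<^esub> w i)" for i
      by (cases "is_sink up i") simp_all
    moreover have "i \<in> {0..<2 * n} \<longleftrightarrow> i < 2 * n" "i \<in> {1..<2 * n} \<longleftrightarrow> 0 < i \<and> i < 2 * n" for i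
      by auto
    ultimately show ?thesis
      unfolding cycle_conds_def
      by (simp only: Conjs_simps set_append set_map set_upt list.set ball_Un ball_simps sat.simps simp_thms)
        (simp only: Ball_def)
  qed
  also have "\<dots> \<longleftrightarrow>
      (\<forall>i<2 * n. if is_sink up i then w i \<sqsubseteq>\<^bsub>order_of M\<^esub> w (i + 1) else w (i + 1) \<sqsubseteq>\<^bsub>order_of M\<^esub> w i) \<and>
      (\<forall>i<2 * n. w i \<noteq> w (i + 1)) \<and>
      (\<forall>i. 0 < i \<and> i < 2 * n \<longrightarrow>
        w i = (if is_sink up i then w (i - 1) \<sqinter>\<^bsub>order_of M\<^esub> w (i + 1) else w (i - 1) \<squnion>\<^bsub>order_of M\<^esub> w (i + 1))) \<and>
      w 0 = w (2 * n) \<and>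
      w 0 = (if is_sink up 0 then w (2 * n - 1) \<sqinter>\<^bsub>order_of M\<^esub> w 1 else w (2 * n - 1) \<squnion>\<^bsub>order_of M\<^esub> w 1)"
    unfolding inner0 inner_all by (rule refl)
  also have "\<dots> \<longleftrightarrow> zigzag_cycle (order_of M) up n w"
    unfolding zigzag_cycle_def zigzag_def alternating_def using n w by auto
  finally show ?thesis .
qed

lemma holds_in_no_cycle_fm:
  assumes lat: "lattice (order_of M)" and n: "1 \<le> n" and ne: "carrier M \<noteq> {}"
  shows "holds_in M (no_cycle_fm up n) \<longleftrightarrow> (\<nexists>x. zigzag_cycle (order_of M) up n x)"
proof (rule holds_in_iff[OF ne])
  fix v :: "nat \<Rightarrow> 'a"
  have "(\<exists>w. (\<forall>i<2 * n + 1. w i \<in> carrier M) \<and> (\<forall>i\<ge>2 * n + 1. w i = v i) \<and> sat M w (cycle_conds up n)) \<longleftrightarrow>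
      (\<exists>x. zigzag_cycle (order_of M) up n x)"
  proof
    assume "\<exists>x. zigzag_cycle (order_of M) up n x"
    then obtain x where x: "zigzag_cycle (order_of M) up n x"
      by blast
    then have C: "x i \<in> carrier M" if "i \<le> 2 * n" for i
      using that by (auto simp: zigzag_cycle_def zigzag_def alternating_def)
    \<comment> \<open>\<open>sat_Exs\<close> demands agreement with v beyond the quantified
      variables, where a given cycle may take arbitrary values.\<close>
    define w where "w i = (if i < 2 * n + 1 then x i else v i)" for i
    have "free_vars (cycle_conds up n) \<subseteq> {..<2 * n + 1}"
      using n by (auto simp: cycle_conds_def split: if_splits)
    then have "sat M w (cycle_conds up n) \<longleftrightarrow> sat M x (cycle_conds up n)"
      by (intro sat_cong) (auto simp: w_def)
    then have "sat M w (cycle_conds up n)"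
      using sat_cycle_conds[OF lat n C] x by simp
    then show "\<exists>w. (\<forall>i<2 * n + 1. w i \<in> carrier M) \<and> (\<forall>i\<ge>2 * n + 1. w i = v i) \<and> sat M w (cycle_conds up n)"
      using C by (intro exI[of _ w]) (auto simp: w_def)
  next
    assume "\<exists>w. (\<forall>i<2 * n + 1. w i \<in> carrier M) \<and> (\<forall>i\<ge>2 * n + 1. w i = v i) \<and> sat M w (cycle_conds up n)"
    then obtain w where "\<forall>i<2 * n + 1. w i \<in> carrier M" "sat M w (cycle_conds up n)"
      by blast
    then show "\<exists>x. zigzag_cycle (order_of M) up n x"
      using sat_cycle_conds[OF lat n, of w up] by auto
  qed
  then show "sat M v (no_cycle_fm up n) \<longleftrightarrow> (\<nexists>x. zigzag_cycle (order_of M) up n x)"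
    by (simp add: no_cycle_fm_def sat_Exs del: Exs.simps)
qed

text \<open>Replaces infinity by a scheme with one condition for each m, each expressible by a
  sentence.\<close>

lemma infinite_iff_distinct:
  "infinite S \<longleftrightarrow> (\<forall>m. \<exists>w :: nat \<Rightarrow> 'a. (\<forall>i<m. w i \<in> S) \<and> (\<forall>j<m. \<forall>i<j. w i \<noteq> w j))"
proof
  assume "infinite S"
  then obtain f :: "nat \<Rightarrow> 'a" where "inj f" "range f \<subseteq> S"
    using infinite_countable_subset by blast
  then show "\<forall>m. \<exists>w :: nat \<Rightarrow> 'a. (\<forall>i<m. w i \<in> S) \<and> (\<forall>j<m. \<forall>i<j. w i \<noteq> w j)"
    by (intro allI exI[of _ f]) (auto simp: inj_def)
next
  assume R: "\<forall>m. \<exists>w :: nat \<Rightarrow> 'a. (\<forall>i<m. w i \<in> S) \<and> (\<forall>j<m. \<forall>i<j. w i \<noteq> w j)"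
  show "infinite S"
  proof
    assume fin: "finite S"
    obtain w :: "nat \<Rightarrow> 'a" where w: "\<forall>i<Suc (card S). w i \<in> S" "\<forall>j<Suc (card S). \<forall>i<j. w i \<noteq> w j"
      using R by blast
    have "inj_on w {..<Suc (card S)}"
      using w(2) by (intro linorder_inj_onI') auto
    then have "card {..<Suc (card S)} \<le> card S"
      using w(1) fin by (intro card_inj_on_le[of w]) auto
    then show False by simp
  qed
qed

lemma holds_in_between_fm:
  assumes ne: "carrier M \<noteq> {}"
  shows "holds_in M (between_fm p q s m) \<longleftrightarrow>
    (\<forall>a\<in>layer M p. \<forall>b\<in>layer M q. lt M a b \<longrightarrow>
      (\<exists>w :: nat \<Rightarrow> 'a. (\<forall>i<m. w i \<in> {x \<in> layer M s. lt M a x \<and> lt M x b}) \<and> (\<forall>j<m. \<forall>i<j. w i \<noteq> w j)))"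
proof (rule holds_in_iff[OF ne])
  fix v :: "nat \<Rightarrow> 'a"
  let ?\<phi> = "Exs m (Conjs (
         map (\<lambda>i. Conj (LayerAt s i) (Conj (LessThan m i) (LessThan i (m + 1)))) [0..<m] @
         concat (map (\<lambda>j. map (\<lambda>i. Neg (Equal i j)) [0..<j]) [0..<m])))"
  have conds: "sat M w (Conjs (
         map (\<lambda>i. Conj (LayerAt s i) (Conj (LessThan m i) (LessThan i (m + 1)))) [0..<m] @
         concat (map (\<lambda>j. map (\<lambda>i. Neg (Equal i j)) [0..<j]) [0..<m]))) \<longleftrightarrow>
      (\<forall>i<m. w i \<in> layer M s \<and> lt M (w m) (w i) \<and> lt M (w i) (w (m + 1))) \<and> (\<forall>j<m. \<forall>i<j. w i \<noteq> w j)" for w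
    by (simp only: Conjs_simps set_append set_concat set_map set_upt ball_Un ball_simps sat.simps image_image) auto
  have *: "sat M (v(m := a, m + 1 := b)) ?\<phi> \<longleftrightarrow>
      (\<exists>w :: nat \<Rightarrow> 'a. (\<forall>i<m. w i \<in> {x \<in> layer M s. lt M a x \<and> lt M x b}) \<and> (\<forall>j<m. \<forall>i<j. w i \<noteq> w j))" for a b
  proof
    assume "sat M (v(m := a, m + 1 := b)) ?\<phi>"
    then obtain w where w: "\<forall>i\<ge>m. w i = (v(m := a, m + 1 := b)) i"
      "\<forall>i<m. w i \<in> layer M s \<and> lt M (w m) (w i) \<and> lt M (w i) (w (m + 1))" "\<forall>j<m. \<forall>i<j. w i \<noteq> w j"
      unfolding sat_Exs conds by (elim exE conjE)
    have "w m = a" "w (m + 1) = b"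
      using w(1) by auto
    then show "\<exists>w :: nat \<Rightarrow> 'a. (\<forall>i<m. w i \<in> {x \<in> layer M s. lt M a x \<and> lt M x b}) \<and> (\<forall>j<m. \<forall>i<j. w i \<noteq> w j)"
      using w by auto
  next
    assume "\<exists>w :: nat \<Rightarrow> 'a. (\<forall>i<m. w i \<in> {x \<in> layer M s. lt M a x \<and> lt M x b}) \<and> (\<forall>j<m. \<forall>i<j. w i \<noteq> w j)"
    then obtain w :: "nat \<Rightarrow> 'a" where w: "\<forall>i<m. w i \<in> {x \<in> layer M s. lt M a x \<and> lt M x b}" "\<forall>j<m. \<forall>i<j. w i \<noteq> w j"
      by blast
    define w' where "w' i = (if i < m then w i else (v(m := a, m + 1 := b)) i)" for i
    have w': "w' m = a" "w' (Suc m) = b" "\<And>i. i < m \<Longrightarrow> w' i = w i"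
      by (auto simp: w'_def)
    show "sat M (v(m := a, m + 1 := b)) ?\<phi>"
      unfolding sat_Exs conds
    proof (intro exI[of _ w'] conjI)
      show "\<forall>i<m. w' i \<in> carrier M"
        using w w' layer_subset[of _ M s] by auto
      show "\<forall>i\<ge>m. w' i = (v(m := a, m + 1 := b)) i"
        by (auto simp: w'_def)
    qed (use w w' in auto)
  qed
  have fv: "(v(m := a)) (Suc m := b) = v(m := a, m + 1 := b)" for a b
    by simp
  show "sat M v (between_fm p q s m) \<longleftrightarrow> (\<forall>a\<in>layer M p. \<forall>b\<in>layer M q. lt M a b \<longrightarrow>
      (\<exists>w :: nat \<Rightarrow> 'a. (\<forall>i<m. w i \<in> {x \<in> layer M s. lt M a x \<and> lt M x b}) \<and> (\<forall>j<m. \<forall>i<j. w i \<noteq> w j)))"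
    unfolding *[symmetric] between_fm_def by (auto simp: layer_def simp del: Exs.simps Conjs_simps)
qed

text \<open>Every axiom is a set of sentences true in P. The lattice property of M precedes simple
  connectedness, because the cycle formulas describe joins and meets by bounds, which match the
  lattice operations only in a lattice.\<close>

theorem pseudospace_axioms_transfer:
  assumes P: "pseudospace_axioms N P" and ne: "carrier P \<noteq> {}" "carrier M \<noteq> {}"
    and holds: "\<And>\<phi>. sentence N \<phi> \<Longrightarrow> holds_in P \<phi> \<Longrightarrow> holds_in M \<phi>"
  shows "pseudospace_axioms N M"
proof -
  have GP: "N_geometry N P" and latP: "lattice (order_of P)" and scP: "simply_connected (order_of P)"
    and infP: "\<And>a b s. possible_type N P a b s \<Longrightarrow> infinite {x \<in> layer P s. lt P a x \<and> lt P x b}"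
    using P unfolding pseudospace_axioms_def by blast+
  have G: "N_geometry N M"
    unfolding N_geometry_def
  proof (intro conjI)
    have GP': "irreflp_on (carrier P) (lt P)" "transp_on (carrier P) (lt P)"
      "(\<Union>s\<in>indices N. layer P s) = carrier P"
      "\<exists>z. least (order_of P) z (carrier P) \<and> z \<in> layer P (- 1)"
      "\<exists>u. greatest (order_of P) u (carrier P) \<and> u \<in> layer P (int N + 1)"
      using GP unfolding N_geometry_def by blast+
    note iff = holds_in_simps[OF ne(1)] holds_in_simps[OF ne(2)]
    show "irreflp_on (carrier M) (lt M)"
      using holds[OF sentences(1)] GP'(1) unfolding iff by blast
    show "transp_on (carrier M) (lt M)"
      using holds[OF sentences(2)] GP'(2) unfolding iff by blast
    show "(\<Union>s\<in>indices N. layer M s) = carrier M"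
      using holds[OF sentences(3)] GP'(3) unfolding iff by blast
    show "disjoint_family_on (layer M) (indices N)"
      unfolding disjoint_family_on_def
    proof (intro ballI impI)
      fix s t assume st: "s \<in> indices N" "t \<in> indices N" "s \<noteq> t"
      then have "layer P s \<inter> layer P t = {}"
        using GP unfolding N_geometry_def disjoint_family_on_def by blast
      then show "layer M s \<inter> layer M t = {}"
        using holds[OF sentences(4)[OF st(1,2)]] unfolding iff by blast
    qed
    show "\<forall>s\<in>indices N. \<forall>t\<in>indices N. \<forall>x\<in>layer M s. \<forall>y\<in>layer M t. lt M x y \<longrightarrow> s < t"
    proof (intro ballI impI, rule ccontr)
      fix s t x y assume st: "s \<in> indices N" "t \<in> indices N" "x \<in> layer M s" "y \<in> layer M t" "lt M x y" "\<not> s < t"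
      then have "\<forall>x\<in>layer P s. \<forall>y\<in>layer P t. \<not> lt P x y"
        using GP unfolding N_geometry_def by blast
      then show False
        using holds[OF sentences(5)[OF st(1,2)]] st unfolding iff by blast
    qed
    have i: "-1 \<in> indices N" "int N + 1 \<in> indices N"
      by auto
    show "\<exists>z. least (order_of M) z (carrier M) \<and> z \<in> layer M (- 1)"
      using holds[OF sentences(6)[OF i(1)]] GP'(4) unfolding iff by blast
    show "\<exists>u. greatest (order_of M) u (carrier M) \<and> u \<in> layer M (int N + 1)"
      using holds[OF sentences(7)[OF i(2)]] GP'(5) unfolding iff by blast
  qed
  have lat: "lattice (order_of M)"
    using latP holds[OF sentences(8)] holds[OF sentences(9)]
    unfolding lattice_order_of[OF G] lattice_order_of[OF GP] holds_in_simps[OF ne(1)] holds_in_simps[OF ne(2)]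
    by blast
  have "simply_connected (order_of M)"
    unfolding simply_connected_def
  proof (intro notI, elim exE)
    fix up n x
    assume x: "zigzag_cycle (order_of M) up n x"
    then have n: "1 \<le> n"
      by (simp add: zigzag_cycle_def)
    have "holds_in P (no_cycle_fm up n)"
      using scP unfolding holds_in_no_cycle_fm[OF latP n ne(1)] simply_connected_def by blast
    then have "holds_in M (no_cycle_fm up n)"
      by (rule holds[OF sentence_no_cycle_fm[OF n]])
    then show False
      using x unfolding holds_in_no_cycle_fm[OF lat n ne(2)] by blast
  qed
  moreover have "infinite {x \<in> layer M s. lt M a x \<and> lt M x b}" if pt: "possible_type N M a b s" for a b s
  proof -
    obtain p q where pq: "p \<in> indices N" "q \<in> indices N" "a \<in> layer M p" "b \<in> layer M q" "p < s" "s < q" "lt M a b"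
      using pt unfolding possible_type_def by blast
    have s: "s \<in> indices N"
      using possible_type_indices[OF pt] .
    have "holds_in P (between_fm p q s m)" for m
      unfolding holds_in_between_fm[OF ne(1)]
    proof (intro ballI impI)
      fix c d assume "c \<in> layer P p" "d \<in> layer P q" "lt P c d"
      then have "possible_type N P c d s"
        using pq unfolding possible_type_def by blast
      then show "\<exists>w. (\<forall>i<m. w i \<in> {x \<in> layer P s. lt P c x \<and> lt P x d}) \<and> (\<forall>j<m. \<forall>i<j. w i \<noteq> w j)"
        using infP infinite_iff_distinct by blast
    qed
    then have "holds_in M (between_fm p q s m)" for m
      using holds[OF sentence_between_fm[OF pq(1,2) s]] by blast
    then show ?thesis
      unfolding holds_in_between_fm[OF ne(2)] infinite_iff_distinct using pq by blast
  qed
  ultimately show ?thesis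
    using G lat unfolding pseudospace_axioms_def by blast
qed

theorem theorem3p1:
  fixes N :: nat and P :: "'p layered" and M :: "'m layered"
  assumes "universal_pseudospace N P"
    and "carrier M \<noteq> {}"
  shows "is_model_of M (complete_theory N P) \<longleftrightarrow>
      N_geometry N M \<and>
      (lattice (order_of M) \<and> simply_connected (order_of M)) \<and>
      (\<forall>a b s. possible_type N M a b s \<longrightarrow> infinite {x \<in> layer M s. lt M a x \<and> lt M x b})"
proof -
  have P: "pseudospace_axioms N P"
    using universal_pseudospace_axioms[OF assms(1)] .
  then obtain z where "z \<in> layer P (-1)"
    unfolding pseudospace_axioms_def N_geometry_def by blast
  then have ne: "carrier P \<noteq> {}"
    using layer_subset[of z P "-1"] by blast
  \<comment> \<open>One direction holds because the axioms are sentences of the theory, the other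
    because P is itself a model of the axioms and any two models satisfy the same sentences.\<close>
  have "is_model_of M (complete_theory N P) \<longleftrightarrow> pseudospace_axioms N M"
  proof
    assume "is_model_of M (complete_theory N P)"
    then have "holds_in M \<phi>" if "sentence N \<phi>" "holds_in P \<phi>" for \<phi>
      using that by (simp add: is_model_of_def complete_theory_def)
    then show "pseudospace_axioms N M"
      by (rule pseudospace_axioms_transfer[OF P ne assms(2)])
  next
    assume M: "pseudospace_axioms N M"
    show "is_model_of M (complete_theory N P)"
      using pseudospace_axioms_complete[OF P M] unfolding is_model_of_def complete_theory_def by blast
  qed
  then show ?thesis
    unfolding pseudospace_axioms_def .
qed

end
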